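(* Assume that the diffusion coefficients are constant, $\sigma_{i,j}(x)\equiv\sigma_{i,j}$ for all $i,j=1,\dots,d$, and that the system of SDEs $$\mathrm{d}X_i(t)=\Big\{\sum_{j\neq i}\frac{\gamma_{i,j}}{X_i(t)-X_j(t)}+b_i(X(t))\Big\}\mathrm{d}t+\sum_{j=1}^d\sigma_{i,j}\,\mathrm{d}W_j(t),\qquad i=1,\dots,d,$$ has a unique strong solution $X$ in $\Delta_d$ on $[0,T]$. Let $p\ge2$ and suppose that, with $\hat p=4p\ (\ge 8)$, there exists a constant $0<\hat C<\infty$ such that $$\sup_{t\in[0,T]}\mathbb{E}[|X(t)|^{\hat p}]+\max_{1\le i<d}\ \sup_{t\in[0,T]}\mathbb{E}\big[|X_i(t)-X_{i+1}(t)|^{-\hat p}\big]<\hat C$$ and $$\mathbb{E}[|X(t)-X(s)|^{\hat p}]\le\hat C|t-s|^{\hat p/2}\quad\text{for all }0\le s<t\le T.$$ Suppose moreover that $b_i\in C_b^2(\mathbb{R}^d;\mathbb{R})$ for $i=1,\dots,d$. Let $X^{(n)}$ be the semi-implicit Euler-Maruyama scheme defined in the context. Then there exists a constant $C>0$, which depends on $d$ (and not on $n$), such that for any $n\in\mathbb{N}$ with $T/n\le1$, $$\mathbb{E}\Big[\sup_{k=1,\dots,n}\big|X(t_k^{(n)})-X^{(n)}(t_k^{(n)})\big|^p\Big]^{1/p}\le\frac{C}{n}.$$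
   Context: Let $d\ge 2$, $T>0$, $\Delta_d=\{(x_1,\dots,x_d)^*\in\mathbb{R}^d: x_1<x_2<\cdots<x_d\}$, and let $|\cdot|$ be the Euclidean norm. $C_b^2(\mathbb{R}^d;\mathbb{R})$ denotes the twice continuously differentiable functions that are bounded together with their partial derivatives up to order 2. $W=(W_1,\dots,W_d)^*$ is a $d$-dimensional standard Brownian motion on a probability space $(\Omega,\mathcal F,\mathbb P)$ with a filtration $(\mathcal F_t)_{t\ge0}$ satisfying the usual conditions. Standing assumptions: (A1) $X(0)\in\Delta_d$ almost surely; (A2) $\gamma_{i,j}=\gamma_{j,i}\ge0$ are constants for $i\ne j$, with $\gamma_{i,i+1}>0$ for $i=1,\dots,d-1$; (A3) the functions $b_i:\mathbb{R}^d\to\mathbb{R}$ are globally Lipschitz continuous; (A4) the functions $\sigma_{i,j}:\mathbb{R}^d\to\mathbb{R}$ are globally Lipschitz continuous and bounded. Semi-implicit Euler-Maruyama scheme: for $n\in\mathbb{N}$ put $t_k^{(n)}=kT/n$ and $X^{(n)}(0)=X(0)$; for $k=0,\dots,n-1$, $X^{(n)}(t_{k+1}^{(n)})$ is the unique solution in $\Delta_d$ of the system ($i=1,\dots,d$) $$X_i^{(n)}(t_{k+1}^{(n)})=X_i^{(n)}(t_k^{(n)})+\Big\{\sum_{j\ne i}\frac{\gamma_{i,j}}{X_i^{(n)}(t_{k+1}^{(n)})-X_j^{(n)}(t_{k+1}^{(n)})}+b_i\big(X^{(n)}(t_k^{(n)})\big)\Big\}\frac Tn+\sum_{j=1}^d\sigma_{i,j}\big(X^{(n)}(t_k^{(n)})\big)\big\{W_j(t_{k+1}^{(n)})-W_j(t_k^{(n)})\big\}.$$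 (It is known that this system has exactly one solution in $\Delta_d$.) *)

theory Defs
  imports "HOL-Probability.Probability"
begin

text \<open>
  Coordinates are indexed by a finite linearly ordered type \<^typ>\<open>'n\<close> with d = CARD('n) elements,
  which is order isomorphic to {1, ..., d}; the pairs (i, i+1) are those related by \<open>adjacent\<close>.
\<close>

definition adjacent :: "'n::linorder \<Rightarrow> 'n \<Rightarrow> bool" where
  "adjacent i j \<longleftrightarrow> i < j \<and> {i<..<j} = {}"

definition Delta :: "(real ^ 'n::{finite,linorder}) set" where
  "Delta = {x. \<forall>i j. i < j \<longrightarrow> x $ i < x $ j}"

text \<open>\<open>g\<close> is the gradient of \<open>f\<close> and \<open>H\<close> its Hessian matrix; their entries are the partial
  derivatives of orders 1 and 2.\<close>

definition Cb2 :: "(real ^ 'n \<Rightarrow> real) \<Rightarrow> bool" where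
  "Cb2 f \<longleftrightarrow>
    (\<exists>(g :: real ^ 'n \<Rightarrow> real ^ 'n) (H :: real ^ 'n \<Rightarrow> real ^ 'n ^ 'n).
      (\<forall>x. (f has_derivative (\<lambda>h. g x \<bullet> h)) (at x)) \<and>
      (\<forall>x. (g has_derivative (\<lambda>h. H x *v h)) (at x)) \<and>
      continuous_on UNIV H \<and>
      bounded (range f) \<and> bounded (range g) \<and> bounded (range H))"

text \<open>Time is the half-line [0, \<open>\<infinity>\<close>), embedded in \<^typ>\<open>real\<close>: values at negative times are
  irrelevant in everything below.\<close>

definition usual_filtration :: "'a measure \<Rightarrow> (real \<Rightarrow> 'a measure) \<Rightarrow> bool" where
  "usual_filtration M F \<longleftrightarrow>
    (\<forall>t\<ge>0. subalgebra M (F t)) \<and>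
    (\<forall>s t. 0 \<le> s \<and> s \<le> t \<longrightarrow> sets (F s) \<subseteq> sets (F t)) \<and>
    (\<forall>t\<ge>0. sets (F t) = (\<Inter>u\<in>{t<..}. sets (F u))) \<and>
    complete_measure M \<and> null_sets M \<subseteq> sets (F 0)"

definition standard_brownian_motion ::
  "'a measure \<Rightarrow> (real \<Rightarrow> 'a measure) \<Rightarrow> (real \<Rightarrow> 'a \<Rightarrow> real ^ 'n::finite) \<Rightarrow> bool" where
  "standard_brownian_motion M F W \<longleftrightarrow>
    (\<forall>t\<ge>0. W t \<in> borel_measurable (F t)) \<and>
    (AE \<omega> in M. W 0 \<omega> = 0) \<and>
    (AE \<omega> in M. continuous_on {0..} (\<lambda>t. W t \<omega>)) \<and>
    (\<forall>s t. 0 \<le> s \<and> s < t \<longrightarrow>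
      distributed M lborel (\<lambda>\<omega>. W t \<omega> - W s \<omega>)
        (\<lambda>x. ennreal (\<Prod>i\<in>UNIV. normal_density 0 (sqrt (t - s)) (x $ i))) \<and>
      prob_space.indep_set M (sets (F s))
        (sets (vimage_algebra (space M) (\<lambda>\<omega>. W t \<omega> - W s \<omega>) borel)))"

text \<open>The augmented filtration generated by the initial value \<open>\<xi>\<close> and the driving process \<open>W\<close>.\<close>

definition augmented_filtration ::
  "'a measure \<Rightarrow> (real \<Rightarrow> 'a \<Rightarrow> real ^ 'n::finite) \<Rightarrow> ('a \<Rightarrow> real ^ 'n) \<Rightarrow> real \<Rightarrow> 'a measure" where
  "augmented_filtration M W \<xi> t = sigma (space M)
    (null_sets M \<union>
     {\<xi> -` A \<inter> space M | A. A \<in> sets borel} \<union>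
     {W s -` A \<inter> space M | s A. 0 \<le> s \<and> s \<le> t \<and> A \<in> sets borel})"

definition interaction :: "('n::finite \<Rightarrow> 'n \<Rightarrow> real) \<Rightarrow> real ^ 'n \<Rightarrow> 'n \<Rightarrow> real" where
  "interaction \<gamma> x i = (\<Sum>j\<in>UNIV - {i}. \<gamma> i j / (x $ i - x $ j))"

text \<open>
  Strong solution in \<open>Delta\<close> on [0, T], in the sense of Karatzas and Shreve, for constant diffusion
  coefficients \<open>\<sigma>\<close>. The Ito integral of the constant \<open>\<sigma> i j\<close> against the j-th Brownian motion over
  [0, t] is \<open>\<sigma> i j * W t \<omega> $ j\<close>, so the equation can be written pathwise.
\<close>

definition strong_solution ::
  "'a measure \<Rightarrow> (real \<Rightarrow> 'a \<Rightarrow> (real, 'n::{finite,linorder}) vec) \<Rightarrow>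
   ('n \<Rightarrow> 'n \<Rightarrow> real) \<Rightarrow> ('n \<Rightarrow> (real, 'n) vec \<Rightarrow> real) \<Rightarrow> ('n \<Rightarrow> 'n \<Rightarrow> real) \<Rightarrow> real \<Rightarrow>
   ('a \<Rightarrow> (real, 'n) vec) \<Rightarrow> (real \<Rightarrow> 'a \<Rightarrow> (real, 'n) vec) \<Rightarrow> bool" where
  "strong_solution M W \<gamma> b \<sigma> T \<xi> X \<longleftrightarrow>
    (\<forall>t\<in>{0..T}. X t \<in> borel_measurable (augmented_filtration M W \<xi> t)) \<and>
    (AE \<omega> in M. X 0 \<omega> = \<xi> \<omega>) \<and>
    (AE \<omega> in M. continuous_on {0..T} (\<lambda>t. X t \<omega>)) \<and>
    (AE \<omega> in M. \<forall>t\<in>{0..T}. X t \<omega> \<in> Delta) \<and>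
    (AE \<omega> in M. \<forall>i.
      set_integrable lborel {0..T} (\<lambda>s. interaction \<gamma> (X s \<omega>) i + b i (X s \<omega>)) \<and>
      (\<forall>t\<in>{0..T}. X t \<omega> $ i = X 0 \<omega> $ i
        + (LBINT s:{0..t}. interaction \<gamma> (X s \<omega>) i + b i (X s \<omega>))
        + (\<Sum>j\<in>UNIV. \<sigma> i j * W t \<omega> $ j)))"

definition unique_strong_solution ::
  "'a measure \<Rightarrow> (real \<Rightarrow> 'a \<Rightarrow> (real, 'n::{finite,linorder}) vec) \<Rightarrow>
   ('n \<Rightarrow> 'n \<Rightarrow> real) \<Rightarrow> ('n \<Rightarrow> (real, 'n) vec \<Rightarrow> real) \<Rightarrow> ('n \<Rightarrow> 'n \<Rightarrow> real) \<Rightarrow> real \<Rightarrow>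
   ('a \<Rightarrow> (real, 'n) vec) \<Rightarrow> (real \<Rightarrow> 'a \<Rightarrow> (real, 'n) vec) \<Rightarrow> bool" where
  "unique_strong_solution M W \<gamma> b \<sigma> T \<xi> X \<longleftrightarrow>
    strong_solution M W \<gamma> b \<sigma> T \<xi> X \<and>
    (\<forall>Y. strong_solution M W \<gamma> b \<sigma> T \<xi> Y \<longrightarrow> (AE \<omega> in M. \<forall>t\<in>{0..T}. Y t \<omega> = X t \<omega>))"

text \<open>One step of the scheme, with step size \<open>h\<close> and Brownian increment \<open>w\<close>, leads from \<open>x\<close> to
  \<open>y\<close>. For \<open>\<gamma>\<close> symmetric, nonnegative and positive on adjacent indices and \<open>h > 0\<close>, there is
  exactly one such \<open>y\<close>, whatever \<open>x\<close> and \<open>w\<close> are; so the definite description below is proper.\<close>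

definition semi_implicit_step ::
  "('n::{finite,linorder} \<Rightarrow> 'n \<Rightarrow> real) \<Rightarrow> ('n \<Rightarrow> (real, 'n) vec \<Rightarrow> real) \<Rightarrow>
   ('n \<Rightarrow> 'n \<Rightarrow> (real, 'n) vec \<Rightarrow> real) \<Rightarrow> real \<Rightarrow> (real, 'n) vec \<Rightarrow> (real, 'n) vec \<Rightarrow> (real, 'n) vec \<Rightarrow> bool" where
  "semi_implicit_step \<gamma> b \<sigma> h w x y \<longleftrightarrow>
    y \<in> Delta \<and>
    (\<forall>i. y $ i = x $ i + (interaction \<gamma> y i + b i x) * h + (\<Sum>j\<in>UNIV. \<sigma> i j x * w $ j))"

text \<open>The k-th value is the scheme at time k T / n.\<close>

primrec semi_implicit_EM ::
  "('n::{finite,linorder} \<Rightarrow> 'n \<Rightarrow> real) \<Rightarrow> ('n \<Rightarrow> (real, 'n) vec \<Rightarrow> real) \<Rightarrow>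
   ('n \<Rightarrow> 'n \<Rightarrow> (real, 'n) vec \<Rightarrow> real) \<Rightarrow> (real \<Rightarrow> 'a \<Rightarrow> (real, 'n) vec) \<Rightarrow> real \<Rightarrow>
   ('a \<Rightarrow> (real, 'n) vec) \<Rightarrow> nat \<Rightarrow> nat \<Rightarrow> 'a \<Rightarrow> (real, 'n) vec" where
  "semi_implicit_EM \<gamma> b \<sigma> W T \<xi> n 0 = \<xi>"
| "semi_implicit_EM \<gamma> b \<sigma> W T \<xi> n (Suc k) =
    (\<lambda>\<omega>. THE y. semi_implicit_step \<gamma> b \<sigma> (T / real n)
      (W (real (Suc k) * T / real n) \<omega> - W (real k * T / real n) \<omega>)
      (semi_implicit_EM \<gamma> b \<sigma> W T \<xi> n k \<omega>) y)"

end

theory Submission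
  imports Defs
begin

text \<open>Write \<open>f\<close> for the interaction, \<open>h = T / n\<close>, \<open>x\<^sub>k\<close> for the solution and \<open>y\<^sub>k\<close> for the scheme at
time \<open>k h\<close>, and \<open>e\<^sub>k = x\<^sub>k - y\<^sub>k\<close>.

The interaction is minus the gradient of a convex function on the chamber \<open>Delta\<close>, hence
monotone: \<open>(f x - f y) \<bullet> (x - y) \<le> 0\<close>. So \<open>y \<mapsto> y - h f y\<close> does not decrease distances, and its
inverse, the resolvent, is defined everywhere and does not increase them
(\<open>interaction_monotone\<close>, \<open>implicit_map_surj\<close>, \<open>resolvent_stable\<close>). The scheme is an iteration of
the resolvent, and the solution satisfies the same recursion up to the local error
\<open>R\<^sub>k = \<integral> (f (X s) - f x\<^sub>k\<^sub>+\<^sub>1 + b (X s) - b x\<^sub>k) ds\<close>. Consequently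
\<open>norm e\<^sub>k\<^sub>+\<^sub>1 \<le> norm (e\<^sub>k + h (b x\<^sub>k - b y\<^sub>k) + R\<^sub>k)\<close>, where \<open>f\<close> enters only through \<open>R\<^sub>k\<close>.

The rate 1 comes from a splitting \<open>R\<^sub>k = M\<^sub>k + A\<^sub>k\<close>, where \<open>M\<^sub>k\<close> has conditional mean 0 and size
\<open>h powr (3/2)\<close> in \<open>L\<^sup>p\<close>, and \<open>A\<^sub>k\<close> has size \<open>h\<^sup>2\<close>. Ito's formula for the singular \<open>f\<close> is
replaced by algebra: if a gap changes from \<open>u\<close> to \<open>v = u + D + N\<close>, with \<open>D\<close> the drift and \<open>N\<close> the
noise, then \<open>1/v - 1/u + N/u\<^sup>2 = - D/(u v) + (N/u) (1/u - 1/v)\<close>. The term \<open>N/u\<^sup>2\<close>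
is linear in a future Brownian increment with a coefficient known at the beginning of the step;
the right-hand side has order \<open>h\<close>, and it is bounded by a polynomial of degree 4 in
quantities at fixed times whose moments of order \<open>4 p\<close> are finite (\<open>inverse_expansion\<close>,
\<open>lin_bound\<close>, \<open>remainder_bound\<close>). This explains the exponent \<open>4 p\<close> of the hypothesis.

For the accumulation of the errors let \<open>E\<^sub>k\<close> be the maximum of \<open>norm e\<^sub>i\<close> over \<open>i \<le> k\<close>. Squaring the
recursion produces the sum of \<open>a\<^sub>j \<bullet> M\<^sub>j\<close>, where \<open>a\<^sub>j = e\<^sub>j + h (b x\<^sub>j - b y\<^sub>j)\<close>. Writing
\<open>a\<^sub>j = E\<^sub>j \<theta>\<^sub>j\<close> with bounded \<open>\<theta>\<^sub>j\<close>, summation by parts bounds it path by path by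
\<open>2 E\<^sub>k N\<close>, where \<open>N\<close> is the maximum of the martingale with differences \<open>\<theta>\<^sub>j \<bullet> M\<^sub>j\<close>, and a discrete
Gronwall argument gives \<open>E\<^sub>n \<le> C (\<Sum> norm A\<^sub>j + sqrt (\<Sum> norm M\<^sub>j\<^sup>2) + N)\<close> on almost every path
(\<open>pathwise_stability\<close>). So the Burkholder inequality is not applied to the unknown error
itself, but only to a martingale whose differences have known moments
(\<open>maximal_moment\<close>); each of the three terms then has order \<open>h\<close> in \<open>L\<^sup>p\<close>.\<close>

section \<open>Elementary inequalities\<close>

text \<open>Convexity of \<open>y powr q\<close> in its tangent form, including the boundary point 0. It serves as
Jensen's inequality, for sums and for integrals, and as Young's inequality.\<close>

lemma powr_tangent:
  fixes q y c :: real
  assumes "1 \<le> q" "0 \<le> y" "0 \<le> c"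
  shows "c powr q + q * c powr (q - 1) * (y - c) \<le> y powr q"
proof -
  consider "c = 0" | "y = 0" "c > 0" | "y > 0" "c > 0" using assms by linarith
  then show ?thesis
  proof cases
    case 2
    have "c powr (q - 1) * c = c powr q"
      using 2 by (simp add: powr_mult_base mult.commute)
    then have "c powr q + q * c powr (q - 1) * (y - c) = (1 - q) * c powr q"
      using 2 by (simp add: algebra_simps)
    also have "\<dots> \<le> 0" using assms by (simp add: mult_nonpos_nonneg)
    finally show ?thesis using 2 by simp
  next
    case 3
    have "y powr q - c powr q \<ge> (q * c powr (q - 1)) * (y - c)"
    proof (rule convex_on_imp_above_tangent[OF powr_convex[OF assms(1)]])
      show "((\<lambda>x. x powr q) has_field_derivative q * c powr (q - 1)) (at c within {0<..})"
        by (rule has_field_derivative_at_within[OF has_real_derivative_powr[OF \<open>c > 0\<close>]])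
    qed (use 3 in \<open>auto simp: interior_open\<close>)
    then show ?thesis by (simp add: algebra_simps)
  qed auto
qed

lemma sum_powr_le:
  fixes y :: "'b \<Rightarrow> real"
  assumes "finite A" "1 \<le> q" "\<And>j. j \<in> A \<Longrightarrow> 0 \<le> y j"
  shows "(\<Sum>j\<in>A. y j) powr q \<le> real (card A) powr (q - 1) * (\<Sum>j\<in>A. y j powr q)"
proof (cases "A = {}")
  case False
  then have N: "real (card A) > 0" using assms(1) by (simp add: card_gt_0_iff)
  define c where "c = (\<Sum>j\<in>A. y j) / real (card A)"
  have c: "c \<ge> 0" unfolding c_def using assms by (intro divide_nonneg_nonneg sum_nonneg) auto
  have S: "(\<Sum>j\<in>A. y j) = real (card A) * c" using N by (simp add: c_def)
  have "real (card A) * c powr q = (\<Sum>j\<in>A. c powr q + q * c powr (q - 1) * (y j - c))"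
    using S by (simp add: sum.distrib sum_distrib_left[symmetric] sum_subtractf)
  also have "\<dots> \<le> (\<Sum>j\<in>A. y j powr q)"
    using assms c by (intro sum_mono powr_tangent) auto
  finally have *: "real (card A) * c powr q \<le> (\<Sum>j\<in>A. y j powr q)" .
  have "(\<Sum>j\<in>A. y j) powr q = real (card A) powr (q - 1) * (real (card A) * c powr q)"
    using N c unfolding S by (simp add: powr_mult powr_diff)
  also have "\<dots> \<le> real (card A) powr (q - 1) * (\<Sum>j\<in>A. y j powr q)"
    using * by (intro mult_left_mono) auto
  finally show ?thesis .
qed (use assms in auto)

lemma abs_powr_tangent:
  fixes q y c :: real
  assumes "1 \<le> q"
  shows "\<bar>c\<bar> powr q + q * (sgn c * \<bar>c\<bar> powr (q - 1)) * (y - c) \<le> \<bar>y\<bar> powr q"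
proof -
  have "sgn c * (y - c) \<le> \<bar>y\<bar> - \<bar>c\<bar>" by (auto simp: sgn_if)
  then have "q * \<bar>c\<bar> powr (q - 1) * (sgn c * (y - c)) \<le> q * \<bar>c\<bar> powr (q - 1) * (\<bar>y\<bar> - \<bar>c\<bar>)"
    using assms by (intro mult_left_mono) auto
  then show ?thesis
    using powr_tangent[OF assms, of "\<bar>y\<bar>" "\<bar>c\<bar>"] by (simp add: algebra_simps)
qed

lemma powr_diff_le:
  fixes q a c :: real
  assumes "1 \<le> q" "0 \<le> a" "0 \<le> c"
  shows "\<bar>c powr q - a powr q\<bar> \<le> q * max a c powr (q - 1) * \<bar>c - a\<bar>"
proof -
  have *: "d powr q - b powr q \<le> q * d powr (q - 1) * (d - b)" if "0 \<le> b" "b \<le> d" for b d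
    using powr_tangent[OF assms(1), of b d] that by (simp add: algebra_simps)
  show ?thesis
  proof (cases "a \<le> c")
    case True
    then show ?thesis using *[of a c] assms powr_mono2[of q a c] by (simp add: max_def abs_if)
  next
    case False
    then show ?thesis using *[of c a] assms powr_mono2[of q c a] by (simp add: max_def abs_if)
  qed
qed

text \<open>A form of Young's inequality: either \<open>x\<^sup>2\<close> is at most \<open>\<epsilon> a\<^sup>2\<close> and the first term dominates, or \<open>a\<close> is
at most a multiple of \<open>\<bar>x\<bar>\<close> and the second one does.\<close>

lemma powr_mult_sq_le:
  fixes a x p \<epsilon> :: real
  assumes "2 \<le> p" "0 < \<epsilon>" "0 \<le> a"
  shows "a powr (p - 2) * x\<^sup>2 \<le> \<epsilon> * a powr p + \<epsilon> powr (-(p - 2) / 2) * \<bar>x\<bar> powr p"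
proof (cases "x\<^sup>2 \<le> \<epsilon> * a\<^sup>2")
  case True
  have "a powr (p - 2) * x\<^sup>2 \<le> a powr (p - 2) * (\<epsilon> * a\<^sup>2)"
    using True by (intro mult_left_mono) auto
  also have "\<dots> = \<epsilon> * a powr p"
    using assms by (cases "a = 0") (auto simp: powr_diff powr_numeral)
  finally show ?thesis by (simp add: add_increasing2)
next
  case False
  then have "x \<noteq> 0" using assms by (auto simp: not_le mult_less_0_iff)
  have "\<epsilon> * a\<^sup>2 < x\<^sup>2" using False by simp
  then have "a\<^sup>2 \<le> x\<^sup>2 / \<epsilon>" using assms by (simp add: field_simps)
  then have "(a\<^sup>2) powr ((p - 2) / 2) \<le> (x\<^sup>2 / \<epsilon>) powr ((p - 2) / 2)"
    using assms by (intro powr_mono2) auto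
  moreover have "(a\<^sup>2) powr ((p - 2) / 2) = a powr (p - 2)" if "a \<noteq> 0"
  proof -
    have "(a\<^sup>2) powr ((p - 2) / 2) = (a powr 2) powr ((p - 2) / 2)"
      using assms that by simp
    also have "\<dots> = a powr (2 * ((p - 2) / 2))" by (rule powr_powr)
    also have "2 * ((p - 2) / 2) = p - 2" by simp
    finally show ?thesis .
  qed
  moreover have "(x\<^sup>2 / \<epsilon>) powr ((p - 2) / 2) = \<epsilon> powr (-(p - 2) / 2) * \<bar>x\<bar> powr (p - 2)"
  proof -
    have "(x\<^sup>2) powr ((p - 2) / 2) = \<bar>x\<bar> powr (p - 2)"
    proof -
      have "(x\<^sup>2) powr ((p - 2) / 2) = (\<bar>x\<bar> powr 2) powr ((p - 2) / 2)"
        using \<open>x \<noteq> 0\<close> by simp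
      also have "\<dots> = \<bar>x\<bar> powr (2 * ((p - 2) / 2))" by (rule powr_powr)
      also have "2 * ((p - 2) / 2) = p - 2" by simp
      finally show ?thesis .
    qed
    moreover have "\<epsilon> powr (-(p - 2) / 2) = inverse (\<epsilon> powr ((p - 2) / 2))"
      by (simp only: powr_minus[symmetric] minus_divide_left)
    moreover have "(x\<^sup>2 / \<epsilon>) powr ((p - 2) / 2) = (x\<^sup>2) powr ((p - 2) / 2) / \<epsilon> powr ((p - 2) / 2)"
      by (rule powr_divide)
    ultimately show ?thesis by (simp add: field_simps del: minus_diff_eq)
  qed
  ultimately have "a powr (p - 2) \<le> \<epsilon> powr (-(p - 2) / 2) * \<bar>x\<bar> powr (p - 2)"
    by (cases "a = 0") auto
  then have "a powr (p - 2) * x\<^sup>2 \<le> \<epsilon> powr (-(p - 2) / 2) * \<bar>x\<bar> powr (p - 2) * x\<^sup>2"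
    by (intro mult_right_mono) auto
  moreover have "\<bar>x\<bar> powr (p - 2) * x\<^sup>2 = \<bar>x\<bar> powr p"
    using \<open>x \<noteq> 0\<close> by (simp add: powr_diff powr_numeral)
  moreover have "0 \<le> \<epsilon> * a powr p" using assms by simp
  ultimately show ?thesis by (simp only: mult.assoc)
qed

text \<open>Convexity bounds the increment by the derivative at the end point \<open>a + x\<close>. Replacing it by the
derivative at \<open>a\<close> costs a second-order term if \<open>x\<close> is small compared with \<open>a\<close>; otherwise every
term is comparable to \<open>\<bar>x\<bar> powr p\<close>.\<close>

lemma abs_powr_add_le_nonneg:
  fixes a x p \<epsilon> :: real
  assumes p: "2 \<le> p" and e: "0 < \<epsilon>" "\<epsilon> \<le> 1" and a: "0 \<le> a"
  shows "\<bar>a + x\<bar> powr p \<le> \<bar>a\<bar> powr p + p * (sgn a * \<bar>a\<bar> powr (p - 1)) * x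
    + 2 * p\<^sup>2 * 3 powr p * (\<epsilon> * \<bar>a\<bar> powr p + \<epsilon> powr (-(p - 2) / 2) * \<bar>x\<bar> powr p)"
proof -
  define \<psi> where "\<psi> y = sgn y * \<bar>y\<bar> powr (p - 1)" for y :: real
  define R where "R = \<epsilon> * a powr p + \<epsilon> powr (-(p - 2) / 2) * \<bar>x\<bar> powr p"
  have e1: "1 \<le> \<epsilon> powr (-(p - 2) / 2)"
  proof -
    have "1 powr (-(p-2)/2) \<le> \<epsilon> powr (-(p - 2) / 2)"
      using e p by (intro powr_mono2') auto
    then show ?thesis by simp
  qed
  have conv: "\<bar>a + x\<bar> powr p \<le> \<bar>a\<bar> powr p + p * \<psi> (a + x) * x"
    using abs_powr_tangent[of p "a + x" a] p by (simp add: \<psi>_def algebra_simps)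
  have "(\<psi> (a + x) - \<psi> a) * x \<le> 2 * p * 3 powr p * R"
  proof (cases "\<bar>x\<bar> \<ge> a / 2")
    case True
    have "\<bar>\<psi> y\<bar> \<le> (3 * \<bar>x\<bar>) powr (p - 1)" if "\<bar>y\<bar> \<le> 3 * \<bar>x\<bar>" for y
    proof -
      have "\<bar>\<psi> y\<bar> \<le> \<bar>y\<bar> powr (p - 1)" by (auto simp: \<psi>_def sgn_if)
      also have "\<dots> \<le> (3 * \<bar>x\<bar>) powr (p - 1)" using that p by (intro powr_mono2) auto
      finally show ?thesis .
    qed
    then have "\<bar>\<psi> (a + x)\<bar> \<le> (3 * \<bar>x\<bar>) powr (p - 1)" "\<bar>\<psi> a\<bar> \<le> (3 * \<bar>x\<bar>) powr (p - 1)"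
      using True a by auto
    then have "\<bar>\<psi> (a + x) - \<psi> a\<bar> * \<bar>x\<bar> \<le> (2 * (3 * \<bar>x\<bar>) powr (p - 1)) * \<bar>x\<bar>"
      by (intro mult_right_mono) auto
    also have "\<dots> = 2 * 3 powr (p - 1) * \<bar>x\<bar> powr p"
      by (cases "x = 0") (auto simp: powr_mult powr_diff)
    also have "\<dots> \<le> 2 * 3 powr p * \<bar>x\<bar> powr p"
      by (intro mult_right_mono mult_left_mono powr_mono) auto
    also have "\<dots> \<le> 2 * p * 3 powr p * R"
    proof -
      have "1 * \<bar>x\<bar> powr p \<le> \<epsilon> powr (-(p - 2) / 2) * \<bar>x\<bar> powr p"
        using e1 by (intro mult_right_mono) auto
      then have "\<bar>x\<bar> powr p \<le> R" using e a by (simp add: R_def add_increasing)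
      then have "1 * \<bar>x\<bar> powr p \<le> p * R" using p by (intro mult_mono) auto
      then have "(2 * 3 powr p) * \<bar>x\<bar> powr p \<le> (2 * 3 powr p) * (p * R)" 
        by (intro mult_left_mono) auto
      then show ?thesis by (simp add: ac_simps)
    qed
    finally show ?thesis by (metis abs_mult abs_ge_self order_trans)
  next
    case False
    then have "a > 0" and x: "\<bar>x\<bar> < a / 2" using a by auto
    then have "a + x > 0" by linarith
    have "\<psi> (a + x) - \<psi> a = (a + x) powr (p - 1) - a powr (p - 1)"
      using \<open>a > 0\<close> \<open>a + x > 0\<close> by (simp add: \<psi>_def)
    then have "\<bar>\<psi> (a + x) - \<psi> a\<bar> \<le> (p - 1) * max a (a + x) powr (p - 2) * \<bar>x\<bar>"
      using powr_diff_le[of "p - 1" a "a + x"] p \<open>a > 0\<close> \<open>a + x > 0\<close> by simp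
    also have "\<dots> \<le> p * (3 * a) powr (p - 2) * \<bar>x\<bar>"
      using p x \<open>a > 0\<close> by (intro mult_right_mono mult_mono powr_mono2) auto
    finally have "\<bar>\<psi> (a + x) - \<psi> a\<bar> * \<bar>x\<bar> \<le> p * (3 * a) powr (p - 2) * \<bar>x\<bar> * \<bar>x\<bar>"
      by (intro mult_right_mono) auto
    also have "\<dots> = p * 3 powr (p - 2) * (a powr (p - 2) * x\<^sup>2)"
      using a by (simp add: powr_mult power2_eq_square)
    also have "\<dots> \<le> (2 * p * 3 powr p) * R"
    proof (rule mult_mono)
      have "3 powr (p - 2) \<le> 2 * (3 powr p :: real)"
        using powr_mono[of "p - 2" p "3::real"] powr_ge_zero[of 3 p] by linarith
      then have "p * 3 powr (p - 2) \<le> p * (2 * (3 powr p :: real))" 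
        using p by (intro mult_left_mono) auto
      then show "p * 3 powr (p - 2) \<le> 2 * p * (3 powr p)" by simp
    qed (use powr_mult_sq_le[OF p e(1) a, of x] p in \<open>auto simp: R_def\<close>)
    finally show ?thesis by (metis abs_mult abs_ge_self order_trans)
  qed
  then have "p * ((\<psi> (a + x) - \<psi> a) * x) \<le> p * (2 * p * 3 powr p * R)"
    using p by (intro mult_left_mono) auto
  then show ?thesis using conv a by (simp add: \<psi>_def R_def algebra_simps power2_eq_square)
qed

text \<open>Second-order Taylor expansion of \<open>\<bar>y\<bar> powr p\<close>, the remainder being split by Young's inequality.\<close>

lemma abs_powr_add_le:
  fixes a x p \<epsilon> :: real
  assumes "2 \<le> p" and "0 < \<epsilon>" "\<epsilon> \<le> 1"
  shows "\<bar>a + x\<bar> powr p \<le> \<bar>a\<bar> powr p + p * (sgn a * \<bar>a\<bar> powr (p - 1)) * x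
    + 2 * p\<^sup>2 * 3 powr p * (\<epsilon> * \<bar>a\<bar> powr p + \<epsilon> powr (-(p - 2) / 2) * \<bar>x\<bar> powr p)"
proof (cases "a \<ge> 0")
  case False
  then show ?thesis using abs_powr_add_le_nonneg[OF assms, of "-a" "-x"]
    by (simp add: abs_minus_commute sgn_minus add.commute[of x a])
qed (rule abs_powr_add_le_nonneg[OF assms])

lemma power2_powr_half:
  fixes y :: real
  assumes "0 \<le> y"
  shows "(y\<^sup>2) powr (p / 2) = y powr p"
proof (cases "y = 0")
  case False
  then have "(y\<^sup>2) powr (p / 2) = (y powr 2) powr (p / 2)" using assms by simp
  also have "\<dots> = y powr p" by (simp only: powr_powr) simp
  finally show ?thesis .
qed simp

lemma discrete_gronwall:
  fixes y :: "nat \<Rightarrow> real"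
  assumes "\<And>k. k \<le> n \<Longrightarrow> y k \<le> B + c * (\<Sum>j<k. y j)" "0 \<le> c" "k \<le> n"
  shows "y k \<le> B * (1 + c) ^ k"
proof -
  have S: "k \<le> n \<Longrightarrow> B + c * (\<Sum>j<k. y j) \<le> B * (1 + c) ^ k" for k
  proof (induction k)
    case (Suc k)
    have "B + c * (\<Sum>j<Suc k. y j) \<le> (B + c * (\<Sum>j<k. y j)) * (1 + c)"
      using mult_left_mono[OF assms(1)[of k] assms(2)] Suc.prems
      by (simp add: algebra_simps)
    also have "\<dots> \<le> B * (1 + c) ^ k * (1 + c)"
      using Suc assms(2) by (intro mult_right_mono) auto
    finally show ?case by (simp add: ac_simps)
  qed simp
  show ?thesis using assms(1)[OF assms(3)] S[OF assms(3)] by linarith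
qed

lemma one_plus_power_le_exp:
  fixes c :: real
  assumes "0 \<le> c" 
  shows "(1 + c) ^ k \<le> exp (real k * c)"
proof -
  have "(1 + c) ^ k \<le> exp c ^ k" using assms by (intro power_mono) (auto simp: exp_ge_add_one_self)
  then show ?thesis by (simp add: exp_of_nat_mult)
qed

text \<open>Here \<open>m\<close> is a running maximum, \<open>x\<close> the current value and \<open>y\<close> the next one. Both sides agree
unless \<open>y\<close> is a new maximum, and then the claim is Young's inequality.\<close>

lemma doob_step:
  fixes m x y p :: real
  assumes "1 \<le> p" "0 \<le> x" "x \<le> m" "0 \<le> y"
  shows "m powr (p - 1) * (y - x) \<le>
    (max y m powr (p - 1) * y - (p - 1) / p * max y m powr p)
    - (m powr (p - 1) * x - (p - 1) / p * m powr p)"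
proof (cases "y \<le> m")
  case False
  then have "y > 0" using assms by linarith
  have pp: "y powr (p - 1) * y = y powr p" "m powr (p - 1) * m = m powr p"
    using \<open>y > 0\<close> assms by (simp add: powr_diff, cases "m = 0") (auto simp: powr_diff)
  have "p * (m powr (p-1) * y) - (p - 1) * m powr p \<le> y powr p"
  proof -
    have "m powr p + p * (m powr (p - 1) * y) - p * (m powr (p - 1) * m) \<le> y powr p"
      using powr_tangent[OF assms(1), of y m] assms by (simp add: algebra_simps)
    then show ?thesis unfolding pp by (simp add: algebra_simps)
  qed
  then have "m powr (p-1) * y \<le> (y powr p + (p - 1) * m powr p) / p"
    using assms by (simp add: field_simps)
  moreover have "(y powr p + (p - 1) * m powr p) / p = y powr p - (p - 1) / p * y powr p + (p - 1) / p * m powr p"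
    using assms by (simp add: field_simps)
  ultimately show ?thesis using False pp by (simp add: max_def algebra_simps)
qed (simp add: max_def algebra_simps)

lemma abs_sum_powr_le:
  fixes y :: "'b \<Rightarrow> real"
  assumes "finite A" "1 \<le> q"
  shows "\<bar>\<Sum>j\<in>A. y j\<bar> powr q \<le> real (card A) powr (q - 1) * (\<Sum>j\<in>A. \<bar>y j\<bar> powr q)"
proof -
  have "\<bar>\<Sum>j\<in>A. y j\<bar> powr q \<le> (\<Sum>j\<in>A. \<bar>y j\<bar>) powr q"
    using assms by (intro powr_mono2) auto
  also have "\<dots> \<le> real (card A) powr (q - 1) * (\<Sum>j\<in>A. \<bar>y j\<bar> powr q)"
    using assms by (intro sum_powr_le) auto
  finally show ?thesis .
qed

lemma powr_pred_mult_le: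
  fixes a b p :: real
  assumes "1 \<le> p" "0 \<le> a" "0 \<le> b"
  shows "a powr (p - 1) * b \<le> a powr p + b powr p"
proof (cases "a \<le> b")
  case True
  have "a powr (p - 1) * b \<le> b powr (p - 1) * b"
    using True assms by (intro mult_right_mono powr_mono2) auto
  also have "\<dots> = b powr p" using assms by (cases "b = 0") (auto simp: powr_diff)
  finally show ?thesis by (simp add: add_increasing)
next
  case False
  have "a powr (p - 1) * b \<le> a powr (p - 1) * a"
    using False assms by (intro mult_left_mono) auto
  also have "\<dots> = a powr p" using assms by (cases "a = 0") (auto simp: powr_diff)
  finally show ?thesis by (simp add: add_increasing2)
qed

section \<open>A maximal inequality for martingale differences\<close>

lemma integrable_of_powr_moment:
  fixes f :: "'a \<Rightarrow> real"
  assumes "f \<in> borel_measurable M" "(\<integral>\<^sup>+ \<omega>. ennreal (\<bar>f \<omega>\<bar> powr p) \<partial>M) \<le> ennreal K"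
  shows "integrable M (\<lambda>\<omega>. \<bar>f \<omega>\<bar> powr p)"
  using assms by (intro integrableI_bounded) (auto intro: le_less_trans)

lemma Max_atMost_Suc:
  fixes f :: "nat \<Rightarrow> real"
  shows "(MAX k\<in>{..Suc n}. f k) = max (f (Suc n)) (MAX k\<in>{..n}. f k)"
  by (simp add: atMost_Suc)

lemma borel_measurable_Max_atMost [measurable]:
  fixes f :: "nat \<Rightarrow> 'a \<Rightarrow> real"
  assumes "\<And>k. k \<le> n \<Longrightarrow> f k \<in> borel_measurable M"
  shows "(\<lambda>\<omega>. MAX k\<in>{..n}. f k \<omega>) \<in> borel_measurable M"
  using assms
proof (induction n)
  case (Suc n)
  then show ?case unfolding Max_atMost_Suc by (intro borel_measurable_max) auto
qed simp

text \<open>A Burkholder-type inequality for the exponents \<open>p \<ge> 2\<close>: a martingale with \<open>n\<close> differences, whose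
\<open>p\<close>-th moments are at most \<open>K\<close>, has a maximum with \<open>p\<close>-th moment of order \<open>n powr (p / 2) * K\<close>.\<close>

locale martingale_differences = prob_space +
  fixes F :: "nat \<Rightarrow> 'a measure" and x :: "nat \<Rightarrow> 'a \<Rightarrow> real" and n :: nat and p K :: real
  assumes p: "2 \<le> p" and n: "1 \<le> n" and K: "0 \<le> K"
    and subalg: "\<And>k. k \<le> n \<Longrightarrow> subalgebra M (F k)"
    and F_mono: "\<And>j k. j \<le> k \<Longrightarrow> k \<le> n \<Longrightarrow> sets (F j) \<subseteq> sets (F k)"
    and adapted: "\<And>k. k < n \<Longrightarrow> x k \<in> borel_measurable (F (Suc k))"
    and moment: "\<And>k. k < n \<Longrightarrow> (\<integral>\<^sup>+ \<omega>. ennreal (\<bar>x k \<omega>\<bar> powr p) \<partial>M) \<le> ennreal K"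
    and centered: "\<And>k. k < n \<Longrightarrow> AE \<omega> in M. real_cond_exp M (F k) (x k) \<omega> = 0"
begin

definition psum :: "nat \<Rightarrow> 'a \<Rightarrow> real" where "psum k \<omega> = (\<Sum>j<k. x j \<omega>)"
definition run_max :: "nat \<Rightarrow> 'a \<Rightarrow> real" where "run_max k \<omega> = (MAX i\<in>{..k}. \<bar>psum i \<omega>\<bar>)"

lemma F_measurable_mono:
  assumes "f \<in> borel_measurable (F j)" "j \<le> k" "k \<le> n"
  shows "f \<in> borel_measurable (F k)"
proof -
  have "space (F j) = space (F k)"
    using subalg[of j] subalg[of k] assms by (simp add: subalgebra_def)
  then show ?thesis
    using assms F_mono[of j k] by (auto simp: measurable_def)
qed

lemma x_meas [measurable]: "k < n \<Longrightarrow> x k \<in> borel_measurable M"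
  using adapted[of k] subalg[of "Suc k"] by (auto intro: measurable_from_subalg)

lemma psum_F: "k \<le> n \<Longrightarrow> psum k \<in> borel_measurable (F k)"
  unfolding psum_def[abs_def]
  by (intro borel_measurable_sum) (auto intro!: F_measurable_mono[OF adapted])

lemma run_max_F: "k \<le> n \<Longrightarrow> run_max k \<in> borel_measurable (F k)"
  unfolding run_max_def[abs_def]
  by (intro borel_measurable_Max_atMost borel_measurable_abs)
     (auto intro: F_measurable_mono[OF psum_F])

lemma psum_meas [measurable]: "k \<le> n \<Longrightarrow> psum k \<in> borel_measurable M"
  using psum_F[of k] subalg[of k] by (auto intro: measurable_from_subalg)

lemma run_max_meas [measurable]: "k \<le> n \<Longrightarrow> run_max k \<in> borel_measurable M"
  using run_max_F[of k] subalg[of k] by (auto intro: measurable_from_subalg)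

lemma run_max_ge: "i \<le> k \<Longrightarrow> \<bar>psum i \<omega>\<bar> \<le> run_max k \<omega>"
  unfolding run_max_def by (intro Max_ge) auto

lemma run_max_nonneg: "0 \<le> run_max k \<omega>"
  using run_max_ge[of 0 k \<omega>] by (simp add: psum_def)

lemma run_max_Suc: "run_max (Suc k) \<omega> = max \<bar>psum (Suc k) \<omega>\<bar> (run_max k \<omega>)"
  unfolding run_max_def by (rule Max_atMost_Suc)

lemma int_x: "k < n \<Longrightarrow> integrable M (\<lambda>\<omega>. \<bar>x k \<omega>\<bar> powr p)"
  by (rule integrable_of_powr_moment[OF _ moment]) auto

lemma int_psum: "k \<le> n \<Longrightarrow> integrable M (\<lambda>\<omega>. \<bar>psum k \<omega>\<bar> powr p)"
proof (rule Bochner_Integration.integrable_bound)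
  show "k \<le> n \<Longrightarrow> integrable M (\<lambda>\<omega>. real k powr (p - 1) * (\<Sum>j<k. \<bar>x j \<omega>\<bar> powr p))"
    by (intro integrable_mult_right Bochner_Integration.integrable_sum int_x) auto
  show "AE \<omega> in M. norm (\<bar>psum k \<omega>\<bar> powr p) \<le> norm (real k powr (p - 1) * (\<Sum>j<k. \<bar>x j \<omega>\<bar> powr p))"
  proof (intro AE_I2)
    fix \<omega>
    have "\<bar>psum k \<omega>\<bar> powr p \<le> real k powr (p - 1) * (\<Sum>j<k. \<bar>x j \<omega>\<bar> powr p)"
      using abs_sum_powr_le[of "{..<k}" p "\<lambda>j. x j \<omega>"] p by (simp add: psum_def)
    then show "norm (\<bar>psum k \<omega>\<bar> powr p) \<le> norm (real k powr (p - 1) * (\<Sum>j<k. \<bar>x j \<omega>\<bar> powr p))"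
      by simp
  qed
qed auto

lemma int_run_max: "k \<le> n \<Longrightarrow> integrable M (\<lambda>\<omega>. run_max k \<omega> powr p)"
proof (rule Bochner_Integration.integrable_bound)
  show "k \<le> n \<Longrightarrow> integrable M (\<lambda>\<omega>. \<Sum>i\<le>k. \<bar>psum i \<omega>\<bar> powr p)"
    by (intro Bochner_Integration.integrable_sum int_psum) auto
  show "AE \<omega> in M. norm (run_max k \<omega> powr p) \<le> norm (\<Sum>i\<le>k. \<bar>psum i \<omega>\<bar> powr p)"
  proof (intro AE_I2)
    fix \<omega>
    have "run_max k \<omega> \<in> (\<lambda>i. \<bar>psum i \<omega>\<bar>) ` {..k}" unfolding run_max_def by (rule Max_in) auto
    then obtain i where i: "i \<le> k" "run_max k \<omega> = \<bar>psum i \<omega>\<bar>" by auto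
    then have "run_max k \<omega> powr p \<le> (\<Sum>i\<le>k. \<bar>psum i \<omega>\<bar> powr p)"
      by (auto intro!: member_le_sum)
    then show "norm (run_max k \<omega> powr p) \<le> norm (\<Sum>i\<le>k. \<bar>psum i \<omega>\<bar> powr p)"
      by (simp add: sum_nonneg)
  qed
qed auto

text \<open>Both uses below test a difference against a weight known at time \<open>k\<close> that grows like the power
\<open>p - 1\<close> of the running maximum; such a weight is integrable against the difference.\<close>

lemma int_weighted:
  assumes k: "k < n" and Y: "Y \<in> borel_measurable (F k)"
    and dom: "\<And>\<omega>. \<bar>Y \<omega>\<bar> \<le> run_max k \<omega> powr (p - 1)"
  shows "integrable M (\<lambda>\<omega>. Y \<omega> * x k \<omega>)" "(\<integral>\<omega>. Y \<omega> * x k \<omega> \<partial>M) = 0"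
proof -
  interpret sub: finite_measure_subalgebra M "F k"
    by standard (use k subalg in auto)
  have [measurable]: "Y \<in> borel_measurable M" "x k \<in> borel_measurable M"
    using Y k subalg[of k] by (auto intro: measurable_from_subalg)
  show int: "integrable M (\<lambda>\<omega>. Y \<omega> * x k \<omega>)"
  proof (rule Bochner_Integration.integrable_bound)
    show "integrable M (\<lambda>\<omega>. run_max k \<omega> powr p + \<bar>x k \<omega>\<bar> powr p)"
      using k by (intro Bochner_Integration.integrable_add int_run_max int_x) auto
    show "AE \<omega> in M. norm (Y \<omega> * x k \<omega>) \<le> norm (run_max k \<omega> powr p + \<bar>x k \<omega>\<bar> powr p)"
    proof (intro AE_I2)
      fix \<omega>
      have "\<bar>Y \<omega> * x k \<omega>\<bar> \<le> run_max k \<omega> powr (p - 1) * \<bar>x k \<omega>\<bar>"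
        unfolding abs_mult using dom by (intro mult_right_mono) auto
      also have "\<dots> \<le> run_max k \<omega> powr p + \<bar>x k \<omega>\<bar> powr p"
        using p run_max_nonneg by (intro powr_pred_mult_le) auto
      finally show "norm (Y \<omega> * x k \<omega>) \<le> norm (run_max k \<omega> powr p + \<bar>x k \<omega>\<bar> powr p)" by simp
    qed
  qed auto
  have "(\<integral>\<omega>. Y \<omega> * x k \<omega> \<partial>M) = (\<integral>\<omega>. Y \<omega> * real_cond_exp M (F k) (x k) \<omega> \<partial>M)"
    by (rule sub.real_cond_exp_intg(2)[symmetric, OF int Y]) simp
  also have "\<dots> = (\<integral>\<omega>. 0 \<partial>M)"
    by (rule integral_cong_AE) (use centered[OF k] in auto)
  finally show "(\<integral>\<omega>. Y \<omega> * x k \<omega> \<partial>M) = 0" by simp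
qed

definition taylor_const :: real where "taylor_const = 2 * p\<^sup>2 * 3 powr p"

lemma moment_bound_le:
  assumes "k < n"
  shows "(\<integral>\<omega>. \<bar>x k \<omega>\<bar> powr p \<partial>M) \<le> K"
proof -
  have "ennreal (\<integral>\<omega>. \<bar>x k \<omega>\<bar> powr p \<partial>M) \<le> ennreal K"
    using moment[OF assms] by (subst nn_integral_eq_integral[symmetric]) (auto simp: int_x[OF assms])
  then show ?thesis using K by (simp add: ennreal_le_iff)
qed

text \<open>The Taylor expansion with \<open>\<epsilon> = 1 / n\<close>: the first-order term vanishes in the mean, and the factor
\<open>1 + taylor_const / n\<close> stays bounded when it is iterated \<open>n\<close> times.\<close>

lemma psum_step:
  assumes k: "k < n"
  shows "(\<integral>\<omega>. \<bar>psum (Suc k) \<omega>\<bar> powr p \<partial>M) \<le> (1 + taylor_const / n) * (\<integral>\<omega>. \<bar>psum k \<omega>\<bar> powr p \<partial>M)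
    + taylor_const * (real n powr ((p - 2) / 2) * K)"
proof -
  let ?Y = "\<lambda>\<omega>. sgn (psum k \<omega>) * \<bar>psum k \<omega>\<bar> powr (p - 1)"
  have [measurable]: "psum k \<in> borel_measurable (F k)" using psum_F k by simp
  have Y: "integrable M (\<lambda>\<omega>. ?Y \<omega> * x k \<omega>)" "(\<integral>\<omega>. ?Y \<omega> * x k \<omega> \<partial>M) = 0"
  proof -
    have m: "?Y \<in> borel_measurable (F k)" by measurable
    have d: "\<bar>?Y \<omega>\<bar> \<le> run_max k \<omega> powr (p - 1)" for \<omega>
    proof -
      have "\<bar>?Y \<omega>\<bar> \<le> \<bar>psum k \<omega>\<bar> powr (p - 1)" by (auto simp: sgn_if)
      also have "\<dots> \<le> run_max k \<omega> powr (p - 1)" using run_max_ge[of k k \<omega>] p by (intro powr_mono2) auto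
      finally show ?thesis .
    qed
    show "integrable M (\<lambda>\<omega>. ?Y \<omega> * x k \<omega>)" "(\<integral>\<omega>. ?Y \<omega> * x k \<omega> \<partial>M) = 0"
      by (rule int_weighted[OF k m d])+
  qed
  have e: "(1 / real n) powr (-(p - 2) / 2) = real n powr ((p - 2) / 2)"
  proof -
    have "(1 / real n) powr (-(p - 2) / 2) = (1 / real n) powr (-((p - 2) / 2))"
      by (simp only: minus_divide_left)
    then show ?thesis unfolding powr_minus using n by (simp add: powr_divide del: minus_diff_eq)
  qed
  have pt: "\<bar>psum (Suc k) \<omega>\<bar> powr p \<le> \<bar>psum k \<omega>\<bar> powr p + p * (?Y \<omega> * x k \<omega>)
      + (taylor_const * (1 / n * \<bar>psum k \<omega>\<bar> powr p) + taylor_const * (real n powr ((p - 2) / 2) * \<bar>x k \<omega>\<bar> powr p))" for \<omega>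
    using abs_powr_add_le[OF p, of "1 / n" "psum k \<omega>" "x k \<omega>"] n unfolding e
    by (simp add: psum_def taylor_const_def algebra_simps)
  have "(\<integral>\<omega>. \<bar>psum (Suc k) \<omega>\<bar> powr p \<partial>M) \<le> (\<integral>\<omega>. \<bar>psum k \<omega>\<bar> powr p + p * (?Y \<omega> * x k \<omega>)
      + (taylor_const * (1 / n * \<bar>psum k \<omega>\<bar> powr p) + taylor_const * (real n powr ((p - 2) / 2) * \<bar>x k \<omega>\<bar> powr p)) \<partial>M)"
    using k Y int_psum[of k] int_x[of k] pt
    by (intro integral_mono int_psum Bochner_Integration.integrable_add integrable_mult_right) auto
  also have "\<dots> = (\<integral>\<omega>. \<bar>psum k \<omega>\<bar> powr p \<partial>M) + p * 0
      + (taylor_const * (1 / n * (\<integral>\<omega>. \<bar>psum k \<omega>\<bar> powr p \<partial>M)) + taylor_const * (real n powr ((p - 2) / 2) * (\<integral>\<omega>. \<bar>x k \<omega>\<bar> powr p \<partial>M)))"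
    using k Y(1) int_psum[of k] int_x[of k]
    by (simp only: Bochner_Integration.integral_add Bochner_Integration.integrable_add
        integrable_mult_right integral_mult_right_zero Y(2) less_imp_le)
  also have "\<dots> \<le> (\<integral>\<omega>. \<bar>psum k \<omega>\<bar> powr p \<partial>M) + p * 0
      + (taylor_const * (1 / n * (\<integral>\<omega>. \<bar>psum k \<omega>\<bar> powr p \<partial>M)) + taylor_const * (real n powr ((p - 2) / 2) * K))"
    using moment_bound_le[OF k] p by (intro add_left_mono mult_left_mono) (auto simp: taylor_const_def)
  finally show ?thesis by (simp add: algebra_simps)
qed

text \<open>The growth factor of \<open>n\<close> steps is at most \<open>exp taylor_const\<close>; the \<open>n\<close> inhomogeneous terms contribute
\<open>n * n powr ((p - 2) / 2) = n powr (p / 2)\<close>.\<close>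

lemma psum_bound: "(\<integral>\<omega>. \<bar>psum n \<omega>\<bar> powr p \<partial>M) \<le> taylor_const * exp taylor_const * real n powr (p / 2) * K"
proof -
  define B where "B = taylor_const * (real n powr ((p - 2) / 2) * K)"
  have taylor_const: "taylor_const \<ge> 0" by (simp add: taylor_const_def)
  have B: "B \<ge> 0" unfolding B_def using taylor_const K by simp
  have c1: "(1 + taylor_const / n) \<ge> 1" using taylor_const by simp
  have "k \<le> n \<Longrightarrow> (\<integral>\<omega>. \<bar>psum k \<omega>\<bar> powr p \<partial>M) \<le> real k * B * (1 + taylor_const / n) ^ k" for k
  proof (induction k)
    case 0
    then show ?case by (simp add: psum_def)
  next
    case (Suc k)
    have "(\<integral>\<omega>. \<bar>psum (Suc k) \<omega>\<bar> powr p \<partial>M) \<le> (1 + taylor_const / n) * (\<integral>\<omega>. \<bar>psum k \<omega>\<bar> powr p \<partial>M) + B"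
      using psum_step[of k] Suc.prems by (simp add: B_def)
    also have "\<dots> \<le> (1 + taylor_const / n) * (real k * B * (1 + taylor_const / n) ^ k) + B * (1 + taylor_const / n) ^ Suc k"
      using Suc B taylor_const mult_left_mono[OF one_le_power[OF c1, of "Suc k"] B]
      by (intro add_mono mult_left_mono) (auto simp del: power_Suc)
    finally show ?case by (simp add: algebra_simps add_divide_distrib)
  qed
  from this[of n] have "(\<integral>\<omega>. \<bar>psum n \<omega>\<bar> powr p \<partial>M) \<le> real n * B * (1 + taylor_const / n) ^ n" by simp
  also have "\<dots> \<le> real n * B * exp (real n * (taylor_const / n))"
    using B taylor_const by (intro mult_left_mono one_plus_power_le_exp) auto
  also have "\<dots> = taylor_const * exp taylor_const * (real n * real n powr ((p - 2) / 2)) * K"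
    using n by (simp add: B_def)
  also have "real n * real n powr ((p - 2) / 2) = real n powr (p / 2)"
    using n by (simp add: diff_divide_distrib powr_diff)
  finally show ?thesis .
qed

text \<open>Doob's inequality from its pathwise version: \<open>\<Phi>\<close> increases at least by a multiple of the martingale
difference, so its mean stays nonnegative. At time \<open>n\<close> this compares the maximum with the final
value.\<close>

lemma doob: "(\<integral>\<omega>. run_max n \<omega> powr p \<partial>M) \<le> 4 powr p * (\<integral>\<omega>. \<bar>psum n \<omega>\<bar> powr p \<partial>M)"
proof -
  define \<Phi> where "\<Phi> k \<omega> = run_max k \<omega> powr (p - 1) * \<bar>psum k \<omega>\<bar> - (p - 1) / p * run_max k \<omega> powr p" for k \<omega>
  have int_mS: "integrable M (\<lambda>\<omega>. run_max k \<omega> powr (p - 1) * \<bar>psum k \<omega>\<bar>)" if "k \<le> n" for k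
  proof (rule Bochner_Integration.integrable_bound)
    show "integrable M (\<lambda>\<omega>. run_max k \<omega> powr p + \<bar>psum k \<omega>\<bar> powr p)"
      using that by (intro Bochner_Integration.integrable_add int_run_max int_psum)
    show "AE \<omega> in M. norm (run_max k \<omega> powr (p - 1) * \<bar>psum k \<omega>\<bar>) \<le> norm (run_max k \<omega> powr p + \<bar>psum k \<omega>\<bar> powr p)"
      using p run_max_nonneg powr_pred_mult_le[of p "run_max k _" "\<bar>psum k _\<bar>"] by (intro AE_I2) auto
  qed (use that in measurable)
  have int_\<Phi>: "integrable M (\<Phi> k)" if "k \<le> n" for k
    unfolding \<Phi>_def[abs_def] using that
    by (intro Bochner_Integration.integrable_diff integrable_mult_right int_run_max int_mS)
  have "k \<le> n \<Longrightarrow> 0 \<le> (\<integral>\<omega>. \<Phi> k \<omega> \<partial>M)" for k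
  proof (induction k)
    case 0
    have "run_max 0 \<omega> = 0" for \<omega> by (simp add: run_max_def psum_def)
    then show ?case by (simp add: \<Phi>_def)
  next
    case (Suc k)
    then have k: "k < n" by simp
    let ?Y = "\<lambda>\<omega>. sgn (psum k \<omega>) * run_max k \<omega> powr (p - 1)"
    have [measurable]: "psum k \<in> borel_measurable (F k)" "run_max k \<in> borel_measurable (F k)"
      using psum_F run_max_F k by simp_all
    have m: "?Y \<in> borel_measurable (F k)" by measurable
    have d: "\<bar>?Y \<omega>\<bar> \<le> run_max k \<omega> powr (p - 1)" for \<omega> by (auto simp: sgn_if)
    have pt: "\<Phi> k \<omega> + ?Y \<omega> * x k \<omega> \<le> \<Phi> (Suc k) \<omega>" for \<omega>
    proof -
      have "sgn (psum k \<omega>) * x k \<omega> \<le> \<bar>psum (Suc k) \<omega>\<bar> - \<bar>psum k \<omega>\<bar>"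
        by (auto simp: psum_def sgn_if)
      then have "run_max k \<omega> powr (p - 1) * (sgn (psum k \<omega>) * x k \<omega>) \<le> run_max k \<omega> powr (p - 1) * (\<bar>psum (Suc k) \<omega>\<bar> - \<bar>psum k \<omega>\<bar>)"
        by (intro mult_left_mono) auto
      also have "\<dots> \<le> \<Phi> (Suc k) \<omega> - \<Phi> k \<omega>"
        using doob_step[of p "\<bar>psum k \<omega>\<bar>" "run_max k \<omega>" "\<bar>psum (Suc k) \<omega>\<bar>"] p run_max_ge[of k k \<omega>]
        by (simp add: \<Phi>_def run_max_Suc)
      finally show ?thesis by (simp add: algebra_simps)
    qed
    have "0 \<le> (\<integral>\<omega>. \<Phi> k \<omega> \<partial>M) + (\<integral>\<omega>. ?Y \<omega> * x k \<omega> \<partial>M)"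
      using Suc int_weighted(2)[OF k m d] by simp
    also have "\<dots> = (\<integral>\<omega>. \<Phi> k \<omega> + ?Y \<omega> * x k \<omega> \<partial>M)"
      using int_\<Phi>[of k] int_weighted(1)[OF k m d] k by simp
    also have "\<dots> \<le> (\<integral>\<omega>. \<Phi> (Suc k) \<omega> \<partial>M)"
      using int_\<Phi>[of k] int_\<Phi>[of "Suc k"] int_weighted(1)[OF k m d] k pt by (intro integral_mono) auto
    finally show ?case .
  qed
  from this[of n] have P: "0 \<le> (\<integral>\<omega>. \<Phi> n \<omega> \<partial>M)" by simp
  have pt: "\<Phi> n \<omega> \<le> 4 powr (p - 1) * \<bar>psum n \<omega>\<bar> powr p - 1 / 4 * run_max n \<omega> powr p" for \<omega>
  proof -
    define m s where "m = run_max n \<omega>" and "s = \<bar>psum n \<omega>\<bar>"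
    have ms: "0 \<le> s" "s \<le> m" using run_max_ge[of n n \<omega>] by (auto simp: m_def s_def)
    \<comment> \<open>As \<open>(p - 1) / p \<ge> 1 / 2\<close>, a quarter of \<open>m powr p\<close> remains after absorption.\<close>
    have "m powr (p - 1) * s \<le> 1 / 4 * m powr p + 4 powr (p - 1) * s powr p"
    proof (cases "s \<le> m / 4")
      case True
      then have "m powr (p - 1) * s \<le> m powr (p - 1) * (m / 4)" by (intro mult_left_mono) auto
      also have "\<dots> = 1 / 4 * m powr p" using ms p by (cases "m = 0") (auto simp: powr_diff)
      finally show ?thesis by (simp add: add_increasing2)
    next
      case False
      then have "m powr (p - 1) * s \<le> (4 * s) powr (p - 1) * s"
        using ms p by (intro mult_right_mono powr_mono2) auto
      also have "\<dots> = 4 powr (p - 1) * s powr p"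
        using ms p by (cases "s = 0") (auto simp: powr_diff powr_mult)
      finally show ?thesis by (simp add: add_increasing)
    qed
    moreover have "1 / 2 * m powr p \<le> (p - 1) / p * m powr p"
      using p by (intro mult_right_mono) (auto simp: field_simps)
    ultimately show ?thesis unfolding \<Phi>_def m_def[symmetric] s_def[symmetric] by simp
  qed
  have "0 \<le> (\<integral>\<omega>. 4 powr (p - 1) * \<bar>psum n \<omega>\<bar> powr p - 1 / 4 * run_max n \<omega> powr p \<partial>M)"
    using P int_\<Phi>[of n] int_psum[of n] int_run_max[of n] pt
    by (intro order_trans[OF P] integral_mono Bochner_Integration.integrable_diff integrable_mult_right) auto
  also have "\<dots> = 4 powr (p - 1) * (\<integral>\<omega>. \<bar>psum n \<omega>\<bar> powr p \<partial>M) - 1 / 4 * (\<integral>\<omega>. run_max n \<omega> powr p \<partial>M)"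
    using int_psum[of n] int_run_max[of n] by simp
  finally show ?thesis by (simp add: powr_diff)
qed

lemma maximal_moment:
  "(\<integral>\<^sup>+ \<omega>. ennreal ((MAX k\<in>{..n}. \<bar>\<Sum>j<k. x j \<omega>\<bar>) powr p) \<partial>M)
    \<le> ennreal (4 powr p * (2 * p\<^sup>2 * 3 powr p) * exp (2 * p\<^sup>2 * 3 powr p) * real n powr (p / 2) * K)"
proof -
  have "(\<integral>\<^sup>+ \<omega>. ennreal (run_max n \<omega> powr p) \<partial>M) = ennreal (\<integral>\<omega>. run_max n \<omega> powr p \<partial>M)"
    by (intro nn_integral_eq_integral int_run_max) auto
  also have "\<dots> \<le> ennreal (4 powr p * (taylor_const * exp taylor_const * real n powr (p / 2) * K))"
    by (intro ennreal_leI order_trans[OF doob] mult_left_mono psum_bound) auto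
  finally show ?thesis by (simp add: run_max_def psum_def taylor_const_def mult.assoc)
qed

end

section \<open>Monotonicity of the interaction and its resolvent\<close>

definition interaction_vec :: "('n::finite \<Rightarrow> 'n \<Rightarrow> real) \<Rightarrow> real ^ 'n \<Rightarrow> real ^ 'n" where
  "interaction_vec \<gamma> x = (\<chi> i. interaction \<gamma> x i)"

lemma interaction_eq_sum:
  "interaction \<gamma> x i = (\<Sum>j\<in>UNIV. \<gamma> i j / (x $ i - x $ j))"
  unfolding interaction_def by (rule sum.mono_neutral_left) auto

lemma Delta_diff_nz: "x \<in> Delta \<Longrightarrow> i \<noteq> j \<Longrightarrow> x $ i - x $ j \<noteq> 0"
  unfolding Delta_def by (cases i j rule: linorder_cases) fastforce+

lemma Delta_diff_mult_pos:
  assumes "x \<in> Delta" "y \<in> Delta" "i \<noteq> j"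
  shows "(x $ i - x $ j) * (y $ i - y $ j) > 0"
proof (cases "i < j")
  case True
  then show ?thesis using assms unfolding Delta_def by (intro mult_neg_neg) auto
next
  case False
  then have "j < i" using assms by auto
  then show ?thesis using assms unfolding Delta_def by (intro mult_pos_pos) auto
qed

lemma open_Delta: "open (Delta :: (real, 'n::{finite,linorder}) vec set)"
proof -
  have eq: "Delta = (\<Inter>i. \<Inter>j. {x :: (real, 'n) vec. i < j \<longrightarrow> x $ i < x $ j})"
    by (auto simp: Delta_def)
  have "open {x :: (real, 'n) vec. i < j \<longrightarrow> x $ i < x $ j}" for i j
    by (cases "i < j") (auto intro!: open_Collect_less continuous_intros)
  then show ?thesis unfolding eq by (intro open_INT ballI) auto
qed

lemma Delta_nonempty: "(\<chi> i. real (card {k. k < i})) \<in> (Delta :: (real ^ 'n::{finite,linorder}) set)"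
  unfolding Delta_def by (auto intro!: psubset_card_mono)

lemma continuous_on_interaction:
  "continuous_on Delta (\<lambda>x. interaction \<gamma> x i)"
  unfolding interaction_def
  by (intro continuous_intros ballI) (metis Delta_diff_nz Diff_iff insertI1)

lemma continuous_on_interaction_vec: "continuous_on Delta (interaction_vec \<gamma>)"
  unfolding interaction_vec_def[abs_def]
  by (intro continuous_on_vec_lambda continuous_on_interaction)

text \<open>The neighbour of \<open>i\<close> lies between \<open>i\<close> and every larger index. So an assumption on adjacent pairs
controls all pairs.\<close>

lemma exists_adjacent_between:
  fixes i j :: "'n::{finite,linorder}"
  assumes "i < j"
  obtains s where "adjacent i s" "s \<le> j"
proof -
  define s where "s = Min {k. i < k}"
  have "s \<in> {k. i < k}" unfolding s_def using assms by (intro Min_in) auto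
  moreover have "s \<le> k" if "i < k" for k unfolding s_def using that by (intro Min_le) auto
  ultimately show ?thesis using that[of s] assms unfolding adjacent_def by fastforce
qed

locale repulsion =
  fixes \<gamma> :: "'n::{finite,linorder} \<Rightarrow> 'n \<Rightarrow> real"
  assumes gamma_sym: "\<And>i j. i \<noteq> j \<Longrightarrow> \<gamma> i j = \<gamma> j i"
    and gamma_nonneg: "\<And>i j. i \<noteq> j \<Longrightarrow> 0 \<le> \<gamma> i j"
    and gamma_pos: "\<And>i j. adjacent i j \<Longrightarrow> 0 < \<gamma> i j"
begin

text \<open>After symmetrization in the pair of indices, each pair contributes
\<open>\<gamma> (1/u - 1/v) (u - v) = - \<gamma> (u - v)\<^sup>2 / (u v)\<close>, and the two gaps \<open>u\<close> and \<open>v\<close> have the same sign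
on \<open>Delta\<close>.\<close>

lemma interaction_monotone:
  assumes x: "x \<in> Delta" and y: "y \<in> Delta"
  shows "(interaction_vec \<gamma> x - interaction_vec \<gamma> y) \<bullet> (x - y) \<le> 0"
proof -
  define d where "d = x - y"
  define c where "c i j = \<gamma> i j / (x $ i - x $ j) - \<gamma> i j / (y $ i - y $ j)" for i j
  have anti: "c j i = - c i j" for i j
  proof (cases "i = j")
    case False
    have "a / (u - v) = - (a / (v - u))" for a u v :: real
      by (metis minus_diff_eq minus_divide_right)
    then show ?thesis unfolding c_def gamma_sym[OF False] by (metis minus_diff_minus)
  qed (simp add: c_def)
  define S where "S = (\<Sum>i\<in>UNIV. \<Sum>j\<in>UNIV. c i j * d $ i)"
  have S: "(interaction_vec \<gamma> x - interaction_vec \<gamma> y) \<bullet> (x - y) = S"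
    by (simp add: S_def c_def d_def inner_vec_def interaction_vec_def interaction_eq_sum
        sum_subtractf[symmetric] sum_distrib_right)
  have "S = (\<Sum>i\<in>UNIV. \<Sum>j\<in>UNIV. c j i * d $ j)"
    unfolding S_def by (rule sum.swap)
  then have "2 * S = (\<Sum>i\<in>UNIV. \<Sum>j\<in>UNIV. c i j * d $ i) + (\<Sum>i\<in>UNIV. \<Sum>j\<in>UNIV. c j i * d $ j)"
    by (simp add: S_def)
  also have "\<dots> = (\<Sum>i\<in>UNIV. \<Sum>j\<in>UNIV. c i j * (d $ i - d $ j))"
  proof -
    have "(\<Sum>i\<in>UNIV. \<Sum>j\<in>UNIV. c j i * d $ j) = (\<Sum>i\<in>UNIV. \<Sum>j\<in>UNIV. - (c i j * d $ j))"
      by (intro sum.cong refl) (metis anti mult_minus_left)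
    then show ?thesis by (simp add: right_diff_distrib sum_subtractf sum_negf)
  qed
  also have "\<dots> \<le> 0"
  proof (intro sum_nonpos)
    fix i j
    show "c i j * (d $ i - d $ j) \<le> 0"
    proof (cases "i = j")
      case False
      define u v where "u = x $ i - x $ j" and "v = y $ i - y $ j"
      have uv: "u * v > 0" using Delta_diff_mult_pos[OF x y False] by (simp add: u_def v_def)
      then have nz: "u \<noteq> 0" "v \<noteq> 0" by auto
      have "c i j * (d $ i - d $ j) = \<gamma> i j * ((1 / u - 1 / v) * (u - v))"
        by (simp add: c_def d_def u_def v_def algebra_simps)
      also have "(1 / u - 1 / v) * (u - v) = - ((u - v)\<^sup>2 / (u * v))"
        using nz by (simp add: field_simps power2_eq_square)
      finally show ?thesis using gamma_nonneg[OF False] uv by simp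
    qed simp
  qed
  finally show ?thesis using S by simp
qed

lemma implicit_map_expanding:
  assumes "x \<in> Delta" "y \<in> Delta" "0 \<le> h"
  shows "norm (x - y) \<le> norm ((x - h *\<^sub>R interaction_vec \<gamma> x) - (y - h *\<^sub>R interaction_vec \<gamma> y))"
    (is "_ \<le> norm ?z")
proof -
  have "(norm (x - y))\<^sup>2 \<le> (x - y) \<bullet> (x - y) - h * ((interaction_vec \<gamma> x - interaction_vec \<gamma> y) \<bullet> (x - y))"
    using interaction_monotone[OF assms(1,2)] assms(3) by (simp add: power2_norm_eq_inner mult_nonneg_nonpos)
  moreover have "(x - y) \<bullet> (x - y) - h * ((interaction_vec \<gamma> x - interaction_vec \<gamma> y) \<bullet> (x - y)) = ?z \<bullet> (x - y)"
    by (simp add: inner_diff_left algebra_simps)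
  moreover have "?z \<bullet> (x - y) \<le> norm ?z * norm (x - y)" by (rule norm_cauchy_schwarz)
  ultimately have "norm (x - y) * norm (x - y) \<le> norm ?z * norm (x - y)"
    unfolding power2_eq_square[symmetric] by linarith
  then show ?thesis
    by (cases "x = y") (simp, metis mult_right_le_imp_le right_minus_eq zero_less_norm_iff)
qed

text \<open>On a wall of the chamber the lowest particle of a collision would be pushed down by an unbounded
force, so the interaction could not converge.\<close>

lemma limit_in_Delta:
  fixes y :: "nat \<Rightarrow> (real, 'n) vec"
  assumes D: "\<And>k. y k \<in> Delta" and lim: "y \<longlonglongrightarrow> l"
    and lim_int: "(\<lambda>k. interaction_vec \<gamma> (y k)) \<longlonglongrightarrow> q"
  shows "l \<in> Delta"
proof (rule ccontr)
  assume nD: "l \<notin> Delta"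
  have comp: "(\<lambda>k. y k $ i) \<longlonglongrightarrow> l $ i" for i by (rule tendsto_vec_nth[OF lim])
  have le: "l $ i \<le> l $ j" if "i < j" for i j
  proof (rule LIMSEQ_le[OF comp[of i] comp[of j]])
    show "\<exists>N. \<forall>k\<ge>N. y k $ i \<le> y k $ j" using D that by (auto simp: Delta_def less_imp_le)
  qed
  \<comment> \<open>The lowest particle \<open>i\<close> of a collision is separated in the limit from all particles below it. Those
above it push it down, among them its neighbour \<open>s\<close> with a force that tends to infinity.\<close>
  define A where "A = {i. \<exists>j>i. l $ i = l $ j}"
  have "A \<noteq> {}"
  proof -
    obtain i j where "i < j" "\<not> l $ i < l $ j" using nD by (auto simp: Delta_def)
    then show ?thesis using le[of i j] by (auto simp: A_def)
  qed
  define i where "i = Min A"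
  have "i \<in> A" unfolding i_def using \<open>A \<noteq> {}\<close> by (intro Min_in) auto
  then obtain j where j: "i < j" "l $ i = l $ j" by (auto simp: A_def)
  have below: "l $ k < l $ i" if "k < i" for k
  proof (rule ccontr)
    assume "\<not> l $ k < l $ i"
    then have "l $ k = l $ i" using le[OF that] by simp
    then have "k \<in> A" using that by (auto simp: A_def)
    then have "i \<le> k" unfolding i_def by (intro Min_le) auto
    then show False using that by simp
  qed
  obtain s where adj: "adjacent i s" and sj: "s \<le> j" by (rule exists_adjacent_between[OF j(1)])
  then have s: "i < s" "s \<le> j" by (auto simp: adjacent_def)
  have ls: "l $ s = l $ i"
    using le[OF s(1)] le[of s j] s j by (cases "s = j") auto
  define r where "r k = (\<Sum>m\<in>{m. m < i}. \<gamma> i m / (y k $ i - y k $ m)) - interaction_vec \<gamma> (y k) $ i" for k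
  have "r \<longlonglongrightarrow> (\<Sum>m\<in>{m. m < i}. \<gamma> i m / (l $ i - l $ m)) - q $ i"
    unfolding r_def[abs_def]
    by (intro tendsto_intros comp tendsto_vec_nth[OF lim_int]) (use below in fastforce)
  moreover have "(\<lambda>k. y k $ s - y k $ i) \<longlonglongrightarrow> l $ s - l $ i" by (intro tendsto_intros comp)
  ultimately have "(\<lambda>k. r k * (y k $ s - y k $ i)) \<longlonglongrightarrow>
      ((\<Sum>m\<in>{m. m < i}. \<gamma> i m / (l $ i - l $ m)) - q $ i) * (l $ s - l $ i)"
    by (rule tendsto_mult)
  then have lim0: "(\<lambda>k. r k * (y k $ s - y k $ i)) \<longlonglongrightarrow> 0" using ls by simp
  \<comment> \<open>Here \<open>r k\<close> stays bounded and the gap tends to 0.\<close>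
  have "\<gamma> i s \<le> r k * (y k $ s - y k $ i)" for k
  proof -
    have gap: "y k $ s - y k $ i > 0" using D[of k] s by (auto simp: Delta_def)
    have "interaction_vec \<gamma> (y k) $ i =
      (\<Sum>m\<in>{m. m < i}. \<gamma> i m / (y k $ i - y k $ m)) + (\<Sum>m\<in>{m. i < m}. \<gamma> i m / (y k $ i - y k $ m))"
    proof -
      have "UNIV - {i} = {m. m < i} \<union> {m. i < m}" by auto
      moreover have "sum G ({m. m < i} \<union> {m. i < m}) = sum G {m. m < i} + sum G {m. i < m}"
        for G :: "'n \<Rightarrow> real"
        by (rule sum.union_disjoint) auto
      ultimately show ?thesis unfolding interaction_vec_def interaction_def
        by (simp only: vec_lambda_beta)
    qed
    also have "(\<Sum>m\<in>{m. i < m}. \<gamma> i m / (y k $ i - y k $ m)) \<le> (\<Sum>m\<in>{s}. \<gamma> i m / (y k $ i - y k $ m))"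
    proof -
      have "(\<Sum>m\<in>{m. i < m}. - (\<gamma> i m / (y k $ i - y k $ m))) \<ge> (\<Sum>m\<in>{s}. - (\<gamma> i m / (y k $ i - y k $ m)))"
      proof (rule sum_mono2)
        fix m assume "m \<in> {m. i < m} - {s}"
        then have "i < m" by simp
        then have "y k $ i - y k $ m < 0" "\<gamma> i m \<ge> 0"
          using D[of k] gamma_nonneg[of i m] by (auto simp: Delta_def)
        then show "0 \<le> - (\<gamma> i m / (y k $ i - y k $ m))"
          by (simp add: divide_nonneg_neg)
      qed (use s in auto)
      then show ?thesis by (simp add: sum_negf)
    qed
    finally have "- (\<gamma> i s / (y k $ i - y k $ s)) \<le> r k" by (simp add: r_def)
    then have "\<gamma> i s / (y k $ s - y k $ i) \<le> r k" by (metis minus_diff_eq minus_divide_right)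
    then show ?thesis using gap by (simp add: field_simps)
  qed
  then have "\<gamma> i s \<le> 0" using lim0 by (intro LIMSEQ_le_const) auto
  then show False using gamma_pos[OF adj] by simp
qed

text \<open>The image of the implicit map is open by invariance of domain. It is closed because the map does
not decrease distances and its limit points cannot come from the boundary of the chamber. A
nonempty open and closed subset of the Euclidean space is everything.\<close>

lemma implicit_map_surj:
  assumes h: "0 < h"
  shows "(\<lambda>y. y - h *\<^sub>R interaction_vec \<gamma> y) ` Delta = UNIV"
proof -
  let ?f = "\<lambda>y. y - h *\<^sub>R interaction_vec \<gamma> y"
  have cont: "continuous_on Delta ?f"
    by (intro continuous_intros continuous_on_interaction_vec)
  have inj: "inj_on ?f Delta"
  proof (rule inj_onI)
    fix x y assume "x \<in> Delta" "y \<in> Delta" "?f x = ?f y"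
    then have "norm (x - y) \<le> 0"
      using implicit_map_expanding[of x y h] h by simp
    then show "x = y" by simp
  qed
  have op: "open (?f ` Delta)" by (rule invariance_of_domain[OF cont open_Delta inj])
  have cl: "closed (?f ` Delta)"
    unfolding closed_sequential_limits
  proof (intro allI impI, elim conjE)
    fix z l assume z: "\<forall>k. z k \<in> ?f ` Delta" and zl: "z \<longlonglongrightarrow> l"
    then obtain y where y: "\<And>k. y k \<in> Delta" "\<And>k. z k = ?f (y k)" 
    proof -
      have "\<forall>k. \<exists>y. y \<in> Delta \<and> z k = ?f y" using z by blast
      then show ?thesis using that by metis
    qed
    have "Cauchy y"
      unfolding Cauchy_def
    proof (intro allI impI)
      fix e :: real assume "e > 0"
      then obtain N where N: "\<And>m n. m \<ge> N \<Longrightarrow> n \<ge> N \<Longrightarrow> dist (z m) (z n) < e"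
        using LIMSEQ_imp_Cauchy[OF zl] unfolding Cauchy_def by blast
      have "dist (y m) (y n) < e" if "m \<ge> N" "n \<ge> N" for m n
        using implicit_map_expanding[OF y(1)[of m] y(1)[of n], of h] h N[OF that]
        by (simp add: dist_norm y(2))
      then show "\<exists>N. \<forall>m\<ge>N. \<forall>n\<ge>N. dist (y m) (y n) < e" by blast
    qed
    then obtain q where q: "y \<longlonglongrightarrow> q" using convergent_eq_Cauchy[of y] by blast
    have "(\<lambda>k. (1 / h) *\<^sub>R (y k - z k)) \<longlonglongrightarrow> (1 / h) *\<^sub>R (q - l)"
      by (intro tendsto_intros q zl)
    moreover have "(\<lambda>k. (1 / h) *\<^sub>R (y k - z k)) = (\<lambda>k. interaction_vec \<gamma> (y k))"
      using h by (simp add: y(2))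
    ultimately have "q \<in> Delta" using limit_in_Delta[OF y(1) q] by auto
    then have "isCont ?f q"
      using cont open_Delta continuous_on_eq_continuous_at by blast
    then have "(\<lambda>k. ?f (y k)) \<longlonglongrightarrow> ?f q" by (rule isCont_tendsto_compose[OF _ q])
    then have "l = ?f q" using zl y(2) LIMSEQ_unique by (metis (no_types, lifting) ext)
    then show "l \<in> ?f ` Delta" using \<open>q \<in> Delta\<close> by blast
  qed
  have "?f ` Delta \<noteq> {}" using Delta_nonempty by blast
  with op cl show ?thesis using clopen[of "?f ` Delta"] by simp
qed

text \<open>The chamber-valued inverse of \<open>y \<mapsto> y - h f y\<close>, where \<open>f\<close> is the interaction.\<close>

definition resolvent :: "real \<Rightarrow> (real, 'n) vec \<Rightarrow> (real, 'n) vec" where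
  "resolvent h z = (THE y. y \<in> Delta \<and> y - h *\<^sub>R interaction_vec \<gamma> y = z)"

lemma resolvent_ex1:
  assumes "0 < h"
  shows "\<exists>!y. y \<in> Delta \<and> y - h *\<^sub>R interaction_vec \<gamma> y = z"
proof -
  obtain y where y: "y \<in> Delta" "y - h *\<^sub>R interaction_vec \<gamma> y = z"
    using implicit_map_surj[OF assms] by (metis (no_types, lifting) UNIV_I imageE)
  moreover have "y' = y" if "y' \<in> Delta" "y' - h *\<^sub>R interaction_vec \<gamma> y' = z" for y'
    using implicit_map_expanding[of y' y h] that y assms by simp
  ultimately show ?thesis by blast
qed

lemma resolvent:
  assumes "0 < h"
  shows "resolvent h z \<in> Delta" "resolvent h z - h *\<^sub>R interaction_vec \<gamma> (resolvent h z) = z"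
  using theI'[OF resolvent_ex1[OF assms, of z]] unfolding resolvent_def by auto

text \<open>For \<open>y\<close> the solution at the end of a step, the image under the implicit map is known up to the local
error, while the scheme is the resolvent of the exact data \<open>z\<close>; the distance of the two is
thus bounded without any estimate of the interaction.\<close>

lemma resolvent_stable:
  assumes "0 < h" "y \<in> Delta"
  shows "norm (y - resolvent h z) \<le> norm ((y - h *\<^sub>R interaction_vec \<gamma> y) - z)"
  using implicit_map_expanding[OF assms(2) resolvent(1)[OF assms(1), of z], of h] assms(1)
    resolvent(2)[OF assms(1), of z] by simp

lemma continuous_resolvent:
  assumes "0 < h"
  shows "continuous_on UNIV (resolvent h)"
proof (rule lipschitz_on_continuous_on)
  show "1-lipschitz_on UNIV (resolvent h)"
    using resolvent_stable[OF assms resolvent(1)[OF assms]] resolvent(2)[OF assms]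
    by (intro lipschitz_onI) (auto simp: dist_norm)
qed

lemma semi_implicit_step_eq_resolvent:
  assumes "0 < h"
  shows "(THE y. semi_implicit_step \<gamma> b (\<lambda>i j x. \<sigma> i j) h w x y)
    = resolvent h (x + h *\<^sub>R (\<chi> i. b i x) + (\<chi> i. \<Sum>j\<in>UNIV. \<sigma> i j * w $ j))"
proof -
  have "semi_implicit_step \<gamma> b (\<lambda>i j x. \<sigma> i j) h w x y \<longleftrightarrow> (y \<in> Delta \<and>
    y - h *\<^sub>R interaction_vec \<gamma> y = x + h *\<^sub>R (\<chi> i. b i x) + (\<chi> i. \<Sum>j\<in>UNIV. \<sigma> i j * w $ j))" for y
  proof -
    have "u = a + (v + c) * h + s \<longleftrightarrow> u - h * v = a + h * c + s" for u a v c s :: real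
      by (auto simp: algebra_simps)
    then show ?thesis
      unfolding semi_implicit_step_def vec_eq_iff by (simp add: interaction_vec_def)
  qed
  then show ?thesis unfolding resolvent_def by simp
qed

end

section \<open>Pathwise accumulation of local errors\<close>

text \<open>Summation by parts replaces \<open>u\<close> by its partial sums and the weight by its increments, which are
nonnegative and add up to at most \<open>E k\<close>.\<close>

lemma abel_increasing_weight:
  fixes E u :: "nat \<Rightarrow> real"
  assumes E: "\<And>i. i < k \<Longrightarrow> E i \<le> E (Suc i)" "0 \<le> E 0"
    and N: "\<And>i. i \<le> k \<Longrightarrow> \<bar>\<Sum>j<i. u j\<bar> \<le> N"
  shows "\<bar>\<Sum>j<k. E j * u j\<bar> \<le> 2 * E k * N"
proof -
  define U where "U i = (\<Sum>j<i. u j)" for i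
  have N0: "0 \<le> N" using N[of 0] by simp
  have "(\<Sum>j<i. E j * u j) = E i * U i - (\<Sum>j<i. (E (Suc j) - E j) * U (Suc j))" for i
    by (induction i) (auto simp: U_def algebra_simps)
  moreover have "0 \<le> E k"
  proof -
    have "i \<le> k \<Longrightarrow> 0 \<le> E i" for i proof (induction i)
      case (Suc i)
      then show ?case using E(1)[of i] by simp
    qed (use E in simp)
    then show ?thesis by simp
  qed
  then have "\<bar>E k * U k\<bar> \<le> E k * N"
    using N[of k] by (auto simp: abs_mult U_def intro!: mult_left_mono)
  moreover have "\<bar>\<Sum>j<k. (E (Suc j) - E j) * U (Suc j)\<bar> \<le> (\<Sum>j<k. (E (Suc j) - E j) * N)"
    using E(1) N unfolding U_def
    by (intro order_trans[OF sum_abs] sum_mono)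
      (auto simp: abs_mult simp del: sum.lessThan_Suc intro!: mult_left_mono)
  moreover have "(\<Sum>j<k. (E (Suc j) - E j) * N) = (E k - E 0) * N"
    by (simp add: sum_distrib_right[symmetric] sum_lessThan_telescope)
  moreover have "0 \<le> E 0 * N" using E N0 by simp
  moreover have "(E k - E 0) * N = E k * N - E 0 * N" by (simp add: algebra_simps)
  ultimately show ?thesis unfolding mult.assoc by (smt (verit))
qed

text \<open>The deterministic core of the error analysis. The vectors \<open>m j\<close> are summed only after pairing
with \<open>\<theta> j\<close>, so that cancellation among them is retained in \<open>N\<close>; the weight \<open>E j\<close> that has been
divided out is increasing, and summation by parts puts it back at the price of a factor 2.\<close>

lemma pathwise_stability:
  fixes e a m r \<theta> :: "nat \<Rightarrow> 'v::real_inner" and \<kappa> L N :: real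
  defines "E \<equiv> \<lambda>k. MAX i\<in>{..k}. norm (e i)"
  assumes e0: "e 0 = 0"
    and step: "\<And>k. k < n \<Longrightarrow> norm (e (Suc k)) \<le> norm (a k + m k + r k)"
    and growth: "\<And>k. k < n \<Longrightarrow> norm (a k) \<le> (1 + \<kappa>) * norm (e k)"
    and \<kappa>: "0 \<le> \<kappa>" "\<kappa> \<le> L"
    and \<theta>: "\<And>k. k < n \<Longrightarrow> a k = E k *\<^sub>R \<theta> k"
    and N: "\<And>k. k \<le> n \<Longrightarrow> \<bar>\<Sum>j<k. \<theta> j \<bullet> m j\<bar> \<le> N"
  shows "(E n)\<^sup>2 \<le> 32 * (1 + L)\<^sup>2 * exp (real n * (2 * \<kappa> * (2 + L)))
    * ((\<Sum>j<n. norm (r j))\<^sup>2 + (\<Sum>j<n. (norm (m j))\<^sup>2) + N\<^sup>2)"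
proof -
  define A where "A = (\<Sum>j<n. norm (r j))"
  define Q where "Q = (\<Sum>j<n. (norm (m j))\<^sup>2)"
  have L: "0 \<le> L" using \<kappa> by simp
  have A0: "0 \<le> A" and Q0: "0 \<le> Q" unfolding A_def Q_def by (auto intro!: sum_nonneg)
  have N0: "0 \<le> N" using N[of 0] by simp
  have E_ge: "norm (e i) \<le> E k" if "i \<le> k" for i k
    unfolding E_def using that by (intro Max_ge) auto
  have E_mono: "E i \<le> E k" if "i \<le> k" for i k
    unfolding E_def using that by (intro Max_mono) auto
  have E0: "0 \<le> E k" for k using E_ge[of 0 k] e0 by simp
  have sq: "(norm (e (Suc k)))\<^sup>2 \<le> (norm (e k))\<^sup>2 + \<kappa> * (2 + L) * (E k)\<^sup>2 + 2 * (E k * (\<theta> k \<bullet> m k))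
      + 2 * (1 + L) * (E k * norm (r k)) + 2 * (norm (m k))\<^sup>2 + 2 * (norm (r k))\<^sup>2" if k: "k < n" for k
  proof -
    have "(norm (e (Suc k)))\<^sup>2 \<le> (norm (a k + m k + r k))\<^sup>2"
      using step[OF k] by (intro power_mono) auto
    also have "\<dots> = (norm (a k))\<^sup>2 + 2 * (a k \<bullet> m k) + 2 * (a k \<bullet> r k) + (norm (m k + r k))\<^sup>2"
      by (simp add: power2_norm_eq_inner inner_add_left inner_add_right inner_commute algebra_simps)
    also have "(norm (a k))\<^sup>2 \<le> (norm (e k))\<^sup>2 + \<kappa> * (2 + L) * (E k)\<^sup>2"
    proof -
      have "(norm (a k))\<^sup>2 \<le> ((1 + \<kappa>) * norm (e k))\<^sup>2" using growth[OF k] by (intro power_mono) auto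
      also have "\<dots> = (norm (e k))\<^sup>2 + \<kappa> * (2 + \<kappa>) * (norm (e k))\<^sup>2"
        by (simp add: power2_eq_square algebra_simps)
      also have "\<dots> \<le> (norm (e k))\<^sup>2 + \<kappa> * (2 + L) * (E k)\<^sup>2"
        using \<kappa> L E_ge[of k k] by (intro add_left_mono mult_mono power_mono) auto
      finally show ?thesis .
    qed
    also have "a k \<bullet> m k = E k * (\<theta> k \<bullet> m k)" using \<theta>[OF k] by simp
    also have "a k \<bullet> r k \<le> (1 + L) * (E k * norm (r k))"
    proof -
      have "a k \<bullet> r k \<le> norm (a k) * norm (r k)" by (rule norm_cauchy_schwarz)
      also have "\<dots> \<le> ((1 + L) * E k) * norm (r k)"
        using \<kappa> L E_ge[of k k] by (intro mult_right_mono order_trans[OF growth[OF k]] mult_mono) auto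
      finally show ?thesis by (simp add: mult.assoc)
    qed
    also have "(norm (m k + r k))\<^sup>2 \<le> 2 * (norm (m k))\<^sup>2 + 2 * (norm (r k))\<^sup>2"
    proof -
      have "(norm (m k + r k))\<^sup>2 \<le> (norm (m k) + norm (r k))\<^sup>2"
        by (intro power_mono norm_triangle_ineq) auto
      also have "\<dots> \<le> 2 * (norm (m k))\<^sup>2 + 2 * (norm (r k))\<^sup>2"
        using sum_squares_bound[of "norm (m k)" "norm (r k)"] by (simp add: power2_sum)
      finally show ?thesis .
    qed
    finally show ?thesis by (simp only: mult.assoc add.assoc)
  qed
  have tel: "i \<le> n \<Longrightarrow> (norm (e i))\<^sup>2 \<le> \<kappa> * (2 + L) * (\<Sum>j<i. (E j)\<^sup>2) + 2 * (\<Sum>j<i. E j * (\<theta> j \<bullet> m j))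
      + 2 * (1 + L) * (\<Sum>j<i. E j * norm (r j)) + 2 * (\<Sum>j<i. (norm (m j))\<^sup>2) + 2 * (\<Sum>j<i. (norm (r j))\<^sup>2)" for i
  proof (induction i)
    case (Suc i)
    then show ?case using sq[of i] by (simp add: algebra_simps)
  qed (simp add: e0)
  have rec: "(E k)\<^sup>2 \<le> 32 * (1 + L)\<^sup>2 * (A\<^sup>2 + Q + N\<^sup>2) + 2 * \<kappa> * (2 + L) * (\<Sum>j<k. (E j)\<^sup>2)" if k: "k \<le> n" for k
  proof -
    have "E k \<in> (\<lambda>i. norm (e i)) ` {..k}" unfolding E_def by (rule Max_in) auto
    then obtain i where i: "i \<le> k" "E k = norm (e i)" by auto
    have 1: "(\<Sum>j<i. (E j)\<^sup>2) \<le> (\<Sum>j<k. (E j)\<^sup>2)" using i by (intro sum_mono2) auto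
    have "\<bar>\<Sum>j<i. E j * (\<theta> j \<bullet> m j)\<bar> \<le> 2 * E i * N"
      using i k by (intro abel_increasing_weight N E_mono E0) auto
    also have "\<dots> \<le> 2 * E k * N" using E_mono[OF i(1)] N0 by (intro mult_right_mono) auto
    finally have 2: "(\<Sum>j<i. E j * (\<theta> j \<bullet> m j)) \<le> 2 * E k * N" by linarith
    have "(\<Sum>j<i. E j * norm (r j)) \<le> (\<Sum>j<i. E k * norm (r j))"
      using i by (intro sum_mono mult_right_mono E_mono) auto
    also have "\<dots> \<le> (\<Sum>j<n. E k * norm (r j))" using i k E0 by (intro sum_mono2) auto
    finally have 3: "(\<Sum>j<i. E j * norm (r j)) \<le> E k * A" by (simp add: A_def sum_distrib_left)
    have 4: "(\<Sum>j<i. (norm (m j))\<^sup>2) \<le> Q" unfolding Q_def using i k by (intro sum_mono2) auto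
    have "(\<Sum>j<i. (norm (r j))\<^sup>2) \<le> (\<Sum>j<n. (norm (r j))\<^sup>2)" using i k by (intro sum_mono2) auto
    also have "\<dots> \<le> (\<Sum>j<n. norm (r j) * A)"
      unfolding power2_eq_square A_def by (intro sum_mono mult_left_mono member_le_sum) auto
    also have "\<dots> = A\<^sup>2" by (simp add: A_def sum_distrib_right power2_eq_square)
    finally have 5: "(\<Sum>j<i. (norm (r j))\<^sup>2) \<le> A\<^sup>2" .
    have "(E k)\<^sup>2 \<le> \<kappa> * (2 + L) * (\<Sum>j<k. (E j)\<^sup>2) + 2 * (2 * E k * N) + 2 * (1 + L) * (E k * A) + 2 * Q + 2 * A\<^sup>2"
    proof -
      have "\<kappa> * (2 + L) * (\<Sum>j<i. (E j)\<^sup>2) \<le> \<kappa> * (2 + L) * (\<Sum>j<k. (E j)\<^sup>2)"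
        using 1 \<kappa> L by (intro mult_left_mono) auto
      moreover have "2 * (1 + L) * (\<Sum>j<i. E j * norm (r j)) \<le> 2 * (1 + L) * (E k * A)"
        using 3 L by (intro mult_left_mono) auto
      ultimately show ?thesis using tel[of i] 2 4 5 i(1) k unfolding i(2) by linarith
    qed
    \<comment> \<open>Young's inequality; half of \<open>(E k)\<^sup>2\<close> is absorbed into the left-hand side.\<close>
    also have "2 * (2 * E k * N) \<le> (E k)\<^sup>2 / 4 + 16 * N\<^sup>2"
      using zero_le_power2[of "E k / 2 - 4 * N"] by (simp add: power2_eq_square algebra_simps)
    also have "2 * (1 + L) * (E k * A) \<le> (E k)\<^sup>2 / 4 + 4 * (1 + L)\<^sup>2 * A\<^sup>2"
      using zero_le_power2[of "E k / 2 - 2 * (1 + L) * A"] by (simp add: power2_eq_square algebra_simps)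
    finally have "(E k)\<^sup>2 \<le> 2 * (\<kappa> * (2 + L) * (\<Sum>j<k. (E j)\<^sup>2)) + 32 * N\<^sup>2 + 8 * ((1 + L)\<^sup>2 * A\<^sup>2) + 4 * Q + 4 * A\<^sup>2"
      by simp
    moreover have "1 \<le> (1 + L)\<^sup>2" using L by simp
    then have "1 * N\<^sup>2 \<le> (1 + L)\<^sup>2 * N\<^sup>2" "1 * Q \<le> (1 + L)\<^sup>2 * Q" "1 * A\<^sup>2 \<le> (1 + L)\<^sup>2 * A\<^sup>2"
      using Q0 by (simp_all only: mult_right_mono zero_le_power2)
    ultimately have "(E k)\<^sup>2 \<le> 2 * (\<kappa> * (2 + L) * (\<Sum>j<k. (E j)\<^sup>2))
        + (32 * ((1 + L)\<^sup>2 * N\<^sup>2) + 32 * ((1 + L)\<^sup>2 * A\<^sup>2) + 32 * ((1 + L)\<^sup>2 * Q))"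
      using Q0 zero_le_power2[of A] zero_le_power2[of N] by linarith
    then show ?thesis by (simp add: algebra_simps)
  qed
  have "(E n)\<^sup>2 \<le> 32 * (1 + L)\<^sup>2 * (A\<^sup>2 + Q + N\<^sup>2) * (1 + 2 * \<kappa> * (2 + L)) ^ n"
    using rec \<kappa> L by (intro discrete_gronwall[where n = n]) auto
  also have "\<dots> \<le> 32 * (1 + L)\<^sup>2 * (A\<^sup>2 + Q + N\<^sup>2) * exp (real n * (2 * \<kappa> * (2 + L)))"
    using \<kappa> L Q0 by (intro mult_left_mono one_plus_power_le_exp mult_nonneg_nonneg) auto
  finally show ?thesis by (simp add: A_def Q_def ac_simps)
qed

section \<open>Time integrals of continuous processes\<close>

text \<open>Continuity of the paths makes a process jointly measurable, as the limit of its discretizations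
in time. So Fubini's theorem is available for time integrals. The parameters are not tied to a
probability measure at first, because the measurability of a time integral is also needed
for the sub-sigma-algebras of a filtration.\<close>

locale continuous_process =
  fixes M :: "'a measure" and g :: "real \<Rightarrow> 'a \<Rightarrow> real" and a b :: real
  assumes ab: "a \<le> b"
    and meas: "\<And>t. t \<in> {a..b} \<Longrightarrow> g t \<in> borel_measurable M"
    and cont: "\<And>\<omega>. \<omega> \<in> space M \<Longrightarrow> continuous_on {a..b} (\<lambda>t. g t \<omega>)"
begin

text \<open>The process is extended to all times by its values at the end points, since the
product measure below lives on the whole line.\<close>

definition clip :: "real \<Rightarrow> real" where "clip t = max a (min b t)"

lemma clip_in: "clip t \<in> {a..b}" using ab by (auto simp: clip_def)
lemma clip_id: "t \<in> {a..b} \<Longrightarrow> clip t = t" by (auto simp: clip_def)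

lemma joint_measurable:
  "(\<lambda>(\<omega>, t). g (clip t) \<omega>) \<in> borel_measurable (M \<Otimes>\<^sub>M lborel)"
proof (rule borel_measurable_LIMSEQ_real)
  let ?r = "\<lambda>m t. real_of_int \<lfloor>t * real (Suc m)\<rfloor> / real (Suc m)"
  show "(\<lambda>x. case x of (\<omega>, t) \<Rightarrow> g (clip (?r m t)) \<omega>) \<in> borel_measurable (M \<Otimes>\<^sub>M lborel)" for m
  proof -
    have "(\<lambda>x. (\<lambda>i x. g (clip (real_of_int i / real (Suc m))) (fst x)) \<lfloor>snd x * real (Suc m)\<rfloor> x)
        \<in> borel_measurable (M \<Otimes>\<^sub>M lborel)"
    proof (rule measurable_compose_countable'[where I = UNIV
          and f = "\<lambda>i x. g (clip (real_of_int i / real (Suc m))) (fst x)" and g = "\<lambda>x. \<lfloor>snd x * real (Suc m)\<rfloor>"])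
      show "(\<lambda>x. g (clip (real_of_int i / real (Suc m))) (fst x)) \<in> borel_measurable (M \<Otimes>\<^sub>M lborel)" for i
        by (rule measurable_compose[OF measurable_fst meas[OF clip_in]])
    qed auto
    then show ?thesis by (simp add: case_prod_beta)
  qed
  fix x :: "'a \<times> real" assume "x \<in> space (M \<Otimes>\<^sub>M lborel)"
  then have om: "fst x \<in> space M" by (auto simp: space_pair_measure)
  let ?t = "snd x"
  have "(\<lambda>m. ?r m ?t) \<longlonglongrightarrow> ?t"
  proof (rule real_tendsto_sandwich)
    show "\<forall>\<^sub>F m in sequentially. ?t - 1 / real (Suc m) \<le> ?r m ?t"
    proof (intro always_eventually allI)
      fix m
      have "?t * real (Suc m) - 1 \<le> real_of_int \<lfloor>?t * real (Suc m)\<rfloor>" by linarith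
      then have "(?t * real (Suc m) - 1) / real (Suc m) \<le> ?r m ?t" by (intro divide_right_mono) auto
      then show "?t - 1 / real (Suc m) \<le> ?r m ?t" by (simp add: diff_divide_distrib del: of_nat_Suc)
    qed
    show "\<forall>\<^sub>F m in sequentially. ?r m ?t \<le> ?t"
    proof (intro always_eventually allI)
      fix m
      have "real_of_int \<lfloor>?t * real (Suc m)\<rfloor> / real (Suc m) \<le> (?t * real (Suc m)) / real (Suc m)"
        by (intro divide_right_mono) auto
      then show "?r m ?t \<le> ?t" by (simp del: of_nat_Suc)
    qed
    have "(\<lambda>m. ?t - 1 / real (Suc m)) \<longlonglongrightarrow> ?t - 0"
      by (intro tendsto_intros LIMSEQ_inverse_real_of_nat[unfolded inverse_eq_divide])
    then show "(\<lambda>m. ?t - 1 / real (Suc m)) \<longlonglongrightarrow> ?t" by simp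
  qed auto
  then have "(\<lambda>m. clip (?r m ?t)) \<longlonglongrightarrow> clip ?t"
    unfolding clip_def by (intro tendsto_intros)
  then have "(\<lambda>m. g (clip (?r m ?t)) (fst x)) \<longlonglongrightarrow> g (clip ?t) (fst x)"
    by (rule continuous_on_tendsto_compose[OF cont[OF om]]) (simp_all only: clip_in eventually_True)
  then show "(\<lambda>m. case x of (\<omega>, t) \<Rightarrow> g (clip (?r m t)) \<omega>) \<longlonglongrightarrow> (case x of (\<omega>, t) \<Rightarrow> g (clip t) \<omega>)"
    by (simp add: case_prod_beta)
qed

definition path_integral :: "'a \<Rightarrow> real" where
  "path_integral \<omega> = (LBINT t:{a..b}. g t \<omega>)"

lemma path_integral_eq: "path_integral \<omega> = (\<integral>t. indicator {a..b} t * g (clip t) \<omega> \<partial>lborel)"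
  unfolding path_integral_def set_lebesgue_integral_def
  by (intro Bochner_Integration.integral_cong) (auto simp: clip_id split: split_indicator)

lemma joint_measurable_indicator:
  "(\<lambda>(\<omega>, t). indicator {a..b} t * g (clip t) \<omega>) \<in> borel_measurable (M \<Otimes>\<^sub>M lborel)"
  unfolding case_prod_beta
  by (intro borel_measurable_times joint_measurable[unfolded case_prod_beta]
      measurable_compose[OF measurable_snd]) auto

lemma measurable_path_integral: "path_integral \<in> borel_measurable M"
  unfolding path_integral_eq[abs_def]
  by (intro lborel.borel_measurable_lebesgue_integral joint_measurable_indicator)

lemma path_integrable: "\<omega> \<in> space M \<Longrightarrow> set_integrable lborel {a..b} (\<lambda>t. g t \<omega>)"
  by (rule borel_integrable_atLeastAtMost'[OF cont])

lemma path_integral_powr_le: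
  assumes q: "1 \<le> q" and om: "\<omega> \<in> space M"
  shows "\<bar>path_integral \<omega>\<bar> powr q \<le> (b - a) powr (q - 1) * (LBINT t:{a..b}. \<bar>g t \<omega>\<bar> powr q)"
proof (cases "a = b")
  case True
  have "AE t in lborel. indicator {a..b} t *\<^sub>R g t \<omega> = 0"
    using AE_lborel_singleton[of a] by eventually_elim (use True in \<open>auto split: split_indicator\<close>)
  then have "path_integral \<omega> = 0" unfolding path_integral_def set_lebesgue_integral_def
    by (rule integral_eq_zero_AE)
  then show ?thesis using True by simp
next
  case False
  then have ba: "b - a > 0" using ab by simp
  define c where "c = (LBINT t:{a..b}. \<bar>g t \<omega>\<bar>) / (b - a)"
  have i1: "set_integrable lborel {a..b} (\<lambda>t. \<bar>g t \<omega>\<bar>)"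
    using path_integrable[OF om] by (rule set_integrable_abs)
  have i2: "set_integrable lborel {a..b} (\<lambda>t. \<bar>g t \<omega>\<bar> powr q)"
    using q by (intro borel_integrable_atLeastAtMost' continuous_on_powr' continuous_on_rabs cont[OF om]
        continuous_on_const) auto
  have ic: "set_integrable lborel {a..b} (\<lambda>t. k)" for k :: real
    by (intro borel_integrable_atLeastAtMost' continuous_on_const)
  have I: "(LBINT t:{a..b}. \<bar>g t \<omega>\<bar>) = (b - a) * c" using ba by (simp add: c_def)
  have c0: "c \<ge> 0" unfolding c_def set_lebesgue_integral_def using ba
    by (intro divide_nonneg_pos integral_nonneg_AE) auto
  have lc: "(LBINT t:{a..b}. k) = (b - a) * k" for k :: real
    using ab by (simp add: set_lebesgue_integral_def)
  have "(b - a) * c powr q = (b - a) * (c powr q - q * c powr (q - 1) * c) + q * c powr (q - 1) * ((b - a) * c)"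
    by (simp add: algebra_simps)
  also have "\<dots> = (LBINT t:{a..b}. (c powr q - q * c powr (q - 1) * c) + q * c powr (q - 1) * \<bar>g t \<omega>\<bar>)"
    by (subst set_integral_add) (auto intro!: ic i1 set_integrable_mult_right simp: lc I)
  also have "\<dots> \<le> (LBINT t:{a..b}. \<bar>g t \<omega>\<bar> powr q)"
  proof (rule set_integral_mono)
    show "set_integrable lborel {a..b} (\<lambda>t. \<bar>g t \<omega>\<bar> powr q)" by (rule i2)
    show "set_integrable lborel {a..b} (\<lambda>t. (c powr q - q * c powr (q - 1) * c) + q * c powr (q - 1) * \<bar>g t \<omega>\<bar>)"
      by (intro set_integral_add ic set_integrable_mult_right i1)
    show "(c powr q - q * c powr (q - 1) * c) + q * c powr (q - 1) * \<bar>g t \<omega>\<bar> \<le> \<bar>g t \<omega>\<bar> powr q" for t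
      using powr_tangent[OF q, of "\<bar>g t \<omega>\<bar>" c] c0 by (simp add: algebra_simps)
  qed
  finally have J: "(b - a) * c powr q \<le> (LBINT t:{a..b}. \<bar>g t \<omega>\<bar> powr q)" .
  have "\<bar>path_integral \<omega>\<bar> \<le> (b - a) * c"
    unfolding path_integral_def I[symmetric] 
    using set_integral_norm_bound[OF path_integrable[OF om]] by simp
  then have "\<bar>path_integral \<omega>\<bar> powr q \<le> ((b - a) * c) powr q" using q by (intro powr_mono2) auto
  also have "\<dots> = (b - a) powr (q - 1) * ((b - a) * c powr q)"
    using ba c0 by (simp add: powr_mult powr_diff)
  also have "\<dots> \<le> (b - a) powr (q - 1) * (LBINT t:{a..b}. \<bar>g t \<omega>\<bar> powr q)"
    using J by (intro mult_left_mono) auto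
  finally show ?thesis .
qed

end

locale continuous_process_prob = continuous_process + prob_space M
begin

sublocale pair_sigma_finite lborel M ..

text \<open>Jensen's inequality in time and Tonelli's theorem: only the moments at fixed times enter.\<close>

lemma moment_path_integral:
  assumes q: "1 \<le> q" and K: "0 \<le> K"
    and mom: "\<And>t. t \<in> {a..b} \<Longrightarrow> (\<integral>\<^sup>+ \<omega>. ennreal (\<bar>g t \<omega>\<bar> powr q) \<partial>M) \<le> ennreal K"
  shows "(\<integral>\<^sup>+ \<omega>. ennreal (\<bar>path_integral \<omega>\<bar> powr q) \<partial>M) \<le> ennreal ((b - a) powr q * K)"
proof -
  define f where "f = (\<lambda>t \<omega>. indicator {a..b} t * ennreal (\<bar>g (clip t) \<omega>\<bar> powr q))"
  have f: "(\<lambda>(t, \<omega>). f t \<omega>) \<in> borel_measurable (lborel \<Otimes>\<^sub>M M)"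
  proof -
    have *: "(\<lambda>(t, \<omega>). g (clip t) \<omega>) \<in> borel_measurable (lborel \<Otimes>\<^sub>M M)"
      using measurable_pair_swap[OF joint_measurable] by (simp add: case_prod_beta)
    have [measurable]: "(\<lambda>x. g (clip (fst x)) (snd x)) \<in> borel_measurable (lborel \<Otimes>\<^sub>M M)"
      using * by (simp add: case_prod_beta)
    show ?thesis unfolding f_def case_prod_beta by measurable
  qed
  have "(\<integral>\<^sup>+ \<omega>. ennreal (\<bar>path_integral \<omega>\<bar> powr q) \<partial>M)
      \<le> (\<integral>\<^sup>+ \<omega>. ennreal ((b - a) powr (q - 1)) * (\<integral>\<^sup>+ t. f t \<omega> \<partial>lborel) \<partial>M)"
  proof (rule nn_integral_mono)
    fix \<omega> assume om: "\<omega> \<in> space M"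
    have i2: "set_integrable lborel {a..b} (\<lambda>t. \<bar>g t \<omega>\<bar> powr q)"
      using q by (intro borel_integrable_atLeastAtMost' continuous_on_powr' continuous_on_rabs cont[OF om]
          continuous_on_const) auto
    have "(\<integral>\<^sup>+ t. f t \<omega> \<partial>lborel) = (\<integral>\<^sup>+ t. ennreal (indicator {a..b} t *\<^sub>R (\<bar>g t \<omega>\<bar> powr q)) \<partial>lborel)"
      unfolding f_def by (intro nn_integral_cong) (auto simp: clip_id split: split_indicator)
    also have "\<dots> = ennreal (LBINT t:{a..b}. \<bar>g t \<omega>\<bar> powr q)"
      using i2 unfolding set_integrable_def set_lebesgue_integral_def
      by (intro nn_integral_eq_integral) auto
    finally show "ennreal (\<bar>path_integral \<omega>\<bar> powr q) \<le> ennreal ((b - a) powr (q - 1)) * (\<integral>\<^sup>+ t. f t \<omega> \<partial>lborel)"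
      using path_integral_powr_le[OF q om] by (simp add: ennreal_mult'[symmetric] ennreal_leI)
  qed
  also have "\<dots> = ennreal ((b - a) powr (q - 1)) * (\<integral>\<^sup>+ \<omega>. (\<integral>\<^sup>+ t. f t \<omega> \<partial>lborel) \<partial>M)"
    using lborel.borel_measurable_nn_integral_fst[OF measurable_pair_swap[OF f]]
    by (intro nn_integral_cmult) simp
  also have "(\<integral>\<^sup>+ \<omega>. (\<integral>\<^sup>+ t. f t \<omega> \<partial>lborel) \<partial>M) = (\<integral>\<^sup>+ t. (\<integral>\<^sup>+ \<omega>. f t \<omega> \<partial>M) \<partial>lborel)"
    by (rule Fubini'[OF f])
  also have "\<dots> \<le> (\<integral>\<^sup>+ t. ennreal K * indicator {a..b} t \<partial>lborel)"
  proof (rule nn_integral_mono)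
    fix t
    show "(\<integral>\<^sup>+ \<omega>. f t \<omega> \<partial>M) \<le> ennreal K * indicator {a..b} t"
      using mom[of t] by (auto simp: f_def clip_id split: split_indicator)
  qed
  also have "\<dots> = ennreal (K * (b - a))"
    using ab K by (simp add: nn_integral_cmult_indicator ennreal_mult)
  also have "ennreal ((b - a) powr (q - 1)) * \<dots> = ennreal ((b - a) powr q * K)"
    using ab K q by (cases "a = b") (simp_all add: ennreal_mult[symmetric] powr_diff)
  finally show ?thesis by (simp add: mult_left_mono)
qed

lemma expectation_path_integral:
  assumes K: "0 \<le> K"
    and bound: "\<And>t. t \<in> {a..b} \<Longrightarrow> (\<integral>\<^sup>+ \<omega>. ennreal \<bar>g t \<omega>\<bar> \<partial>M) \<le> ennreal K"
    and zero: "\<And>t. t \<in> {a..b} \<Longrightarrow> (\<integral>\<omega>. g t \<omega> \<partial>M) = 0"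
  shows "integrable M path_integral" "(\<integral>\<omega>. path_integral \<omega> \<partial>M) = 0"
proof -
  define f where "f = (\<lambda>t \<omega>. indicator {a..b} t * g (clip t) \<omega>)"
  have f: "(\<lambda>(t, \<omega>). f t \<omega>) \<in> borel_measurable (lborel \<Otimes>\<^sub>M M)"
    using measurable_pair_swap[OF joint_measurable_indicator] by (simp add: case_prod_beta f_def)
  have "integrable (lborel \<Otimes>\<^sub>M M) (case_prod f)"
  proof (rule integrableI_bounded[OF f])
    have f': "(\<lambda>x. ennreal (norm (case x of (t, \<omega>) \<Rightarrow> f t \<omega>))) \<in> borel_measurable (lborel \<Otimes>\<^sub>M M)"
      using f by simp
    have "(\<integral>\<^sup>+ x. ennreal (norm (case x of (t, \<omega>) \<Rightarrow> f t \<omega>)) \<partial>(lborel \<Otimes>\<^sub>M M))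
        = (\<integral>\<^sup>+ t. (\<integral>\<^sup>+ \<omega>. ennreal (norm (f t \<omega>)) \<partial>M) \<partial>lborel)"
      using sigma_finite_measure.nn_integral_fst[OF prob_space_imp_sigma_finite[OF prob_space_axioms] f']
      by simp
    also have "\<dots> \<le> (\<integral>\<^sup>+ t. ennreal K * indicator {a..b} t \<partial>lborel)"
      using bound by (intro nn_integral_mono) (auto simp: f_def clip_id split: split_indicator)
    also have "\<dots> < \<infinity>" using ab K by (simp add: nn_integral_cmult_indicator ennreal_mult[symmetric])
    finally show "(\<integral>\<^sup>+ x. ennreal (norm (case x of (t, \<omega>) \<Rightarrow> f t \<omega>)) \<partial>(lborel \<Otimes>\<^sub>M M)) < \<infinity>" .
  qed
  note int = this
  have pe: "path_integral = (\<lambda>\<omega>. \<integral>t. f t \<omega> \<partial>lborel)"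
    by (simp add: path_integral_eq[abs_def] f_def)
  show "integrable M path_integral" unfolding pe by (rule integrable_snd[OF int])
  have "(\<integral>\<omega>. path_integral \<omega> \<partial>M) = (\<integral>t. (\<integral>\<omega>. f t \<omega> \<partial>M) \<partial>lborel)"
    unfolding pe by (rule Fubini_integral[OF int])
  also have "\<dots> = (\<integral>t. 0 \<partial>(lborel :: real measure))"
    using zero by (intro Bochner_Integration.integral_cong) (auto simp: f_def clip_id split: split_indicator)
  finally show "(\<integral>\<omega>. path_integral \<omega> \<partial>M) = 0" by simp
qed

end

section \<open>Gaussian increments\<close>

text \<open>The density is a product over coordinates, and all factors but one integrate to 1.\<close>

lemma nn_integral_normal_marginal:
  fixes h :: "real \<Rightarrow> ennreal" and l :: "'n::finite"
  assumes s: "0 < s" and h [measurable]: "h \<in> borel_measurable borel"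
  shows "(\<integral>\<^sup>+ x. ennreal (\<Prod>i\<in>UNIV. normal_density 0 s (x $ i)) * h (x $ l) \<partial>(lborel :: (real ^ 'n) measure))
    = (\<integral>\<^sup>+ y. ennreal (normal_density 0 s y) * h y \<partial>lborel)"
proof -
  define f where "f = (\<lambda>(b :: real ^ 'n) y. ennreal (normal_density 0 s y) * (if b = axis l 1 then h y else 1))"
  have B: "(Basis :: (real ^ 'n) set) = (\<lambda>i. axis i 1) ` UNIV"
    by (auto simp: Basis_vec_def)
  have inj: "inj (\<lambda>i::'n. axis i (1::real))" by (auto simp: inj_def axis_eq_axis)
  have reindex: "(\<Prod>b\<in>Basis. F b) = (\<Prod>i\<in>UNIV. F (axis i 1))" for F :: "real ^ 'n \<Rightarrow> ennreal"
    unfolding B by (subst prod.reindex[OF inj]) simp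
  have one: "(\<Prod>i\<in>UNIV. if i = l then u else 1) = u" for u :: ennreal
    by (simp add: prod.delta)
  have "(\<integral>\<^sup>+ x. ennreal (\<Prod>i\<in>UNIV. normal_density 0 s (x $ i)) * h (x $ l) \<partial>(lborel :: (real ^ 'n) measure))
      = (\<integral>\<^sup>+ x. (\<Prod>b\<in>Basis. f b (x \<bullet> b)) \<partial>(lborel :: (real ^ 'n) measure))"
  proof (rule nn_integral_cong)
    fix x :: "real ^ 'n"
    have "(\<Prod>b\<in>Basis. f b (x \<bullet> b)) = (\<Prod>i\<in>UNIV. f (axis i 1) (x $ i))"
      unfolding reindex by (simp add: inner_axis)
    also have "\<dots> = (\<Prod>i\<in>UNIV. ennreal (normal_density 0 s (x $ i)) * (if i = l then h (x $ l) else 1))"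
      unfolding f_def by (intro prod.cong refl) (auto simp: axis_eq_axis)
    also have "\<dots> = ennreal (\<Prod>i\<in>UNIV. normal_density 0 s (x $ i)) * h (x $ l)"
      by (subst prod.distrib) (simp add: one prod_ennreal)
    finally show "ennreal (\<Prod>i\<in>UNIV. normal_density 0 s (x $ i)) * h (x $ l) = (\<Prod>b\<in>Basis. f b (x \<bullet> b))" by simp
  qed
  also have "\<dots> = (\<Prod>b\<in>Basis. \<integral>\<^sup>+ y. f b y \<partial>lborel)"
  proof (rule nn_integral_lborel_prod)
    show "f b \<in> borel_measurable borel" for b unfolding f_def by (cases "b = axis l 1") auto
  qed simp
  also have "\<dots> = (\<Prod>i\<in>UNIV. if i = l then (\<integral>\<^sup>+ y. ennreal (normal_density 0 s y) * h y \<partial>lborel) else 1)"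
    unfolding reindex
  proof (intro prod.cong refl)
    fix i :: 'n
    have "(\<integral>\<^sup>+ y. ennreal (normal_density 0 s y) \<partial>lborel) = 1"
      using s integrable_normal_density[OF s, of 0] integral_normal_density[OF s, of 0]
      by (subst nn_integral_eq_integral) auto
    then show "(\<integral>\<^sup>+ y. f (axis i 1) y \<partial>lborel)
        = (if i = l then (\<integral>\<^sup>+ y. ennreal (normal_density 0 s y) * h y \<partial>lborel) else 1)"
      by (auto simp: f_def axis_eq_axis)
  qed
  finally show ?thesis by (simp add: one)
qed

lemma distributed_normal_coordinate:
  fixes Z :: "'a \<Rightarrow> real ^ 'n::finite"
  assumes s: "0 < s"
    and D: "distributed M lborel Z (\<lambda>x. ennreal (\<Prod>i\<in>UNIV. normal_density 0 s (x $ i)))"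
  shows "distributed M lborel (\<lambda>\<omega>. Z \<omega> $ l) (\<lambda>y. ennreal (normal_density 0 s y))"
proof -
  have Z [measurable]: "Z \<in> borel_measurable M" using distributed_measurable[OF D] by simp
  have Zl [measurable]: "(\<lambda>\<omega>. Z \<omega> $ l) \<in> borel_measurable M" by (rule measurable_compose[OF Z borel_measurable_nth])
  have "distr M lborel (\<lambda>\<omega>. Z \<omega> $ l) = density lborel (\<lambda>y. ennreal (normal_density 0 s y))"
  proof (rule measure_eqI)
    fix A assume "A \<in> sets (distr M lborel (\<lambda>\<omega>. Z \<omega> $ l))"
    then have A [measurable]: "A \<in> sets borel" by simp
    have "emeasure (distr M lborel (\<lambda>\<omega>. Z \<omega> $ l)) A = (\<integral>\<^sup>+ \<omega>. indicator A (Z \<omega> $ l) \<partial>M)"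
      by (subst emeasure_distr) (auto simp: nn_integral_indicator[symmetric] simp del: nn_integral_indicator
          intro!: nn_integral_cong split: split_indicator)
    also have "\<dots> = (\<integral>\<^sup>+ x. ennreal (\<Prod>i\<in>UNIV. normal_density 0 s (x $ i)) * indicator A (x $ l) \<partial>lborel)"
      by (rule distributed_nn_integral[OF D, symmetric]) simp
    also have "\<dots> = (\<integral>\<^sup>+ y. ennreal (normal_density 0 s y) * indicator A y \<partial>lborel)"
      by (rule nn_integral_normal_marginal[OF s]) simp
    also have "\<dots> = emeasure (density lborel (\<lambda>y. ennreal (normal_density 0 s y))) A"
      by (simp add: emeasure_density)
    finally show "emeasure (distr M lborel (\<lambda>\<omega>. Z \<omega> $ l)) A
        = emeasure (density lborel (\<lambda>y. ennreal (normal_density 0 s y))) A" .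
  qed simp
  then show ?thesis unfolding distributed_def by simp
qed

lemma powr_le_one_plus_power:
  fixes x q :: real
  assumes "0 \<le> x" "0 \<le> q" "q \<le> real k"
  shows "x powr q \<le> 1 + x ^ k"
proof (cases "x \<le> 1")
  case True
  then have "x powr q \<le> 1 powr q" using assms by (intro powr_mono2) auto
  then show ?thesis using assms by (simp add: add_increasing2)
next
  case False
  then have "x powr q \<le> x powr real k" using assms by (intro powr_mono) auto
  then show ?thesis using False by (simp add: powr_realpow)
qed

text \<open>An even integer moment, which is known explicitly, dominates the moment of any smaller real order;
applied to the standardized variable this gives the scaling in \<open>s\<close>.\<close>

lemma normal_powr_moment_bound:
  fixes Z :: "'a \<Rightarrow> real"
  assumes s: "0 < s" and q: "0 \<le> q" "q \<le> real (2 * k)"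
    and D: "distributed M lborel Z (\<lambda>y. ennreal (normal_density 0 s y))" and M: "prob_space M"
  shows "(\<integral>\<^sup>+ \<omega>. ennreal (\<bar>Z \<omega>\<bar> powr q) \<partial>M) \<le> ennreal (s powr q * (1 + fact (2 * k) / (2 ^ k * fact k)))"
proof -
  interpret prob_space M by fact
  have Z [measurable]: "Z \<in> borel_measurable M" using distributed_measurable[OF D] by simp
  have "(\<integral>\<^sup>+ \<omega>. ennreal (Z \<omega> ^ (2 * k)) \<partial>M) = (\<integral>\<^sup>+ y. ennreal (normal_density 0 s y * (y - 0) ^ (2 * k)) \<partial>lborel)"
    by (subst distributed_nn_integral[OF D, symmetric])
      (auto simp: ennreal_mult intro!: nn_integral_cong)
  also have "\<dots> = ennreal (\<integral> y. normal_density 0 s y * (y - 0) ^ (2 * k) \<partial>lborel)"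
    using integrable_normal_moment[OF s, of 0 "2 * k"] by (intro nn_integral_eq_integral) auto
  also have "\<dots> = ennreal (s ^ (2 * k) * (fact (2 * k) / (2 ^ k * fact k)))"
    unfolding integral_normal_moment_even[OF s] using s by (simp add: power_divide power_mult)
  finally have E: "(\<integral>\<^sup>+ \<omega>. ennreal (Z \<omega> ^ (2 * k)) \<partial>M) = ennreal (s ^ (2 * k) * (fact (2 * k) / (2 ^ k * fact k)))" .
  have "(\<integral>\<^sup>+ \<omega>. ennreal (\<bar>Z \<omega>\<bar> powr q) \<partial>M)
      \<le> (\<integral>\<^sup>+ \<omega>. ennreal (s powr q) + ennreal (s powr q / s ^ (2 * k)) * ennreal (Z \<omega> ^ (2 * k)) \<partial>M)"
  proof (rule nn_integral_mono)
    fix \<omega>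
    have "\<bar>Z \<omega>\<bar> powr q = s powr q * (\<bar>Z \<omega>\<bar> / s) powr q" using s by (simp add: powr_divide)
    also have "\<dots> \<le> s powr q * (1 + (\<bar>Z \<omega>\<bar> / s) ^ (2 * k))"
      using s q by (intro mult_left_mono powr_le_one_plus_power) auto
    also have "\<dots> = s powr q + s powr q / s ^ (2 * k) * Z \<omega> ^ (2 * k)"
      by (simp add: power_divide algebra_simps power_even_abs)
    finally show "ennreal (\<bar>Z \<omega>\<bar> powr q) \<le> ennreal (s powr q) + ennreal (s powr q / s ^ (2 * k)) * ennreal (Z \<omega> ^ (2 * k))"
      using s by (simp add: ennreal_plus[symmetric] ennreal_mult[symmetric] ennreal_leI del: ennreal_plus)
  qed
  also have "\<dots> = ennreal (s powr q) + ennreal (s powr q / s ^ (2 * k)) * ennreal (s ^ (2 * k) * (fact (2 * k) / (2 ^ k * fact k)))"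
    by (subst nn_integral_add) (auto simp: nn_integral_cmult E emeasure_space_1)
  also have "\<dots> = ennreal (s powr q * (1 + fact (2 * k) / (2 ^ k * fact k)))"
    using s by (simp add: ennreal_plus[symmetric] ennreal_mult[symmetric] algebra_simps del: ennreal_plus)
  finally show ?thesis .
qed

lemma normal_expectation:
  fixes Z :: "'a \<Rightarrow> real"
  assumes s: "0 < s" and D: "distributed M lborel Z (\<lambda>y. ennreal (normal_density 0 s y))"
  shows "integrable M Z" "(\<integral>\<omega>. Z \<omega> \<partial>M) = 0"
proof -
  show "(\<integral>\<omega>. Z \<omega> \<partial>M) = 0"
    using distributed_integral[OF D, of "\<lambda>x. x"] integral_normal_moment_nz_1[OF s, of 0] by simp
  show "integrable M Z"
    using distributed_integrable[OF D, of "\<lambda>x. x"] integrable_normal_moment_nz_1[OF s, of 0] by simp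
qed

lemma (in prob_space) indep_increment_product:
  fixes Z :: "'a \<Rightarrow> real ^ 'n::finite" and H :: "'a \<Rightarrow> real"
  assumes F: "subalgebra M F" and Z: "Z \<in> borel_measurable M"
    and ind: "indep_set (sets F) (sets (vimage_algebra (space M) Z borel))"
    and H: "H \<in> borel_measurable F" "integrable M H" and Zl: "integrable M (\<lambda>\<omega>. Z \<omega> $ l)"
    and mean: "(\<integral>\<omega>. Z \<omega> $ l \<partial>M) = 0"
  shows "integrable M (\<lambda>\<omega>. H \<omega> * Z \<omega> $ l)" "(\<integral>\<omega>. H \<omega> * Z \<omega> $ l \<partial>M) = 0"
proof -
  have sp: "space F = space M" using F by (simp add: subalgebra_def)
  have HM: "H \<in> borel_measurable M" using H(1) F by (rule measurable_from_subalg[rotated])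
  have "indep_var borel H borel (\<lambda>\<omega>. Z \<omega> $ l)"
    unfolding indep_var_eq
  proof (intro conjI)
    show "random_variable borel H" "random_variable borel (\<lambda>\<omega>. Z \<omega> $ l)"
      using HM Zl by auto
    have 1: "sigma_sets (space M) {H -` A \<inter> space M |A. A \<in> sets borel} \<subseteq> sets F"
    proof -
      have "{H -` A \<inter> space M |A. A \<in> sets borel} \<subseteq> sets F"
        using measurable_sets[OF H(1)] sp by auto
      then show ?thesis using sets.sigma_sets_subset[of _ F] sp by auto
    qed
    have 2: "sigma_sets (space M) {(\<lambda>\<omega>. Z \<omega> $ l) -` A \<inter> space M |A. A \<in> sets borel}
        \<subseteq> sets (vimage_algebra (space M) Z borel)"
    proof -
      have "{(\<lambda>\<omega>. Z \<omega> $ l) -` A \<inter> space M |A. A \<in> sets borel} \<subseteq> sets (vimage_algebra (space M) Z borel)"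
      proof clarify
        fix A :: "real set" assume A: "A \<in> sets borel"
        have "(\<lambda>x::real^'n. x $ l) -` A \<inter> space borel \<in> sets borel"
          by (rule measurable_sets[OF _ A]) (rule borel_measurable_nth)
        then have "Z -` ((\<lambda>x. x $ l) -` A) \<inter> space M \<in> sets (vimage_algebra (space M) Z borel)"
          by (intro in_vimage_algebra) simp
        then show "(\<lambda>\<omega>. Z \<omega> $ l) -` A \<inter> space M \<in> sets (vimage_algebra (space M) Z borel)"
          by (simp add: vimage_def)
      qed
      then show ?thesis
        using sets.sigma_sets_subset[of _ "vimage_algebra (space M) Z borel"] by simp
    qed
    show "indep_set (sigma_sets (space M) {H -` A \<inter> space M |A. A \<in> sets borel})
        (sigma_sets (space M) {(\<lambda>\<omega>. Z \<omega> $ l) -` A \<inter> space M |A. A \<in> sets borel})"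
      unfolding indep_set_def
      by (rule indep_sets_mono_sets[OF ind[unfolded indep_set_def]]) (use 1 2 in \<open>auto split: bool.split\<close>)
  qed
  from indep_var_lebesgue_integral[OF this H(2) Zl] indep_var_integrable[OF this H(2) Zl]
  show "integrable M (\<lambda>\<omega>. H \<omega> * Z \<omega> $ l)" "(\<integral>\<omega>. H \<omega> * Z \<omega> $ l \<partial>M) = 0"
    by (simp_all add: mean)
qed

section \<open>Families bounded in a moment\<close>

text \<open>Uniform bounds over a family of random variables, without naming the constants. The estimates of
this file have to be uniform in the step size and in the position of the step; both are
part of the index \<open>x\<close>.\<close>

definition bounded_Lp :: "'a measure \<Rightarrow> real \<Rightarrow> 'p set \<Rightarrow> ('p \<Rightarrow> 'a \<Rightarrow> real) \<Rightarrow> bool" where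
  "bounded_Lp M q P f \<longleftrightarrow> (\<forall>x\<in>P. f x \<in> borel_measurable M) \<and>
    (\<exists>K\<ge>0. \<forall>x\<in>P. (\<integral>\<^sup>+ \<omega>. ennreal (\<bar>f x \<omega>\<bar> powr q) \<partial>M) \<le> ennreal K)"

lemma bounded_LpI:
  assumes "\<And>x. x \<in> P \<Longrightarrow> f x \<in> borel_measurable M" "0 \<le> K"
    "\<And>x. x \<in> P \<Longrightarrow> (\<integral>\<^sup>+ \<omega>. ennreal (\<bar>f x \<omega>\<bar> powr q) \<partial>M) \<le> ennreal K"
  shows "bounded_Lp M q P f"
  using assms unfolding bounded_Lp_def by blast

lemma bounded_Lp_measurable: "bounded_Lp M q P f \<Longrightarrow> x \<in> P \<Longrightarrow> f x \<in> borel_measurable M"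
  unfolding bounded_Lp_def by blast

lemma nn_integral_abs_sum_powr_le:
  fixes f :: "'b \<Rightarrow> 'a \<Rightarrow> real"
  assumes I: "finite I" and q: "1 \<le> q" and m: "\<And>i. i \<in> I \<Longrightarrow> f i \<in> borel_measurable M"
    and K: "\<And>i. i \<in> I \<Longrightarrow> 0 \<le> K i"
    "\<And>i. i \<in> I \<Longrightarrow> (\<integral>\<^sup>+ \<omega>. ennreal (\<bar>f i \<omega>\<bar> powr q) \<partial>M) \<le> ennreal (K i)"
  shows "(\<integral>\<^sup>+ \<omega>. ennreal (\<bar>\<Sum>i\<in>I. f i \<omega>\<bar> powr q) \<partial>M) \<le> ennreal (real (card I) powr (q - 1) * (\<Sum>i\<in>I. K i))"
proof -
  have "(\<integral>\<^sup>+ \<omega>. ennreal (\<bar>\<Sum>i\<in>I. f i \<omega>\<bar> powr q) \<partial>M)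
      \<le> (\<integral>\<^sup>+ \<omega>. ennreal (real (card I) powr (q - 1)) * (\<Sum>i\<in>I. ennreal (\<bar>f i \<omega>\<bar> powr q)) \<partial>M)"
    using abs_sum_powr_le[OF I q]
    by (intro nn_integral_mono) (simp add: sum_ennreal ennreal_mult[symmetric] sum_nonneg ennreal_leI)
  also have "\<dots> = ennreal (real (card I) powr (q - 1)) * (\<Sum>i\<in>I. \<integral>\<^sup>+ \<omega>. ennreal (\<bar>f i \<omega>\<bar> powr q) \<partial>M)"
    using m by (subst nn_integral_cmult, measurable, subst nn_integral_sum) auto
  also have "\<dots> \<le> ennreal (real (card I) powr (q - 1)) * (\<Sum>i\<in>I. ennreal (K i))"
    using K by (intro mult_left_mono sum_mono) auto
  also have "\<dots> = ennreal (real (card I) powr (q - 1) * (\<Sum>i\<in>I. K i))"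
    using K by (simp add: sum_ennreal ennreal_mult sum_nonneg)
  finally show ?thesis .
qed

lemma bounded_Lp_sum:
  assumes I: "finite I" and q: "1 \<le> q" and f: "\<And>i. i \<in> I \<Longrightarrow> bounded_Lp M q P (f i)"
  shows "bounded_Lp M q P (\<lambda>x \<omega>. \<Sum>i\<in>I. f i x \<omega>)"
proof -
  have "\<exists>K. \<forall>i\<in>I. 0 \<le> K i \<and> (\<forall>x\<in>P. (\<integral>\<^sup>+ \<omega>. ennreal (\<bar>f i x \<omega>\<bar> powr q) \<partial>M) \<le> ennreal (K i))"
    using f unfolding bounded_Lp_def by (intro bchoice) blast
  then obtain K where K: "\<And>i. i \<in> I \<Longrightarrow> 0 \<le> K i"
    "\<And>i x. i \<in> I \<Longrightarrow> x \<in> P \<Longrightarrow> (\<integral>\<^sup>+ \<omega>. ennreal (\<bar>f i x \<omega>\<bar> powr q) \<partial>M) \<le> ennreal (K i)"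
    by blast
  show ?thesis
  proof (rule bounded_LpI)
    show "(\<lambda>\<omega>. \<Sum>i\<in>I. f i x \<omega>) \<in> borel_measurable M" if "x \<in> P" for x
      using bounded_Lp_measurable[OF f that] by (intro borel_measurable_sum)
    show "0 \<le> real (card I) powr (q - 1) * (\<Sum>i\<in>I. K i)"
      using K by (intro mult_nonneg_nonneg sum_nonneg) auto
    fix x assume x: "x \<in> P"
    show "(\<integral>\<^sup>+ \<omega>. ennreal (\<bar>\<Sum>i\<in>I. f i x \<omega>\<bar> powr q) \<partial>M) \<le> ennreal (real (card I) powr (q - 1) * (\<Sum>i\<in>I. K i))"
      using K x by (intro nn_integral_abs_sum_powr_le[OF I q] bounded_Lp_measurable[OF f x])
  qed
qed

lemma bounded_Lp_add:
  assumes q: "1 \<le> q" and f: "bounded_Lp M q P f" "bounded_Lp M q P g"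
  shows "bounded_Lp M q P (\<lambda>x \<omega>. f x \<omega> + g x \<omega>)"
proof -
  have "bounded_Lp M q P (\<lambda>x \<omega>. \<Sum>i\<in>{True, False}. (if i then f else g) x \<omega>)"
    using f by (intro bounded_Lp_sum q) auto
  then show ?thesis by simp
qed

lemma bounded_Lp_mono:
  assumes f: "bounded_Lp M q P f" and q: "0 \<le> q" and g: "\<And>x. x \<in> P \<Longrightarrow> g x \<in> borel_measurable M"
    and le: "\<And>x. x \<in> P \<Longrightarrow> AE \<omega> in M. \<bar>g x \<omega>\<bar> \<le> \<bar>f x \<omega>\<bar>"
  shows "bounded_Lp M q P g"
proof -
  obtain K where K: "0 \<le> K" "\<And>x. x \<in> P \<Longrightarrow> (\<integral>\<^sup>+ \<omega>. ennreal (\<bar>f x \<omega>\<bar> powr q) \<partial>M) \<le> ennreal K"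
    using f unfolding bounded_Lp_def by blast
  show ?thesis
  proof (rule bounded_LpI[OF g K(1)])
    fix x assume x: "x \<in> P"
    have "(\<integral>\<^sup>+ \<omega>. ennreal (\<bar>g x \<omega>\<bar> powr q) \<partial>M) \<le> (\<integral>\<^sup>+ \<omega>. ennreal (\<bar>f x \<omega>\<bar> powr q) \<partial>M)"
      using le[OF x] q by (intro nn_integral_mono_AE) (auto intro!: ennreal_leI powr_mono2 elim!: eventually_mono)
    also have "\<dots> \<le> ennreal K" by (rule K(2)[OF x])
    finally show "(\<integral>\<^sup>+ \<omega>. ennreal (\<bar>g x \<omega>\<bar> powr q) \<partial>M) \<le> ennreal K" .
  qed
qed

lemma bounded_Lp_cmult:
  assumes f: "bounded_Lp M q P f"
  shows "bounded_Lp M q P (\<lambda>x \<omega>. c * f x \<omega>)"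
proof -
  obtain K where K: "0 \<le> K" "\<And>x. x \<in> P \<Longrightarrow> (\<integral>\<^sup>+ \<omega>. ennreal (\<bar>f x \<omega>\<bar> powr q) \<partial>M) \<le> ennreal K"
    using f unfolding bounded_Lp_def by blast
  show ?thesis
  proof (rule bounded_LpI)
    fix x assume x: "x \<in> P"
    note [measurable] = bounded_Lp_measurable[OF f x]
    show "(\<lambda>\<omega>. c * f x \<omega>) \<in> borel_measurable M" by measurable
    have "(\<integral>\<^sup>+ \<omega>. ennreal (\<bar>c * f x \<omega>\<bar> powr q) \<partial>M) = ennreal (\<bar>c\<bar> powr q) * (\<integral>\<^sup>+ \<omega>. ennreal (\<bar>f x \<omega>\<bar> powr q) \<partial>M)"
      by (subst nn_integral_cmult[symmetric]) (auto simp: abs_mult powr_mult ennreal_mult)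
    also have "\<dots> \<le> ennreal (\<bar>c\<bar> powr q) * ennreal K" using K(2)[OF x] by (intro mult_left_mono) auto
    finally show "(\<integral>\<^sup>+ \<omega>. ennreal (\<bar>c * f x \<omega>\<bar> powr q) \<partial>M) \<le> ennreal (\<bar>c\<bar> powr q * K)"
      using K(1) by (simp add: ennreal_mult)
  qed (use K in auto)
qed

lemma bounded_Lp_abs:
  assumes "bounded_Lp M q P f"
  shows "bounded_Lp M q P (\<lambda>x \<omega>. \<bar>f x \<omega>\<bar>)"
  using assms unfolding bounded_Lp_def by auto

lemma bounded_Lp_power:
  assumes "bounded_Lp M (real k * q) P f" "0 < k"
  shows "bounded_Lp M q P (\<lambda>x \<omega>. f x \<omega> ^ k)"
proof -
  have e: "\<bar>y ^ k\<bar> powr q = \<bar>y\<bar> powr (real k * q)" for y :: real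
    using assms(2) by (cases "y = 0") (simp_all add: power_abs powr_powr flip: powr_realpow)
  show ?thesis using assms(1) unfolding bounded_Lp_def e by auto
qed

lemma bounded_Lp_reindex:
  assumes "bounded_Lp M q Q f" "\<And>x. x \<in> P \<Longrightarrow> r x \<in> Q"
  shows "bounded_Lp M q P (\<lambda>x. f (r x))"
  using assms unfolding bounded_Lp_def by blast

lemma (in prob_space) bounded_Lp_const: "bounded_Lp M q P (\<lambda>_ _. c)"
  by (rule bounded_LpI[where K = "\<bar>c\<bar> powr q"]) (auto simp: emeasure_space_1)

lemma abs_le_one_plus_powr:
  fixes y q :: real
  assumes "1 \<le> q"
  shows "\<bar>y\<bar> \<le> 1 + \<bar>y\<bar> powr q"
proof (cases "\<bar>y\<bar> \<le> 1")
  case False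
  then have "\<bar>y\<bar> powr 1 \<le> \<bar>y\<bar> powr q" using assms by (intro powr_mono) auto
  then show ?thesis by simp
qed (simp add: add_increasing2)

lemma (in prob_space) bounded_Lp_nn_integral_abs:
  assumes f: "bounded_Lp M q P f" and q: "1 \<le> q"
  obtains K where "0 \<le> K" "\<And>x. x \<in> P \<Longrightarrow> (\<integral>\<^sup>+ \<omega>. ennreal \<bar>f x \<omega>\<bar> \<partial>M) \<le> ennreal K"
proof -
  obtain K where K: "0 \<le> K" "\<And>x. x \<in> P \<Longrightarrow> (\<integral>\<^sup>+ \<omega>. ennreal (\<bar>f x \<omega>\<bar> powr q) \<partial>M) \<le> ennreal K"
    using f unfolding bounded_Lp_def by blast
  have "(\<integral>\<^sup>+ \<omega>. ennreal \<bar>f x \<omega>\<bar> \<partial>M) \<le> ennreal (1 + K)" if x: "x \<in> P" for x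
  proof -
    note [measurable] = bounded_Lp_measurable[OF f x]
    have "(\<integral>\<^sup>+ \<omega>. ennreal \<bar>f x \<omega>\<bar> \<partial>M) \<le> (\<integral>\<^sup>+ \<omega>. 1 + ennreal (\<bar>f x \<omega>\<bar> powr q) \<partial>M)"
    proof (rule nn_integral_mono)
      fix \<omega>
      have "ennreal \<bar>f x \<omega>\<bar> \<le> ennreal (1 + \<bar>f x \<omega>\<bar> powr q)"
        by (intro ennreal_leI abs_le_one_plus_powr q)
      then show "ennreal \<bar>f x \<omega>\<bar> \<le> 1 + ennreal (\<bar>f x \<omega>\<bar> powr q)" by (simp add: ennreal_plus)
    qed
    also have "\<dots> = 1 + (\<integral>\<^sup>+ \<omega>. ennreal (\<bar>f x \<omega>\<bar> powr q) \<partial>M)"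
      by (subst nn_integral_add) (auto simp: emeasure_space_1)
    also have "\<dots> \<le> 1 + ennreal K" using K(2)[OF x] by (intro add_left_mono)
    finally show ?thesis using K(1) by (simp add: ennreal_plus)
  qed
  then show ?thesis using that[of "1 + K"] K(1) by auto
qed

lemma (in prob_space) bounded_Lp_integrable:
  assumes f: "bounded_Lp M q P f" and q: "1 \<le> q" and x: "x \<in> P"
  shows "integrable M (f x)"
proof -
  obtain K where K: "\<And>x. x \<in> P \<Longrightarrow> (\<integral>\<^sup>+ \<omega>. ennreal \<bar>f x \<omega>\<bar> \<partial>M) \<le> ennreal K"
    using bounded_Lp_nn_integral_abs[OF f q] by metis
  show ?thesis
    using K[OF x] by (intro integrableI_bounded bounded_Lp_measurable[OF f x]) (auto intro: le_less_trans)
qed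

section \<open>Moments along one step of the particle system\<close>

lemma borel_measurable_vec_component [measurable (raw)]:
  fixes f :: "'a \<Rightarrow> real ^ 'n::finite"
  shows "f \<in> borel_measurable M \<Longrightarrow> (\<lambda>\<omega>. f \<omega> $ i) \<in> borel_measurable M"
  by (rule measurable_compose[OF _ borel_measurable_nth])

text \<open>The setting in which the error is estimated. Paths are continuous and stay in the chamber on the
whole probability space, which is achieved later by a change on a null set. Of the law of
the Brownian motion only the moments of its increments are kept, and their orthogonality to the
past. The exponent \<open>8 p\<close> makes the square of an increment have a moment of order \<open>4 p\<close>, like the other quantities.\<close>

locale particle_system = prob_space M + repulsion \<gamma>
  for M :: "'a measure" and \<gamma> :: "'n::{finite,linorder} \<Rightarrow> 'n \<Rightarrow> real" +
  fixes F :: "real \<Rightarrow> 'a measure" and W X :: "real \<Rightarrow> 'a \<Rightarrow> (real, 'n) vec"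
    and \<sigma> :: "'n \<Rightarrow> 'n \<Rightarrow> real" and b :: "'n \<Rightarrow> (real, 'n) vec \<Rightarrow> real"
    and b' :: "'n \<Rightarrow> (real, 'n) vec \<Rightarrow> (real, 'n) vec" and T p B :: real
  assumes T: "0 < T" and p: "2 \<le> p"
    and subalg: "\<And>t. 0 \<le> t \<Longrightarrow> subalgebra M (F t)"
    and F_mono: "\<And>s t. 0 \<le> s \<Longrightarrow> s \<le> t \<Longrightarrow> sets (F s) \<subseteq> sets (F t)"
    and X_adapted: "\<And>t. t \<in> {0..T} \<Longrightarrow> X t \<in> borel_measurable (F t)"
    and W_adapted: "\<And>t. t \<in> {0..T} \<Longrightarrow> W t \<in> borel_measurable (F t)"
    and X_cont: "\<And>\<omega>. \<omega> \<in> space M \<Longrightarrow> continuous_on {0..T} (\<lambda>t. X t \<omega>)"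
    and W_cont: "\<And>\<omega>. \<omega> \<in> space M \<Longrightarrow> continuous_on {0..T} (\<lambda>t. W t \<omega>)"
    and X_Delta: "\<And>\<omega> t. \<omega> \<in> space M \<Longrightarrow> t \<in> {0..T} \<Longrightarrow> X t \<omega> \<in> Delta"
    and sde: "AE \<omega> in M. \<forall>s t i. 0 \<le> s \<longrightarrow> s \<le> t \<longrightarrow> t \<le> T \<longrightarrow>
      X t \<omega> $ i - X s \<omega> $ i = (LBINT r:{s..t}. interaction \<gamma> (X r \<omega>) i + b i (X r \<omega>))
        + (\<Sum>j\<in>UNIV. \<sigma> i j * (W t \<omega> $ j - W s \<omega> $ j))"
    and gap_moment: "\<And>i j. i \<noteq> j \<Longrightarrow> bounded_Lp M (4 * p) {0..T} (\<lambda>t \<omega>. 1 / \<bar>X t \<omega> $ i - X t \<omega> $ j\<bar>)"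
    and W_moment: "\<And>l. \<exists>K\<ge>0. \<forall>s t. 0 \<le> s \<longrightarrow> s \<le> t \<longrightarrow> t \<le> T \<longrightarrow>
      (\<integral>\<^sup>+ \<omega>. ennreal (\<bar>W t \<omega> $ l - W s \<omega> $ l\<bar> powr (8 * p)) \<partial>M) \<le> ennreal ((t - s) powr (4 * p) * K)"
    and W_indep: "\<And>s t H l. 0 \<le> s \<Longrightarrow> s \<le> t \<Longrightarrow> t \<le> T \<Longrightarrow> H \<in> borel_measurable (F s) \<Longrightarrow> integrable M H \<Longrightarrow>
      integrable M (\<lambda>\<omega>. H \<omega> * (W t \<omega> $ l - W s \<omega> $ l)) \<and> (\<integral>\<omega>. H \<omega> * (W t \<omega> $ l - W s \<omega> $ l) \<partial>M) = 0"
    and B: "0 \<le> B" and b_bound: "\<And>i x. \<bar>b i x\<bar> \<le> B"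
    and b_lipschitz: "\<And>i x y. \<bar>b i x - b i y\<bar> \<le> B * norm (x - y)"
    and b'_bound: "\<And>i x. norm (b' i x) \<le> B" and b'_cont: "\<And>i. continuous_on UNIV (b' i)"
    and b_taylor: "\<And>i x y. \<bar>b i y - b i x - b' i x \<bullet> (y - x)\<bar> \<le> B * (norm (y - x))\<^sup>2"
begin

lemma b_cont: "continuous_on UNIV (b i)"
proof (rule lipschitz_on_continuous_on)
  show "B-lipschitz_on UNIV (b i)"
    using b_lipschitz B by (intro lipschitz_onI) (auto simp: dist_norm)
qed

lemma b_meas [measurable]: "b i \<in> borel_measurable borel"
  by (rule borel_measurable_continuous_onI[OF b_cont])

lemma b'_meas [measurable]: "b' i \<in> borel_measurable borel"
  by (rule borel_measurable_continuous_onI[OF b'_cont])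

lemma F_measurable_mono:
  assumes "f \<in> borel_measurable (F s)" "0 \<le> s" "s \<le> t"
  shows "f \<in> borel_measurable (F t)"
proof -
  have "space (F s) = space (F t)"
    using subalg[of s] subalg[of t] assms by (simp add: subalgebra_def)
  then show ?thesis using assms F_mono[of s t] by (auto simp: measurable_def)
qed

lemma X_F: "t \<in> {0..T} \<Longrightarrow> t \<le> t' \<Longrightarrow> X t \<in> borel_measurable (F t')"
  by (rule F_measurable_mono[OF X_adapted]) auto

lemma W_F: "t \<in> {0..T} \<Longrightarrow> t \<le> t' \<Longrightarrow> W t \<in> borel_measurable (F t')"
  by (rule F_measurable_mono[OF W_adapted]) auto

lemma F_M: "0 \<le> t \<Longrightarrow> f \<in> borel_measurable (F t) \<Longrightarrow> f \<in> borel_measurable M"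
  using subalg by (rule measurable_from_subalg)

lemma X_M [measurable]: "t \<in> {0..T} \<Longrightarrow> X t \<in> borel_measurable M"
  by (rule F_M[OF _ X_adapted]) auto

lemma W_M [measurable]: "t \<in> {0..T} \<Longrightarrow> W t \<in> borel_measurable M"
  by (rule F_M[OF _ W_adapted]) auto

lemma space_F: "0 \<le> t \<Longrightarrow> space (F t) = space M"
  using subalg by (simp add: subalgebra_def)

lemma interaction_measurable [measurable]: "(\<lambda>x. interaction \<gamma> x i) \<in> borel_measurable borel"
  unfolding interaction_def by measurable

definition drift :: "'n \<Rightarrow> real \<Rightarrow> 'a \<Rightarrow> real" where
  "drift i t \<omega> = interaction \<gamma> (X t \<omega>) i + b i (X t \<omega>)"

definition inv_gap :: "(real, 'n) vec \<Rightarrow> real" where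
  "inv_gap x = (\<Sum>i\<in>UNIV. \<Sum>j\<in>UNIV. 1 / \<bar>x $ i - x $ j\<bar>)"

definition \<Gamma> :: real where "\<Gamma> = (\<Sum>i\<in>UNIV. \<Sum>j\<in>UNIV. \<bar>\<gamma> i j\<bar>)"

definition sigma_norm :: real where "sigma_norm = (\<Sum>i\<in>UNIV. \<Sum>j\<in>UNIV. \<bar>\<sigma> i j\<bar>)"

lemma inv_gap_nonneg: "0 \<le> inv_gap x" unfolding inv_gap_def by (intro sum_nonneg) auto
lemma \<Gamma>_nonneg: "0 \<le> \<Gamma>" unfolding \<Gamma>_def by (intro sum_nonneg) auto
lemma sigma_norm_nonneg: "0 \<le> sigma_norm" unfolding sigma_norm_def by (intro sum_nonneg) auto

lemma double_sum_ge:
  fixes f :: "'n \<Rightarrow> 'n \<Rightarrow> real"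
  assumes "\<And>i j. 0 \<le> f i j"
  shows "(\<Sum>j\<in>UNIV. f i j) \<le> (\<Sum>i\<in>UNIV. \<Sum>j\<in>UNIV. f i j)" "f i j \<le> (\<Sum>i\<in>UNIV. \<Sum>j\<in>UNIV. f i j)"
proof -
  show 1: "(\<Sum>j\<in>UNIV. f i j) \<le> (\<Sum>i\<in>UNIV. \<Sum>j\<in>UNIV. f i j)"
    using assms by (intro member_le_sum) (auto intro!: sum_nonneg)
  have "f i j \<le> (\<Sum>j\<in>UNIV. f i j)" using assms by (intro member_le_sum) auto
  then show "f i j \<le> (\<Sum>i\<in>UNIV. \<Sum>j\<in>UNIV. f i j)" using 1 by linarith
qed

lemma inv_gap_ge: "1 / \<bar>x $ i - x $ j\<bar> \<le> inv_gap x"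
  unfolding inv_gap_def by (rule double_sum_ge(2)) auto

lemma \<Gamma>_ge: "(\<Sum>j\<in>UNIV. \<bar>\<gamma> i j\<bar>) \<le> \<Gamma>"
  unfolding \<Gamma>_def by (rule double_sum_ge(1)) auto

lemma sigma_norm_ge: "\<bar>\<sigma> i j\<bar> \<le> sigma_norm"
  unfolding sigma_norm_def by (rule double_sum_ge(2)) auto

lemma drift_bound: "\<bar>drift i t \<omega>\<bar> \<le> \<Gamma> * inv_gap (X t \<omega>) + B"
proof -
  have "\<bar>interaction \<gamma> (X t \<omega>) i\<bar> \<le> (\<Sum>j\<in>UNIV. \<bar>\<gamma> i j / (X t \<omega> $ i - X t \<omega> $ j)\<bar>)"
    unfolding interaction_eq_sum by (rule sum_abs)
  also have "\<dots> \<le> (\<Sum>j\<in>UNIV. \<bar>\<gamma> i j\<bar> * inv_gap (X t \<omega>))"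
  proof (rule sum_mono)
    fix j
    show "\<bar>\<gamma> i j / (X t \<omega> $ i - X t \<omega> $ j)\<bar> \<le> \<bar>\<gamma> i j\<bar> * inv_gap (X t \<omega>)"
      using mult_left_mono[OF inv_gap_ge[of "X t \<omega>" i j], of "\<bar>\<gamma> i j\<bar>"] by (simp add: abs_divide)
  qed
  also have "\<dots> \<le> \<Gamma> * inv_gap (X t \<omega>)"
    unfolding sum_distrib_right[symmetric] by (intro mult_right_mono \<Gamma>_ge inv_gap_nonneg)
  finally show ?thesis using b_bound[of i "X t \<omega>"] unfolding drift_def by linarith
qed

lemma inv_gap_moment: "bounded_Lp M (4 * p) {0..T} (\<lambda>t \<omega>. inv_gap (X t \<omega>))"
  unfolding inv_gap_def
proof (intro bounded_Lp_sum)
  fix i j :: 'n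
  show "bounded_Lp M (4 * p) {0..T} (\<lambda>t \<omega>. 1 / \<bar>X t \<omega> $ i - X t \<omega> $ j\<bar>)"
    using gap_moment[of i j] bounded_Lp_const[of "4 * p" "{0..T}" 0] by (cases "i = j") auto
qed (use p in auto)

lemma drift_measurable [measurable]: "t \<in> {0..T} \<Longrightarrow> drift i t \<in> borel_measurable M"
  unfolding drift_def[abs_def] by measurable

lemma drift_moment: "bounded_Lp M (4 * p) {0..T} (drift i)"
proof (rule bounded_Lp_mono)
  show "bounded_Lp M (4 * p) {0..T} (\<lambda>t \<omega>. \<Gamma> * inv_gap (X t \<omega>) + B)"
    using p by (intro bounded_Lp_add bounded_Lp_cmult inv_gap_moment bounded_Lp_const) auto
  show "AE \<omega> in M. \<bar>drift i t \<omega>\<bar> \<le> \<bar>\<Gamma> * inv_gap (X t \<omega>) + B\<bar>" for t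
    using drift_bound[of i t] by (intro AE_I2) (meson abs_ge_self order_trans)
qed (use p in auto)

lemma drift_cont:
  assumes "\<omega> \<in> space M" "0 \<le> s" "t \<le> T"
  shows "continuous_on {s..t} (\<lambda>r. drift i r \<omega>)"
proof -
  have c: "continuous_on {s..t} (\<lambda>r. X r \<omega>)"
    using assms by (intro continuous_on_subset[OF X_cont]) auto
  show ?thesis unfolding drift_def
    by (intro continuous_on_add continuous_on_compose2[OF continuous_on_interaction c]
        continuous_on_compose2[OF b_cont c])
      (use X_Delta assms in auto)
qed

definition noise :: "real \<Rightarrow> real \<Rightarrow> 'a \<Rightarrow> 'n \<Rightarrow> real" where
  "noise s t \<omega> i = (\<Sum>j\<in>UNIV. \<sigma> i j * (W t \<omega> $ j - W s \<omega> $ j))"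

text \<open>The increment of the solution without its noise, which is the time integral of the drift.\<close>

definition smooth_part :: "real \<Rightarrow> real \<Rightarrow> 'a \<Rightarrow> 'n \<Rightarrow> real" where
  "smooth_part s t \<omega> i = X t \<omega> $ i - X s \<omega> $ i - noise s t \<omega> i"

definition bm_size :: "real \<Rightarrow> real \<Rightarrow> 'a \<Rightarrow> real" where
  "bm_size s t \<omega> = (\<Sum>l\<in>UNIV. \<bar>W t \<omega> $ l - W s \<omega> $ l\<bar>)"

text \<open>The triples of a step size \<open>h\<close>, the beginning \<open>s\<close> of a step and a time \<open>t\<close> within this step.\<close>

definition steps :: "(real \<times> real \<times> real) set" where
  "steps = {(h, s, t). 0 < h \<and> h \<le> 1 \<and> 0 \<le> s \<and> s + h \<le> T \<and> s \<le> t \<and> t \<le> s + h}"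

lemma stepsD:
  assumes "(h, s, t) \<in> steps"
  shows "0 < h" "h \<le> 1" "0 \<le> s" "s + h \<le> T" "s \<le> t" "t \<le> s + h" "s \<in> {0..T}" "t \<in> {0..T}" "s + h \<in> {0..T}"
  using assms by (auto simp: steps_def)

text \<open>The drift has moments of order \<open>4 p\<close> at fixed times, so its integral over a step has order \<open>h\<close>.\<close>

lemma smooth_part_moment:
  "bounded_Lp M (4 * p) steps (\<lambda>(h, s, t) \<omega>. smooth_part s t \<omega> i / h)"
proof -
  obtain K where K: "0 \<le> K" "\<And>t. t \<in> {0..T} \<Longrightarrow> (\<integral>\<^sup>+ \<omega>. ennreal (\<bar>drift i t \<omega>\<bar> powr (4 * p)) \<partial>M) \<le> ennreal K"
    using drift_moment[of i] unfolding bounded_Lp_def by blast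
  show ?thesis
  proof (rule bounded_LpI[OF _ K(1)])
    fix x assume "x \<in> steps"
    then obtain h s t where x: "x = (h, s, t)" and st: "(h, s, t) \<in> steps" by (cases x) auto
    note st = stepsD[OF st]
    interpret cp: continuous_process_prob M "drift i" s t
      by standard (use st in \<open>auto intro!: drift_cont\<close>)
    have [measurable]: "X t \<in> borel_measurable M" "X s \<in> borel_measurable M" "W t \<in> borel_measurable M" "W s \<in> borel_measurable M"
      using st by auto
    show "(case x of (h, s, t) \<Rightarrow> \<lambda>\<omega>. smooth_part s t \<omega> i / h) \<in> borel_measurable M"
      unfolding x prod.case smooth_part_def noise_def by measurable
    have ae: "AE \<omega> in M. smooth_part s t \<omega> i = cp.path_integral \<omega>"
      using sde by eventually_elim
        (use st in \<open>simp add: smooth_part_def noise_def cp.path_integral_def drift_def\<close>)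
    have "(\<integral>\<^sup>+ \<omega>. ennreal (\<bar>smooth_part s t \<omega> i / h\<bar> powr (4 * p)) \<partial>M)
        = (\<integral>\<^sup>+ \<omega>. ennreal ((1 / h) powr (4 * p)) * ennreal (\<bar>cp.path_integral \<omega>\<bar> powr (4 * p)) \<partial>M)"
      using ae by (intro nn_integral_cong_AE, eventually_elim)
        (use st in \<open>simp add: abs_divide powr_divide ennreal_mult[symmetric]\<close>)
    also have "\<dots> = ennreal ((1 / h) powr (4 * p)) * (\<integral>\<^sup>+ \<omega>. ennreal (\<bar>cp.path_integral \<omega>\<bar> powr (4 * p)) \<partial>M)"
      using cp.measurable_path_integral by (intro nn_integral_cmult) measurable
    also have "\<dots> \<le> ennreal ((1 / h) powr (4 * p)) * ennreal ((t - s) powr (4 * p) * K)"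
      using p K st by (intro mult_left_mono cp.moment_path_integral) auto
    also have "\<dots> = ennreal (((t - s) / h) powr (4 * p) * K)"
      using K st by (simp add: ennreal_mult[symmetric] powr_divide)
    also have "\<dots> \<le> ennreal (1 * K)"
    proof (intro ennreal_leI mult_right_mono K)
      have "((t - s) / h) powr (4 * p) \<le> 1 powr (4 * p)" using st p by (intro powr_mono2) auto
      then show "((t - s) / h) powr (4 * p) \<le> 1" by simp
    qed
    finally show "(\<integral>\<^sup>+ \<omega>. ennreal (\<bar>(case x of (h, s, t) \<Rightarrow> \<lambda>\<omega>. smooth_part s t \<omega> i / h) \<omega>\<bar> powr (4 * p)) \<partial>M) \<le> ennreal K"
      by (simp add: x)
  qed
qed

lemma bm_size_moment: "bounded_Lp M (4 * p) steps (\<lambda>(h, s, t) \<omega>. (bm_size s t \<omega>)\<^sup>2 / h)"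
proof -
  have l: "bounded_Lp M (8 * p) steps (\<lambda>(h, s, t) \<omega>. \<bar>W t \<omega> $ l - W s \<omega> $ l\<bar> / sqrt h)" for l
  proof -
    obtain K where K: "0 \<le> K" "\<And>s t. 0 \<le> s \<Longrightarrow> s \<le> t \<Longrightarrow> t \<le> T \<Longrightarrow>
        (\<integral>\<^sup>+ \<omega>. ennreal (\<bar>W t \<omega> $ l - W s \<omega> $ l\<bar> powr (8 * p)) \<partial>M) \<le> ennreal ((t - s) powr (4 * p) * K)"
      using W_moment[of l] by blast
    show ?thesis
    proof (rule bounded_LpI[OF _ K(1)])
      fix x assume "x \<in> steps"
      then obtain h s t where x: "x = (h, s, t)" and st: "(h, s, t) \<in> steps" by (cases x) auto
      note st = stepsD[OF st]
      have [measurable]: "W t \<in> borel_measurable M" "W s \<in> borel_measurable M"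
        using st by auto
      show "(case x of (h, s, t) \<Rightarrow> \<lambda>\<omega>. \<bar>W t \<omega> $ l - W s \<omega> $ l\<bar> / sqrt h) \<in> borel_measurable M"
        unfolding x prod.case by measurable
      have sq: "sqrt h powr (8 * p) = h powr (4 * p)"
        using st by (simp add: powr_half_sqrt[symmetric] powr_powr)
      have "(\<integral>\<^sup>+ \<omega>. ennreal (\<bar>\<bar>W t \<omega> $ l - W s \<omega> $ l\<bar> / sqrt h\<bar> powr (8 * p)) \<partial>M)
          = (\<integral>\<^sup>+ \<omega>. ennreal (1 / h powr (4 * p)) * ennreal (\<bar>W t \<omega> $ l - W s \<omega> $ l\<bar> powr (8 * p)) \<partial>M)"
        using st by (intro nn_integral_cong) (simp add: abs_divide powr_divide sq ennreal_mult[symmetric])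
      also have "\<dots> = ennreal (1 / h powr (4 * p)) * (\<integral>\<^sup>+ \<omega>. ennreal (\<bar>W t \<omega> $ l - W s \<omega> $ l\<bar> powr (8 * p)) \<partial>M)"
        by (intro nn_integral_cmult) measurable
      also have "\<dots> \<le> ennreal (1 / h powr (4 * p)) * ennreal ((t - s) powr (4 * p) * K)"
        using st by (intro mult_left_mono K) auto
      also have "\<dots> = ennreal (((t - s) / h) powr (4 * p) * K)"
        using K st by (simp add: ennreal_mult[symmetric] powr_divide)
      also have "\<dots> \<le> ennreal (1 * K)"
      proof (intro ennreal_leI mult_right_mono K)
        have "((t - s) / h) powr (4 * p) \<le> 1 powr (4 * p)" using st p by (intro powr_mono2) auto
        then show "((t - s) / h) powr (4 * p) \<le> 1" by simp
      qed
      finally show "(\<integral>\<^sup>+ \<omega>. ennreal (\<bar>(case x of (h, s, t) \<Rightarrow> \<lambda>\<omega>. \<bar>W t \<omega> $ l - W s \<omega> $ l\<bar> / sqrt h) \<omega>\<bar> powr (8 * p)) \<partial>M) \<le> ennreal K"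
        by (simp add: x)
    qed
  qed
  have "bounded_Lp M (real 2 * (4 * p)) steps (\<lambda>x \<omega>. \<Sum>l\<in>UNIV. (case x of (h, s, t) \<Rightarrow> \<lambda>\<omega>. \<bar>W t \<omega> $ l - W s \<omega> $ l\<bar> / sqrt h) \<omega>)"
    using p l by (intro bounded_Lp_sum) auto
  then have "bounded_Lp M (4 * p) steps (\<lambda>x \<omega>. (\<Sum>l\<in>UNIV. (case x of (h, s, t) \<Rightarrow> \<lambda>\<omega>. \<bar>W t \<omega> $ l - W s \<omega> $ l\<bar> / sqrt h) \<omega>) ^ 2)"
    by (rule bounded_Lp_power) simp
  moreover have "((\<Sum>l\<in>UNIV. (case x of (h, s, t) \<Rightarrow> \<lambda>\<omega>. \<bar>W t \<omega> $ l - W s \<omega> $ l\<bar> / sqrt h) \<omega>) ^ 2)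
      = (case x of (h, s, t) \<Rightarrow> \<lambda>\<omega>. (bm_size s t \<omega>)\<^sup>2 / h) \<omega>" if "x \<in> steps" for x \<omega>
    using that by (auto simp: steps_def bm_size_def sum_divide_distrib[symmetric] power_divide)
  ultimately show ?thesis unfolding bounded_Lp_def by (simp cong: measurable_cong)
qed

end

section \<open>Expansion of the local error\<close>

text \<open>The algebraic substitute for Ito's formula applied to \<open>1 / u\<close>. The bound has degree 4 in \<open>\<Lambda>\<close>. A
direct estimate of the mixed term \<open>N D / (u\<^sup>2 v)\<close> would have a higher degree, as \<open>D\<close> and the three
inverse gaps already use up 4 and \<open>N\<close> is of the size of \<open>sqrt (c h \<Lambda>)\<close>. Where \<open>D\<close> dominates
\<open>N\<close>, the difference of the inverses is therefore bounded trivially, and the smallness is taken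
from \<open>N\<close> being below \<open>D\<close>.\<close>

lemma inverse_expansion:
  fixes u v D N c h \<Lambda> :: real
  assumes nz: "u \<noteq> 0" "v \<noteq> 0" and \<Lambda>: "1 \<le> \<Lambda>" "1 / \<bar>u\<bar> \<le> \<Lambda>" "1 / \<bar>v\<bar> \<le> \<Lambda>"
    and h: "0 < h" and c: "0 \<le> c" and vu: "v - u = D + N"
    and D: "\<bar>D\<bar> \<le> c * h * \<Lambda>" and N: "N\<^sup>2 \<le> c * h * \<Lambda>"
  shows "\<bar>1 / v - 1 / u + N / u\<^sup>2\<bar> \<le> 5 * c * h * \<Lambda> ^ 4"
proof -
  have p: "\<Lambda> ^ 3 \<le> \<Lambda> ^ 4" using \<Lambda> by (intro power_increasing) auto
  have iu: "\<bar>1 / u\<bar> \<le> \<Lambda>" and iv: "\<bar>1 / v\<bar> \<le> \<Lambda>" using \<Lambda> by auto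
  have ch: "0 \<le> c * h" using c h by simp
  have e1: "1 / v - 1 / u = - ((D + N) * (1 / u) * (1 / v))"
    unfolding vu[symmetric] using nz by (simp add: field_simps)
  have "1 / v - 1 / u + N / u\<^sup>2 = - (D * (1 / u) * (1 / v)) + N * (1 / u) * (1 / u - 1 / v)"
  proof -
    have "N * (1 / u) * (1 / u - 1 / v) = N / u\<^sup>2 - N * (1 / u) * (1 / v)"
      by (simp add: right_diff_distrib power2_eq_square)
    moreover have "(D + N) * (1 / u) * (1 / v) = D * (1 / u) * (1 / v) + N * (1 / u) * (1 / v)"
      by (simp only: distrib_right)
    ultimately show ?thesis using e1 by linarith
  qed
  then have "\<bar>1 / v - 1 / u + N / u\<^sup>2\<bar> \<le> \<bar>D * (1 / u) * (1 / v)\<bar> + \<bar>N * (1 / u) * (1 / u - 1 / v)\<bar>"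
    by linarith
  moreover have "\<bar>D * (1 / u) * (1 / v)\<bar> \<le> c * h * \<Lambda> ^ 4"
  proof -
    have "\<bar>D * (1 / u) * (1 / v)\<bar> \<le> (c * h * \<Lambda>) * \<Lambda> * \<Lambda>"
      unfolding abs_mult using D iu iv \<Lambda> ch by (intro mult_mono) auto
    also have "\<dots> = c * h * \<Lambda> ^ 3" by (simp add: power3_eq_cube)
    also have "\<dots> \<le> c * h * \<Lambda> ^ 4" using p ch by (intro mult_left_mono) auto
    finally show ?thesis .
  qed
  moreover have "\<bar>N * (1 / u) * (1 / u - 1 / v)\<bar> \<le> 2 * c * h * \<Lambda> ^ 4"
  proof (cases "\<bar>D\<bar> \<le> \<bar>N\<bar>")
    case True
    have "\<bar>1 / u - 1 / v\<bar> = \<bar>D + N\<bar> * \<bar>1 / u\<bar> * \<bar>1 / v\<bar>"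
      using e1 by (metis abs_minus_cancel abs_minus_commute abs_mult)
    also have "\<dots> \<le> (2 * \<bar>N\<bar>) * \<Lambda> * \<Lambda>"
      using True iu iv \<Lambda> by (intro mult_mono) auto
    finally have "\<bar>N * (1 / u) * (1 / u - 1 / v)\<bar> \<le> \<bar>N\<bar> * \<Lambda> * ((2 * \<bar>N\<bar>) * \<Lambda> * \<Lambda>)"
      unfolding abs_mult using iu \<Lambda> by (intro mult_mono) auto
    also have "\<dots> = 2 * N\<^sup>2 * \<Lambda> ^ 3" by (simp add: power2_eq_square power3_eq_cube)
    also have "\<dots> \<le> 2 * (c * h * \<Lambda>) * \<Lambda> ^ 3" using N \<Lambda> by (intro mult_right_mono) auto
    also have "\<dots> = 2 * c * h * \<Lambda> ^ 4" by (simp add: power3_eq_cube power4_eq_xxxx)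
    finally show ?thesis .
  next
    case False
    have "\<bar>1 / u - 1 / v\<bar> \<le> 2 * \<Lambda>" using iu iv by linarith
    then have "\<bar>N * (1 / u) * (1 / u - 1 / v)\<bar> \<le> (c * h * \<Lambda>) * \<Lambda> * (2 * \<Lambda>)"
      unfolding abs_mult using False D iu \<Lambda> ch by (intro mult_mono) auto
    also have "\<dots> = 2 * c * h * \<Lambda> ^ 3" by (simp add: power3_eq_cube)
    also have "\<dots> \<le> 2 * c * h * \<Lambda> ^ 4" using p ch by (intro mult_left_mono) auto
    finally show ?thesis .
  qed
  moreover have "0 \<le> c * h * \<Lambda> ^ 4" using c h \<Lambda> by simp
  ultimately show ?thesis by linarith
qed

context particle_system
begin

text \<open>One random variable that dominates every inverse gap, the rescaled drift and the square
of the rescaled noise, at the times \<open>s\<close>, \<open>t\<close> and \<open>s + h\<close>. The local error is estimated by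
powers of \<open>\<Lambda>\<close>.\<close>

definition \<Lambda> :: "real \<Rightarrow> real \<Rightarrow> real \<Rightarrow> 'a \<Rightarrow> real" where
  "\<Lambda> h s t \<omega> = 1 + inv_gap (X s \<omega>) + inv_gap (X t \<omega>) + inv_gap (X (s + h) \<omega>)
    + (\<Sum>i\<in>UNIV. \<bar>smooth_part s t \<omega> i / h\<bar>) + (\<Sum>i\<in>UNIV. \<bar>smooth_part s (s + h) \<omega> i / h\<bar>)
    + (bm_size s t \<omega>)\<^sup>2 / h + (bm_size s (s + h) \<omega>)\<^sup>2 / h"

definition lin_coeff :: "'n \<Rightarrow> 'n \<Rightarrow> (real, 'n) vec \<Rightarrow> real" where
  "lin_coeff i l x = (\<Sum>j\<in>UNIV. \<gamma> i j * (\<sigma> i l - \<sigma> j l) / (x $ i - x $ j)\<^sup>2)"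

text \<open>The part of the integrand of the local error that is linear in the Brownian increments, with
coefficients known at time \<open>s\<close>. The reference time of the singular part is \<open>s\<close>, although the scheme
evaluates the interaction at \<open>s + h\<close>; this is why two increments occur.\<close>

definition lin :: "'n \<Rightarrow> real \<Rightarrow> real \<Rightarrow> real \<Rightarrow> 'a \<Rightarrow> real" where
  "lin i h s t \<omega> = (\<Sum>l\<in>UNIV. lin_coeff i l (X s \<omega>) * ((W (s + h) \<omega> $ l - W s \<omega> $ l) - (W t \<omega> $ l - W s \<omega> $ l)))
    + (\<Sum>m\<in>UNIV. b' i (X s \<omega>) $ m * noise s t \<omega> m)"

definition remainder :: "'n \<Rightarrow> real \<Rightarrow> real \<Rightarrow> real \<Rightarrow> 'a \<Rightarrow> real" where
  "remainder i h s t \<omega> = interaction \<gamma> (X t \<omega>) i - interaction \<gamma> (X (s + h) \<omega>) i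
    + (b i (X t \<omega>) - b i (X s \<omega>)) - lin i h s t \<omega>"

lemma \<Lambda>_moment: "bounded_Lp M (4 * p) steps (\<lambda>(h, s, t) \<omega>. \<Lambda> h s t \<omega>)"
proof -
  have ri: "x \<in> steps \<Longrightarrow> (\<lambda>(h, s, t). s) x \<in> {0..T}" "x \<in> steps \<Longrightarrow> (\<lambda>(h, s, t). t) x \<in> {0..T}"
    "x \<in> steps \<Longrightarrow> (\<lambda>(h, s, t). s + h) x \<in> {0..T}" for x
    by (auto simp: steps_def)
  have ig: "bounded_Lp M (4 * p) steps (\<lambda>(h, s, t) \<omega>. inv_gap (X s \<omega>))"
    "bounded_Lp M (4 * p) steps (\<lambda>(h, s, t) \<omega>. inv_gap (X t \<omega>))"
    "bounded_Lp M (4 * p) steps (\<lambda>(h, s, t) \<omega>. inv_gap (X (s + h) \<omega>))"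
    using bounded_Lp_reindex[OF inv_gap_moment, of steps "\<lambda>(h, s, t). s", OF ri(1)]
      bounded_Lp_reindex[OF inv_gap_moment, of steps "\<lambda>(h, s, t). t", OF ri(2)]
      bounded_Lp_reindex[OF inv_gap_moment, of steps "\<lambda>(h, s, t). s + h", OF ri(3)]
    by (simp_all add: split_def)
  have sm: "bounded_Lp M (4 * p) steps (\<lambda>x \<omega>. \<Sum>i\<in>UNIV. \<bar>(case x of (h, s, t) \<Rightarrow> \<lambda>\<omega>. smooth_part s t \<omega> i / h) \<omega>\<bar>)"
    using p by (intro bounded_Lp_sum bounded_Lp_abs smooth_part_moment) auto
  have r: "x \<in> steps \<Longrightarrow> (\<lambda>(h, s, t). (h, s, s + h)) x \<in> steps" for x
    by (auto simp: steps_def)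
  have "bounded_Lp M (4 * p) steps (\<lambda>x \<omega>. 1 + (case x of (h, s, t) \<Rightarrow> \<lambda>\<omega>. inv_gap (X s \<omega>)) \<omega>
      + (case x of (h, s, t) \<Rightarrow> \<lambda>\<omega>. inv_gap (X t \<omega>)) \<omega> + (case x of (h, s, t) \<Rightarrow> \<lambda>\<omega>. inv_gap (X (s + h) \<omega>)) \<omega>
      + (\<Sum>i\<in>UNIV. \<bar>(case x of (h, s, t) \<Rightarrow> \<lambda>\<omega>. smooth_part s t \<omega> i / h) \<omega>\<bar>)
      + (\<Sum>i\<in>UNIV. \<bar>(case (\<lambda>(h, s, t). (h, s, s + h)) x of (h, s, t) \<Rightarrow> \<lambda>\<omega>. smooth_part s t \<omega> i / h) \<omega>\<bar>)
      + (case x of (h, s, t) \<Rightarrow> \<lambda>\<omega>. (bm_size s t \<omega>)\<^sup>2 / h) \<omega>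
      + (case (\<lambda>(h, s, t). (h, s, s + h)) x of (h, s, t) \<Rightarrow> \<lambda>\<omega>. (bm_size s t \<omega>)\<^sup>2 / h) \<omega>)"
    using p by (intro bounded_Lp_add bounded_Lp_const ig sm bm_size_moment
        bounded_Lp_reindex[OF sm r] bounded_Lp_reindex[OF bm_size_moment r]) auto
  then show ?thesis by (simp add: split_def \<Lambda>_def)
qed

lemma bm_size_nonneg: "0 \<le> bm_size s t \<omega>"
  unfolding bm_size_def by (intro sum_nonneg) auto

lemma noise_bound: "\<bar>noise s t \<omega> i\<bar> \<le> sigma_norm * bm_size s t \<omega>"
proof -
  have "\<bar>noise s t \<omega> i\<bar> \<le> (\<Sum>j\<in>UNIV. \<bar>\<sigma> i j\<bar> * \<bar>W t \<omega> $ j - W s \<omega> $ j\<bar>)"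
    unfolding noise_def by (rule order_trans[OF sum_abs]) (simp add: abs_mult)
  also have "\<dots> \<le> (\<Sum>j\<in>UNIV. sigma_norm * \<bar>W t \<omega> $ j - W s \<omega> $ j\<bar>)"
    by (intro sum_mono mult_right_mono sigma_norm_ge) auto
  finally show ?thesis by (simp add: bm_size_def sum_distrib_left)
qed

text \<open>Sorted by pairs of particles instead of coordinates of the Brownian motion, \<open>lin\<close> shows the terms
\<open>N / u\<^sup>2\<close> of the expansion of the inverse gaps.\<close>

lemma lin_alt:
  "lin i h s t \<omega> = (\<Sum>j\<in>UNIV. \<gamma> i j * (((noise s (s + h) \<omega> i - noise s (s + h) \<omega> j) - (noise s t \<omega> i - noise s t \<omega> j))
      / (X s \<omega> $ i - X s \<omega> $ j)\<^sup>2)) + (\<Sum>m\<in>UNIV. b' i (X s \<omega>) $ m * noise s t \<omega> m)"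
proof -
  define w where "w l = (W (s + h) \<omega> $ l - W s \<omega> $ l) - (W t \<omega> $ l - W s \<omega> $ l)" for l
  have w: "noise s (s + h) \<omega> i - noise s t \<omega> i = (\<Sum>l\<in>UNIV. \<sigma> i l * w l)" for i
    unfolding noise_def w_def by (simp add: sum_subtractf[symmetric] algebra_simps)
  have "(\<Sum>l\<in>UNIV. lin_coeff i l (X s \<omega>) * w l)
      = (\<Sum>l\<in>UNIV. \<Sum>j\<in>UNIV. \<gamma> i j * ((\<sigma> i l * w l - \<sigma> j l * w l) / (X s \<omega> $ i - X s \<omega> $ j)\<^sup>2))"
    unfolding lin_coeff_def sum_distrib_right by (intro sum.cong refl) (simp add: algebra_simps)
  also have "\<dots> = (\<Sum>j\<in>UNIV. \<Sum>l\<in>UNIV. \<gamma> i j * ((\<sigma> i l * w l - \<sigma> j l * w l) / (X s \<omega> $ i - X s \<omega> $ j)\<^sup>2))"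
    by (rule sum.swap)
  also have "\<dots> = (\<Sum>j\<in>UNIV. \<gamma> i j * (((noise s (s + h) \<omega> i - noise s t \<omega> i) - (noise s (s + h) \<omega> j - noise s t \<omega> j))
      / (X s \<omega> $ i - X s \<omega> $ j)\<^sup>2))"
    unfolding w by (simp add: sum_distrib_left[symmetric] sum_divide_distrib[symmetric] sum_subtractf)
  finally show ?thesis unfolding lin_def w_def[symmetric] by (simp add: algebra_simps)
qed

context
  fixes h s t \<omega>
  assumes st: "(h, s, t) \<in> steps" and om: "\<omega> \<in> space M"
begin

lemma \<Lambda>_facts:
  shows "1 \<le> \<Lambda> h s t \<omega>"
    and "inv_gap (X s \<omega>) \<le> \<Lambda> h s t \<omega>" "inv_gap (X t \<omega>) \<le> \<Lambda> h s t \<omega>" "inv_gap (X (s + h) \<omega>) \<le> \<Lambda> h s t \<omega>"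
    and "(\<Sum>i\<in>UNIV. \<bar>smooth_part s t \<omega> i\<bar>) \<le> h * \<Lambda> h s t \<omega>"
    and "(\<Sum>i\<in>UNIV. \<bar>smooth_part s (s + h) \<omega> i\<bar>) \<le> h * \<Lambda> h s t \<omega>"
    and "(bm_size s t \<omega>)\<^sup>2 \<le> h * \<Lambda> h s t \<omega>" "(bm_size s (s + h) \<omega>)\<^sup>2 \<le> h * \<Lambda> h s t \<omega>"
proof -
  have h: "0 < h" using stepsD(1)[OF st] .
  note nn = inv_gap_nonneg[of "X s \<omega>"] inv_gap_nonneg[of "X t \<omega>"] inv_gap_nonneg[of "X (s + h) \<omega>"]
  have s1: "0 \<le> (\<Sum>i\<in>UNIV. \<bar>smooth_part s t \<omega> i / h\<bar>)" "0 \<le> (\<Sum>i\<in>UNIV. \<bar>smooth_part s (s + h) \<omega> i / h\<bar>)"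
    by (auto intro!: sum_nonneg)
  have s2: "0 \<le> (bm_size s t \<omega>)\<^sup>2 / h" "0 \<le> (bm_size s (s + h) \<omega>)\<^sup>2 / h" using h by auto
  note all = nn s1 s2
  show "1 \<le> \<Lambda> h s t \<omega>" "inv_gap (X s \<omega>) \<le> \<Lambda> h s t \<omega>" "inv_gap (X t \<omega>) \<le> \<Lambda> h s t \<omega>" "inv_gap (X (s + h) \<omega>) \<le> \<Lambda> h s t \<omega>"
    using all unfolding \<Lambda>_def by linarith+
  have e: "(\<Sum>i\<in>UNIV. \<bar>f i / h\<bar>) = (\<Sum>i\<in>UNIV. \<bar>f i\<bar>) / h" for f :: "'n \<Rightarrow> real"
    using h by (simp add: sum_divide_distrib)
  have "(\<Sum>i\<in>UNIV. \<bar>smooth_part s t \<omega> i\<bar>) / h \<le> \<Lambda> h s t \<omega>" "(\<Sum>i\<in>UNIV. \<bar>smooth_part s (s + h) \<omega> i\<bar>) / h \<le> \<Lambda> h s t \<omega>"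
    "(bm_size s t \<omega>)\<^sup>2 / h \<le> \<Lambda> h s t \<omega>" "(bm_size s (s + h) \<omega>)\<^sup>2 / h \<le> \<Lambda> h s t \<omega>"
    using all unfolding \<Lambda>_def e by linarith+
  then show "(\<Sum>i\<in>UNIV. \<bar>smooth_part s t \<omega> i\<bar>) \<le> h * \<Lambda> h s t \<omega>"
    "(\<Sum>i\<in>UNIV. \<bar>smooth_part s (s + h) \<omega> i\<bar>) \<le> h * \<Lambda> h s t \<omega>"
    "(bm_size s t \<omega>)\<^sup>2 \<le> h * \<Lambda> h s t \<omega>" "(bm_size s (s + h) \<omega>)\<^sup>2 \<le> h * \<Lambda> h s t \<omega>"
    using h by (simp_all add: divide_le_eq mult.commute)
qed

lemma bm_size_le: "r = t \<or> r = s + h \<Longrightarrow> bm_size s r \<omega> \<le> sqrt h * \<Lambda> h s t \<omega>"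
proof -
  assume "r = t \<or> r = s + h"
  then have "(bm_size s r \<omega>)\<^sup>2 \<le> h * \<Lambda> h s t \<omega>" using \<Lambda>_facts(7,8) by auto
  also have "\<dots> \<le> h * (\<Lambda> h s t \<omega>)\<^sup>2"
    using \<Lambda>_facts(1) stepsD(1)[OF st] by (intro mult_left_mono) (auto simp: power2_eq_square)
  also have "\<dots> = (sqrt h * \<Lambda> h s t \<omega>)\<^sup>2" using stepsD(1)[OF st] by (simp add: power_mult_distrib)
  finally have "(bm_size s r \<omega>)\<^sup>2 \<le> (sqrt h * \<Lambda> h s t \<omega>)\<^sup>2" .
  moreover have "0 \<le> sqrt h * \<Lambda> h s t \<omega>"
    using \<Lambda>_facts(1) stepsD(1)[OF st] by simp
  ultimately show ?thesis by (rule power2_le_imp_le)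
qed

lemma inverse_gap_expansion:
  assumes r: "r = t \<or> r = s + h"
  shows "\<bar>1 / (X r \<omega> $ i - X r \<omega> $ j) - 1 / (X s \<omega> $ i - X s \<omega> $ j)
      + (noise s r \<omega> i - noise s r \<omega> j) / (X s \<omega> $ i - X s \<omega> $ j)\<^sup>2\<bar>
    \<le> 5 * (2 + 4 * sigma_norm\<^sup>2) * h * \<Lambda> h s t \<omega> ^ 4"
proof (cases "i = j")
  case False
  have rT: "r \<in> {0..T}" and sT: "s \<in> {0..T}" and h: "0 < h" using stepsD[OF st] r by auto
  have L1: "1 \<le> \<Lambda> h s t \<omega>" by (rule \<Lambda>_facts)
  have sm: "(\<Sum>i\<in>UNIV. \<bar>smooth_part s r \<omega> i\<bar>) \<le> h * \<Lambda> h s t \<omega>" using r \<Lambda>_facts(5,6) by auto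
  have smi: "\<bar>smooth_part s r \<omega> i\<bar> \<le> h * \<Lambda> h s t \<omega>" for i
    using sm member_le_sum[of i UNIV "\<lambda>i. \<bar>smooth_part s r \<omega> i\<bar>"] by simp
  have sq: "(bm_size s r \<omega>)\<^sup>2 \<le> h * \<Lambda> h s t \<omega>" using r \<Lambda>_facts(7,8) by auto
  have hL: "0 \<le> h * \<Lambda> h s t \<omega>" using h L1 by simp
  show ?thesis
  proof (rule inverse_expansion[where D = "smooth_part s r \<omega> i - smooth_part s r \<omega> j"])
    show "X s \<omega> $ i - X s \<omega> $ j \<noteq> 0" "X r \<omega> $ i - X r \<omega> $ j \<noteq> 0"
      using Delta_diff_nz[OF X_Delta[OF om sT] False] Delta_diff_nz[OF X_Delta[OF om rT] False] by auto
    show "1 / \<bar>X s \<omega> $ i - X s \<omega> $ j\<bar> \<le> \<Lambda> h s t \<omega>" "1 / \<bar>X r \<omega> $ i - X r \<omega> $ j\<bar> \<le> \<Lambda> h s t \<omega>"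
      using inv_gap_ge[of "X s \<omega>" i j] inv_gap_ge[of "X r \<omega>" i j] r \<Lambda>_facts(2-4) by auto
    show "X r \<omega> $ i - X r \<omega> $ j - (X s \<omega> $ i - X s \<omega> $ j)
        = smooth_part s r \<omega> i - smooth_part s r \<omega> j + (noise s r \<omega> i - noise s r \<omega> j)"
      by (simp add: smooth_part_def)
    have "\<bar>smooth_part s r \<omega> i - smooth_part s r \<omega> j\<bar> \<le> 2 * (h * \<Lambda> h s t \<omega>)"
      using smi[of i] smi[of j] by linarith
    also have "\<dots> \<le> (2 + 4 * sigma_norm\<^sup>2) * (h * \<Lambda> h s t \<omega>)" using hL by (intro mult_right_mono) auto
    finally show "\<bar>smooth_part s r \<omega> i - smooth_part s r \<omega> j\<bar> \<le> (2 + 4 * sigma_norm\<^sup>2) * h * \<Lambda> h s t \<omega>"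
      by (simp add: mult.assoc)
    have "\<bar>noise s r \<omega> i - noise s r \<omega> j\<bar> \<le> 2 * (sigma_norm * bm_size s r \<omega>)"
      using noise_bound[of s r \<omega> i] noise_bound[of s r \<omega> j] by linarith
    then have "(noise s r \<omega> i - noise s r \<omega> j)\<^sup>2 \<le> (2 * (sigma_norm * bm_size s r \<omega>))\<^sup>2"
      using sigma_norm_nonneg bm_size_nonneg by (metis abs_le_square_iff abs_of_nonneg mult_nonneg_nonneg zero_le_numeral)
    also have "\<dots> = 4 * sigma_norm\<^sup>2 * (bm_size s r \<omega>)\<^sup>2" by (simp add: power_mult_distrib)
    also have "\<dots> \<le> (2 + 4 * sigma_norm\<^sup>2) * (h * \<Lambda> h s t \<omega>)" using sq by (intro mult_mono) auto
    finally show "(noise s r \<omega> i - noise s r \<omega> j)\<^sup>2 \<le> (2 + 4 * sigma_norm\<^sup>2) * h * \<Lambda> h s t \<omega>"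
      by (simp add: mult.assoc)
  qed (use h L1 in auto)
qed (use \<Lambda>_facts(1) stepsD(1)[OF st] in auto)

lemma lin_bound: "\<bar>lin i h s t \<omega>\<bar> \<le> (4 * \<Gamma> * sigma_norm + real CARD('n) * B * sigma_norm) * (sqrt h * \<Lambda> h s t \<omega> ^ 4)"
proof -
  define L where "L = \<Lambda> h s t \<omega>"
  have L1: "1 \<le> L" and h: "0 < h" using \<Lambda>_facts(1) stepsD[OF st] by (auto simp: L_def)
  have nb: "\<bar>noise s r \<omega> i\<bar> \<le> sigma_norm * (sqrt h * L)" if "r = t \<or> r = s + h" for r i
    using noise_bound[of s r \<omega> i] mult_left_mono[OF bm_size_le[OF that] sigma_norm_nonneg] by (simp add: L_def)
  have nn: "0 \<le> sigma_norm * (sqrt h * L)" using sigma_norm_nonneg h L1 by simp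
  have P: "L ^ 3 \<le> L ^ 4" "L ^ 1 \<le> L ^ 4" using L1 by (intro power_increasing; simp)+
  have "\<bar>\<Sum>j\<in>UNIV. \<gamma> i j * (((noise s (s + h) \<omega> i - noise s (s + h) \<omega> j) - (noise s t \<omega> i - noise s t \<omega> j))
      / (X s \<omega> $ i - X s \<omega> $ j)\<^sup>2)\<bar> \<le> (\<Sum>j\<in>UNIV. \<bar>\<gamma> i j\<bar> * (4 * (sigma_norm * (sqrt h * L)) * L\<^sup>2))"
  proof (rule order_trans[OF sum_abs sum_mono])
    fix j
    have "\<bar>(noise s (s + h) \<omega> i - noise s (s + h) \<omega> j) - (noise s t \<omega> i - noise s t \<omega> j)\<bar> \<le> 4 * (sigma_norm * (sqrt h * L))"
      using nb[of "s + h" i] nb[of "s + h" j] nb[of t i] nb[of t j] by simp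
    moreover have "1 / (X s \<omega> $ i - X s \<omega> $ j)\<^sup>2 \<le> L\<^sup>2"
    proof -
      have "1 / \<bar>X s \<omega> $ i - X s \<omega> $ j\<bar> \<le> L"
        using inv_gap_ge[of "X s \<omega>" i j] \<Lambda>_facts(2) by (simp add: L_def)
      then have "(1 / \<bar>X s \<omega> $ i - X s \<omega> $ j\<bar>)\<^sup>2 \<le> L\<^sup>2" by (intro power_mono) auto
      then show ?thesis by (simp add: power_divide)
    qed
    ultimately have "\<bar>(noise s (s + h) \<omega> i - noise s (s + h) \<omega> j) - (noise s t \<omega> i - noise s t \<omega> j)\<bar>
        * (1 / (X s \<omega> $ i - X s \<omega> $ j)\<^sup>2) \<le> (4 * (sigma_norm * (sqrt h * L))) * L\<^sup>2"
      using nn by (intro mult_mono) auto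
    then show "\<bar>\<gamma> i j * (((noise s (s + h) \<omega> i - noise s (s + h) \<omega> j) - (noise s t \<omega> i - noise s t \<omega> j))
      / (X s \<omega> $ i - X s \<omega> $ j)\<^sup>2)\<bar> \<le> \<bar>\<gamma> i j\<bar> * (4 * (sigma_norm * (sqrt h * L)) * L\<^sup>2)"
      unfolding abs_mult by (intro mult_left_mono) (auto simp: abs_divide)
  qed
  also have "\<dots> = (\<Sum>j\<in>UNIV. \<bar>\<gamma> i j\<bar>) * (4 * sigma_norm * (sqrt h * L ^ 3))"
    unfolding sum_distrib_right[symmetric] by (simp add: power2_eq_square power3_eq_cube ac_simps)
  also have "\<dots> \<le> \<Gamma> * (4 * sigma_norm * (sqrt h * L ^ 4))"
    using sigma_norm_nonneg h L1 P \<Gamma>_nonneg by (intro mult_mono \<Gamma>_ge mult_left_mono) auto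
  finally have 1: "\<bar>\<Sum>j\<in>UNIV. \<gamma> i j * (((noise s (s + h) \<omega> i - noise s (s + h) \<omega> j) - (noise s t \<omega> i - noise s t \<omega> j))
      / (X s \<omega> $ i - X s \<omega> $ j)\<^sup>2)\<bar> \<le> \<Gamma> * (4 * sigma_norm * (sqrt h * L ^ 4))" .
  have "\<bar>\<Sum>m\<in>UNIV. b' i (X s \<omega>) $ m * noise s t \<omega> m\<bar> \<le> (\<Sum>m\<in>(UNIV::'n set). B * (sigma_norm * (sqrt h * L)))"
  proof (rule order_trans[OF sum_abs sum_mono])
    fix m
    show "\<bar>b' i (X s \<omega>) $ m * noise s t \<omega> m\<bar> \<le> B * (sigma_norm * (sqrt h * L))"
      unfolding abs_mult using B nb[of t m] order_trans[OF component_le_norm_cart b'_bound]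
      by (intro mult_mono) auto
  qed
  also have "\<dots> = real CARD('n) * B * sigma_norm * (sqrt h * L ^ 1)" by simp
  also have "\<dots> \<le> real CARD('n) * B * sigma_norm * (sqrt h * L ^ 4)"
    using B sigma_norm_nonneg h P by (intro mult_left_mono) auto
  finally have 2: "\<bar>\<Sum>m\<in>UNIV. b' i (X s \<omega>) $ m * noise s t \<omega> m\<bar> \<le> real CARD('n) * B * sigma_norm * (sqrt h * L ^ 4)" .
  have "\<bar>lin i h s t \<omega>\<bar> \<le> \<Gamma> * (4 * sigma_norm * (sqrt h * L ^ 4)) + real CARD('n) * B * sigma_norm * (sqrt h * L ^ 4)"
    unfolding lin_alt using 1 2 by linarith
  then show ?thesis by (simp add: L_def algebra_simps)
qed

text \<open>The first-order term along the smooth part of the increment has order \<open>h\<close>, and so has the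
square of the whole increment. What remains of the Taylor expansion of \<open>b\<close> is its linear term
along the noise.\<close>

lemma drift_expansion_bound:
  "\<bar>b i (X t \<omega>) - b i (X s \<omega>) - (\<Sum>m\<in>UNIV. b' i (X s \<omega>) $ m * noise s t \<omega> m)\<bar>
    \<le> B * (3 + 2 * (real CARD('n))\<^sup>2 * sigma_norm\<^sup>2) * (h * \<Lambda> h s t \<omega> ^ 4)"
proof -
  define L where "L = \<Lambda> h s t \<omega>"
  have L1: "1 \<le> L" and h: "0 < h" "h \<le> 1" using \<Lambda>_facts(1) stepsD[OF st] by (auto simp: L_def)
  have P: "L\<^sup>2 \<le> L ^ 4" "L ^ 1 \<le> L ^ 4" "L ^ 1 \<le> L\<^sup>2" using L1 by (intro power_increasing; simp)+
  define \<delta> where "\<delta> = X t \<omega> - X s \<omega>"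
  have \<delta>: "\<delta> $ m = smooth_part s t \<omega> m + noise s t \<omega> m" for m by (simp add: \<delta>_def smooth_part_def)
  have sm: "(\<Sum>m\<in>UNIV. \<bar>smooth_part s t \<omega> m\<bar>) \<le> h * L" using \<Lambda>_facts(5) by (simp add: L_def)
  have bm: "(bm_size s t \<omega>)\<^sup>2 \<le> h * L" using \<Lambda>_facts(7) by (simp add: L_def)
  let ?d = "real CARD('n)"
  have "norm \<delta> \<le> (\<Sum>m\<in>UNIV. \<bar>\<delta> $ m\<bar>)" by (rule norm_le_l1_cart)
  also have "\<dots> \<le> (\<Sum>m\<in>UNIV. \<bar>smooth_part s t \<omega> m\<bar> + sigma_norm * bm_size s t \<omega>)"
    unfolding \<delta> by (intro sum_mono order_trans[OF abs_triangle_ineq] add_left_mono noise_bound)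
  also have "\<dots> \<le> h * L + ?d * (sigma_norm * bm_size s t \<omega>)" using sm by (simp add: sum.distrib)
  finally have "(norm \<delta>)\<^sup>2 \<le> (h * L + ?d * (sigma_norm * bm_size s t \<omega>))\<^sup>2" by (intro power_mono) auto
  also have "\<dots> \<le> 2 * (h * L)\<^sup>2 + 2 * (?d * (sigma_norm * bm_size s t \<omega>))\<^sup>2"
    using sum_squares_bound[of "h * L" "?d * (sigma_norm * bm_size s t \<omega>)"] by (simp add: power2_sum)
  also have "(h * L)\<^sup>2 \<le> h * L\<^sup>2"
  proof -
    have "h * h * L\<^sup>2 \<le> 1 * h * L\<^sup>2" using h by (intro mult_right_mono) auto
    then show ?thesis by (simp add: power_mult_distrib power2_eq_square ac_simps)
  qed
  also have "(?d * (sigma_norm * bm_size s t \<omega>))\<^sup>2 \<le> ?d\<^sup>2 * sigma_norm\<^sup>2 * (h * L\<^sup>2)"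
  proof -
    have "h * L \<le> h * L\<^sup>2" using h P(3) by (intro mult_left_mono) auto
    then have "(?d\<^sup>2 * sigma_norm\<^sup>2) * (bm_size s t \<omega>)\<^sup>2 \<le> (?d\<^sup>2 * sigma_norm\<^sup>2) * (h * L\<^sup>2)"
      using bm by (intro mult_left_mono) auto
    then show ?thesis by (simp add: power_mult_distrib)
  qed
  finally have n2: "(norm \<delta>)\<^sup>2 \<le> (2 + 2 * ?d\<^sup>2 * sigma_norm\<^sup>2) * (h * L\<^sup>2)" by (simp add: algebra_simps)
  have "b' i (X s \<omega>) \<bullet> \<delta> = (\<Sum>m\<in>UNIV. b' i (X s \<omega>) $ m * smooth_part s t \<omega> m) + (\<Sum>m\<in>UNIV. b' i (X s \<omega>) $ m * noise s t \<omega> m)"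
    by (simp add: inner_vec_def \<delta> distrib_left sum.distrib)
  moreover have "\<bar>\<Sum>m\<in>UNIV. b' i (X s \<omega>) $ m * smooth_part s t \<omega> m\<bar> \<le> B * (h * L)"
  proof -
    have "\<bar>\<Sum>m\<in>UNIV. b' i (X s \<omega>) $ m * smooth_part s t \<omega> m\<bar> \<le> (\<Sum>m\<in>UNIV. B * \<bar>smooth_part s t \<omega> m\<bar>)"
    proof (rule order_trans[OF sum_abs sum_mono])
      fix m
      show "\<bar>b' i (X s \<omega>) $ m * smooth_part s t \<omega> m\<bar> \<le> B * \<bar>smooth_part s t \<omega> m\<bar>"
        unfolding abs_mult using order_trans[OF component_le_norm_cart b'_bound]
        by (intro mult_right_mono) auto
    qed
    also have "\<dots> \<le> B * (h * L)" unfolding sum_distrib_left[symmetric] using sm B by (intro mult_left_mono)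
    finally show ?thesis .
  qed
  moreover have "\<bar>b i (X t \<omega>) - b i (X s \<omega>) - b' i (X s \<omega>) \<bullet> \<delta>\<bar> \<le> B * (norm \<delta>)\<^sup>2"
    unfolding \<delta>_def by (rule b_taylor)
  moreover have "B * (norm \<delta>)\<^sup>2 \<le> B * ((2 + 2 * ?d\<^sup>2 * sigma_norm\<^sup>2) * (h * L ^ 4))"
    using B h P by (intro mult_left_mono order_trans[OF n2]) auto
  moreover have "B * (h * L) \<le> B * (h * L ^ 4)" using B h P(2) by (intro mult_left_mono) auto
  ultimately have "\<bar>b i (X t \<omega>) - b i (X s \<omega>) - (\<Sum>m\<in>UNIV. b' i (X s \<omega>) $ m * noise s t \<omega> m)\<bar>
      \<le> B * ((2 + 2 * ?d\<^sup>2 * sigma_norm\<^sup>2) * (h * L ^ 4)) + B * (h * L ^ 4)" by linarith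
  then show ?thesis by (simp add: L_def algebra_simps)
qed

lemma remainder_bound:
  "\<bar>remainder i h s t \<omega>\<bar> \<le> (\<Gamma> * (10 * (2 + 4 * sigma_norm\<^sup>2)) + B * (3 + 2 * (real CARD('n))\<^sup>2 * sigma_norm\<^sup>2)) * (h * \<Lambda> h s t \<omega> ^ 4)"
proof -
  define \<beta> where "\<beta> r j = 1 / (X r \<omega> $ i - X r \<omega> $ j) - 1 / (X s \<omega> $ i - X s \<omega> $ j)
      + (noise s r \<omega> i - noise s r \<omega> j) / (X s \<omega> $ i - X s \<omega> $ j)\<^sup>2" for r j
  define L where "L = \<Lambda> h s t \<omega>"
  have "remainder i h s t \<omega> = (\<Sum>j\<in>UNIV. \<gamma> i j * (\<beta> t j - \<beta> (s + h) j))
      + (b i (X t \<omega>) - b i (X s \<omega>) - (\<Sum>m\<in>UNIV. b' i (X s \<omega>) $ m * noise s t \<omega> m))"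
    unfolding remainder_def lin_alt interaction_eq_sum \<beta>_def
    by (simp add: sum_subtractf sum.distrib algebra_simps diff_divide_distrib add_divide_distrib)
  moreover have "\<bar>\<Sum>j\<in>UNIV. \<gamma> i j * (\<beta> t j - \<beta> (s + h) j)\<bar> \<le> \<Gamma> * (10 * (2 + 4 * sigma_norm\<^sup>2) * (h * L ^ 4))"
  proof -
    have "\<bar>\<Sum>j\<in>UNIV. \<gamma> i j * (\<beta> t j - \<beta> (s + h) j)\<bar> \<le> (\<Sum>j\<in>UNIV. \<bar>\<gamma> i j\<bar> * (10 * (2 + 4 * sigma_norm\<^sup>2) * (h * L ^ 4)))"
    proof (rule order_trans[OF sum_abs sum_mono])
      fix j
      have "\<bar>\<beta> t j - \<beta> (s + h) j\<bar> \<le> 10 * (2 + 4 * sigma_norm\<^sup>2) * (h * L ^ 4)"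
      proof -
        have "\<bar>\<beta> t j\<bar> \<le> 5 * (2 + 4 * sigma_norm\<^sup>2) * h * L ^ 4" "\<bar>\<beta> (s + h) j\<bar> \<le> 5 * (2 + 4 * sigma_norm\<^sup>2) * h * L ^ 4"
          using inverse_gap_expansion[of t i j] inverse_gap_expansion[of "s + h" i j]
          unfolding \<beta>_def L_def by simp_all
        then have "\<bar>\<beta> t j - \<beta> (s + h) j\<bar> \<le> 5 * (2 + 4 * sigma_norm\<^sup>2) * h * L ^ 4 + 5 * (2 + 4 * sigma_norm\<^sup>2) * h * L ^ 4"
          by linarith
        then show ?thesis by (simp add: algebra_simps)
      qed
      then show "\<bar>\<gamma> i j * (\<beta> t j - \<beta> (s + h) j)\<bar> \<le> \<bar>\<gamma> i j\<bar> * (10 * (2 + 4 * sigma_norm\<^sup>2) * (h * L ^ 4))"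
        unfolding abs_mult by (intro mult_left_mono) auto
    qed
    also have "\<dots> \<le> \<Gamma> * (10 * (2 + 4 * sigma_norm\<^sup>2) * (h * L ^ 4))"
      unfolding sum_distrib_right[symmetric] using stepsD(1)[OF st] \<Lambda>_facts(1)
      by (intro mult_right_mono \<Gamma>_ge) (auto simp: L_def)
    finally show ?thesis .
  qed
  moreover note drift_expansion_bound[of i, folded L_def]
  ultimately have "\<bar>remainder i h s t \<omega>\<bar> \<le> \<Gamma> * (10 * (2 + 4 * sigma_norm\<^sup>2) * (h * L ^ 4)) + B * (3 + 2 * (real CARD('n))\<^sup>2 * sigma_norm\<^sup>2) * (h * L ^ 4)"
    by linarith
  then show ?thesis unfolding L_def distrib_right mult.assoc .
qed

end

end

section \<open>Centered part and remainder of the local error\<close>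

context particle_system
begin

definition mart_step :: "'n \<Rightarrow> real \<Rightarrow> real \<Rightarrow> 'a \<Rightarrow> real" where
  "mart_step i h s \<omega> = (LBINT t:{s..s+h}. lin i h s t \<omega>)"

definition rem_step :: "'n \<Rightarrow> real \<Rightarrow> real \<Rightarrow> 'a \<Rightarrow> real" where
  "rem_step i h s \<omega> = (LBINT t:{s..s+h}. remainder i h s t \<omega>)"

lemma lin_coeff_measurable [measurable]: "lin_coeff i l \<in> borel_measurable borel"
  unfolding lin_coeff_def[abs_def] by measurable

lemma lin_F:
  assumes st: "(h, s, t) \<in> steps"
  shows "lin i h s t \<in> borel_measurable (F (s + h))"
proof -
  note st = stepsD[OF st]
  have [measurable]: "X s \<in> borel_measurable (F (s + h))" "W s \<in> borel_measurable (F (s + h))"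
    "W t \<in> borel_measurable (F (s + h))" "W (s + h) \<in> borel_measurable (F (s + h))"
    using st by (auto intro!: X_F W_F)
  show ?thesis unfolding lin_def[abs_def] noise_def by measurable
qed

lemma lin_M [measurable]: "(h, s, t) \<in> steps \<Longrightarrow> lin i h s t \<in> borel_measurable M"
  using stepsD[of h s t] by (intro F_M[OF _ lin_F]) auto

lemma remainder_M [measurable]:
  assumes st: "(h, s, t) \<in> steps"
  shows "remainder i h s t \<in> borel_measurable M"
proof -
  have [measurable]: "X s \<in> borel_measurable M" "X t \<in> borel_measurable M" "X (s + h) \<in> borel_measurable M"
    using stepsD[OF st] by auto
  note [measurable] = lin_M[OF st]
  show ?thesis unfolding remainder_def[abs_def] by measurable
qed

lemma W_component_cont:
  assumes "\<omega> \<in> space M" "0 \<le> s" "s' \<le> T"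
  shows "continuous_on {s..s'} (\<lambda>t. W t \<omega> $ l)"
  using assms by (intro continuous_on_component continuous_on_subset[OF W_cont]) auto

lemma lin_cont:
  assumes "\<omega> \<in> space M" "0 \<le> s" "s + h \<le> T"
  shows "continuous_on {s..s+h} (\<lambda>t. lin i h s t \<omega>)"
  unfolding lin_def noise_def
  by (intro continuous_intros W_component_cont assms)

lemma remainder_cont:
  assumes "\<omega> \<in> space M" "0 \<le> s" "s + h \<le> T"
  shows "continuous_on {s..s+h} (\<lambda>t. remainder i h s t \<omega>)"
proof -
  have "continuous_on {s..s+h} (\<lambda>t. drift i t \<omega> - (interaction \<gamma> (X (s + h) \<omega>) i + b i (X s \<omega>)) - lin i h s t \<omega>)"
    by (intro continuous_on_diff continuous_on_const drift_cont lin_cont assms)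
  then show ?thesis by (simp add: remainder_def drift_def algebra_simps)
qed

lemma mart_step_F:
  assumes st: "(h, s, s) \<in> steps"
  shows "mart_step i h s \<in> borel_measurable (F (s + h))"
proof -
  note st = stepsD[OF st]
  interpret cp: continuous_process "F (s + h)" "lin i h s" s "s + h"
    using st by unfold_locales (auto intro!: lin_F lin_cont simp: steps_def space_F)
  show ?thesis using cp.measurable_path_integral
    by (simp add: mart_step_def[abs_def] cp.path_integral_def[abs_def])
qed

lemma continuous_process_lin:
  assumes st: "(h, s, s) \<in> steps"
  shows "continuous_process_prob M (lin i h s) s (s + h)"
  using stepsD[OF st] by unfold_locales (auto intro!: lin_M lin_cont simp: steps_def)

lemma continuous_process_remainder:
  assumes st: "(h, s, s) \<in> steps"
  shows "continuous_process_prob M (remainder i h s) s (s + h)"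
  using stepsD[OF st] by unfold_locales (auto intro!: remainder_M remainder_cont simp: steps_def)

lemma rem_step_M:
  assumes st: "(h, s, s) \<in> steps"
  shows "rem_step i h s \<in> borel_measurable M"
proof -
  interpret cp: continuous_process_prob M "remainder i h s" s "s + h"
    by (rule continuous_process_remainder[OF st])
  show ?thesis using cp.measurable_path_integral
    by (simp add: rem_step_def[abs_def] cp.path_integral_def[abs_def])
qed

lemma \<Lambda>_dominated_moment:
  fixes g :: "real \<Rightarrow> real \<Rightarrow> real \<Rightarrow> 'a \<Rightarrow> real"
  assumes c: "\<And>h. 0 < h \<Longrightarrow> 0 < c h"
    and bound: "\<And>h s t \<omega>. (h, s, t) \<in> steps \<Longrightarrow> \<omega> \<in> space M \<Longrightarrow> \<bar>g h s t \<omega>\<bar> \<le> C * (c h * \<Lambda> h s t \<omega> ^ 4)"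
  shows "\<exists>K\<ge>0. \<forall>h s t. (h, s, t) \<in> steps \<longrightarrow>
    (\<integral>\<^sup>+ \<omega>. ennreal (\<bar>g h s t \<omega>\<bar> powr p) \<partial>M) \<le> ennreal (c h powr p * K)"
proof -
  have "bounded_Lp M (real 4 * p) steps (\<lambda>(h, s, t) \<omega>. \<Lambda> h s t \<omega>)" using \<Lambda>_moment by simp
  then have "bounded_Lp M p steps (\<lambda>x \<omega>. (case x of (h, s, t) \<Rightarrow> \<lambda>\<omega>. \<Lambda> h s t \<omega>) \<omega> ^ 4)"
    by (rule bounded_Lp_power) simp
  then have bd: "bounded_Lp M p steps (\<lambda>x \<omega>. C * (case x of (h, s, t) \<Rightarrow> \<lambda>\<omega>. \<Lambda> h s t \<omega>) \<omega> ^ 4)"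
    by (rule bounded_Lp_cmult)
  obtain K where K: "0 \<le> K" "\<And>x. x \<in> steps \<Longrightarrow>
      (\<integral>\<^sup>+ \<omega>. ennreal (\<bar>C * (case x of (h, s, t) \<Rightarrow> \<lambda>\<omega>. \<Lambda> h s t \<omega>) \<omega> ^ 4\<bar> powr p) \<partial>M) \<le> ennreal K"
    using bd unfolding bounded_Lp_def by blast
  have "(\<integral>\<^sup>+ \<omega>. ennreal (\<bar>g h s t \<omega>\<bar> powr p) \<partial>M) \<le> ennreal (c h powr p * K)" if st: "(h, s, t) \<in> steps" for h s t
  proof -
    have ch: "0 < c h" using c stepsD(1)[OF st] .
    have [measurable]: "(\<lambda>\<omega>. C * \<Lambda> h s t \<omega> ^ 4) \<in> borel_measurable M"
      using bounded_Lp_measurable[OF bd st] by simp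
    have "(\<integral>\<^sup>+ \<omega>. ennreal (\<bar>g h s t \<omega>\<bar> powr p) \<partial>M)
        \<le> (\<integral>\<^sup>+ \<omega>. ennreal (c h powr p) * ennreal (\<bar>C * \<Lambda> h s t \<omega> ^ 4\<bar> powr p) \<partial>M)"
    proof (rule nn_integral_mono)
      fix \<omega> assume "\<omega> \<in> space M"
      from bound[OF st this] have "\<bar>g h s t \<omega>\<bar> \<le> c h * (C * \<Lambda> h s t \<omega> ^ 4)" by (simp add: ac_simps)
      also have "\<dots> \<le> c h * \<bar>C * \<Lambda> h s t \<omega> ^ 4\<bar>" using ch by (intro mult_left_mono) auto
      finally have "\<bar>g h s t \<omega>\<bar> powr p \<le> (c h * \<bar>C * \<Lambda> h s t \<omega> ^ 4\<bar>) powr p"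
        using p by (intro powr_mono2) auto
      then show "ennreal (\<bar>g h s t \<omega>\<bar> powr p) \<le> ennreal (c h powr p) * ennreal (\<bar>C * \<Lambda> h s t \<omega> ^ 4\<bar> powr p)"
        using ch by (simp only: ennreal_mult[symmetric] powr_ge_zero powr_mult ennreal_leI)
    qed
    also have "\<dots> = ennreal (c h powr p) * (\<integral>\<^sup>+ \<omega>. ennreal (\<bar>C * \<Lambda> h s t \<omega> ^ 4\<bar> powr p) \<partial>M)"
      by (intro nn_integral_cmult) measurable
    also have "\<dots> \<le> ennreal (c h powr p) * ennreal K"
      using K(2)[OF st] by (intro mult_left_mono) auto
    finally show ?thesis using K(1) by (simp add: ennreal_mult)
  qed
  then show ?thesis using K(1) by blast
qed

text \<open>Integration over a step of length \<open>h\<close> gains a factor \<open>h\<close>. This gives the orders \<open>h powr (3/2)\<close> and \<open>h\<^sup>2\<close> of the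
two parts of the local error.\<close>

lemma step_integral_moment:
  fixes g :: "real \<Rightarrow> real \<Rightarrow> real \<Rightarrow> 'a \<Rightarrow> real"
  assumes g: "\<And>h s. (h, s, s) \<in> steps \<Longrightarrow> continuous_process_prob M (g h s) s (s + h)"
    and K: "\<exists>K\<ge>0. \<forall>h s t. (h, s, t) \<in> steps \<longrightarrow>
      (\<integral>\<^sup>+ \<omega>. ennreal (\<bar>g h s t \<omega>\<bar> powr p) \<partial>M) \<le> ennreal (c h powr p * K)"
  shows "\<exists>K\<ge>0. \<forall>h s. (h, s, s) \<in> steps \<longrightarrow>
    (\<integral>\<^sup>+ \<omega>. ennreal (\<bar>LBINT t:{s..s+h}. g h s t \<omega>\<bar> powr p) \<partial>M) \<le> ennreal ((h powr p * c h powr p) * K)"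
proof -
  obtain K where K: "0 \<le> K" "\<And>h s t. (h, s, t) \<in> steps \<Longrightarrow>
      (\<integral>\<^sup>+ \<omega>. ennreal (\<bar>g h s t \<omega>\<bar> powr p) \<partial>M) \<le> ennreal (c h powr p * K)"
    using K by blast
  have "(\<integral>\<^sup>+ \<omega>. ennreal (\<bar>LBINT t:{s..s+h}. g h s t \<omega>\<bar> powr p) \<partial>M) \<le> ennreal ((h powr p * c h powr p) * K)"
    if st: "(h, s, s) \<in> steps" for h s
  proof -
    interpret cp: continuous_process_prob M "g h s" s "s + h" by (rule g[OF st])
    have "(\<integral>\<^sup>+ \<omega>. ennreal (\<bar>cp.path_integral \<omega>\<bar> powr p) \<partial>M) \<le> ennreal ((s + h - s) powr p * (c h powr p * K))"
    proof (rule cp.moment_path_integral)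
      fix t assume "t \<in> {s..s+h}"
      then have "(h, s, t) \<in> steps" using st by (auto simp: steps_def)
      then show "(\<integral>\<^sup>+ \<omega>. ennreal (\<bar>g h s t \<omega>\<bar> powr p) \<partial>M) \<le> ennreal (c h powr p * K)" by (rule K(2))
    qed (use p K in auto)
    then show ?thesis by (simp add: cp.path_integral_def mult.assoc)
  qed
  then show ?thesis using K(1) by blast
qed

lemma lin_moment:
  "\<exists>K\<ge>0. \<forall>h s t. (h, s, t) \<in> steps \<longrightarrow>
    (\<integral>\<^sup>+ \<omega>. ennreal (\<bar>lin i h s t \<omega>\<bar> powr p) \<partial>M) \<le> ennreal (sqrt h powr p * K)"
  by (rule \<Lambda>_dominated_moment[OF _ lin_bound]) auto

lemma mart_step_moment:
  "\<exists>K\<ge>0. \<forall>h s. (h, s, s) \<in> steps \<longrightarrow>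
    (\<integral>\<^sup>+ \<omega>. ennreal (\<bar>mart_step i h s \<omega>\<bar> powr p) \<partial>M) \<le> ennreal (h powr (3 / 2 * p) * K)"
proof -
  have e: "h powr p * sqrt h powr p = h powr (3 / 2 * p)" if "(h, s, s) \<in> steps" for h s
  proof -
    have "h powr p * (h powr (1 / 2)) powr p = h powr (3 / 2 * p)"
      by (simp add: powr_powr powr_add[symmetric])
    then show ?thesis using stepsD(1)[OF that] by (simp add: powr_half_sqrt)
  qed
  show ?thesis
    using step_integral_moment[OF continuous_process_lin[of _ _ i] lin_moment]
    by (simp add: mart_step_def e cong: imp_cong)
qed

lemma rem_step_moment:
  "\<exists>K\<ge>0. \<forall>h s. (h, s, s) \<in> steps \<longrightarrow>
    (\<integral>\<^sup>+ \<omega>. ennreal (\<bar>rem_step i h s \<omega>\<bar> powr p) \<partial>M) \<le> ennreal (h powr (2 * p) * K)"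
proof -
  have "\<exists>K\<ge>0. \<forall>h s t. (h, s, t) \<in> steps \<longrightarrow>
      (\<integral>\<^sup>+ \<omega>. ennreal (\<bar>remainder i h s t \<omega>\<bar> powr p) \<partial>M) \<le> ennreal (h powr p * K)"
    by (rule \<Lambda>_dominated_moment[OF _ remainder_bound]) auto
  from step_integral_moment[OF continuous_process_remainder[of _ _ i] this] show ?thesis
    by (simp add: rem_step_def powr_add[symmetric])
qed

lemma inv_gap_sq_integrable:
  assumes t: "t \<in> {0..T}"
  shows "integrable M (\<lambda>\<omega>. (inv_gap (X t \<omega>))\<^sup>2)"
proof -
  have "bounded_Lp M (real 2 * (2 * p)) {0..T} (\<lambda>t \<omega>. inv_gap (X t \<omega>))"
    using inv_gap_moment by simp
  then have "bounded_Lp M (2 * p) {0..T} (\<lambda>t \<omega>. (inv_gap (X t \<omega>)) ^ 2)"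
    by (rule bounded_Lp_power) simp
  then show ?thesis using t p by (intro bounded_Lp_integrable[where P = "{0..T}" and q = "2 * p"]) auto
qed

lemma lin_coeff_bound: "\<bar>lin_coeff i l x\<bar> \<le> \<Gamma> * (2 * sigma_norm) * (inv_gap x)\<^sup>2"
proof -
  have "\<bar>lin_coeff i l x\<bar> \<le> (\<Sum>j\<in>UNIV. \<bar>\<gamma> i j\<bar> * (2 * sigma_norm * (inv_gap x)\<^sup>2))"
    unfolding lin_coeff_def
  proof (rule order_trans[OF sum_abs sum_mono])
    fix j
    have "1 / \<bar>x $ i - x $ j\<bar> \<le> inv_gap x" by (rule inv_gap_ge)
    then have "(1 / \<bar>x $ i - x $ j\<bar>)\<^sup>2 \<le> (inv_gap x)\<^sup>2" by (intro power_mono) auto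
    moreover have "\<bar>\<sigma> i l - \<sigma> j l\<bar> \<le> 2 * sigma_norm" using sigma_norm_ge[of i l] sigma_norm_ge[of j l] by linarith
    ultimately have "\<bar>\<sigma> i l - \<sigma> j l\<bar> * (1 / \<bar>x $ i - x $ j\<bar>)\<^sup>2 \<le> 2 * sigma_norm * (inv_gap x)\<^sup>2"
      using sigma_norm_nonneg by (intro mult_mono) auto
    then have "\<bar>\<gamma> i j\<bar> * (\<bar>\<sigma> i l - \<sigma> j l\<bar> * (1 / \<bar>x $ i - x $ j\<bar>)\<^sup>2) \<le> \<bar>\<gamma> i j\<bar> * (2 * sigma_norm * (inv_gap x)\<^sup>2)"
      by (intro mult_left_mono) auto
    then show "\<bar>\<gamma> i j * (\<sigma> i l - \<sigma> j l) / (x $ i - x $ j)\<^sup>2\<bar> \<le> \<bar>\<gamma> i j\<bar> * (2 * sigma_norm * (inv_gap x)\<^sup>2)"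
      by (simp add: abs_mult abs_divide power_divide)
  qed
  also have "\<dots> \<le> \<Gamma> * (2 * sigma_norm * (inv_gap x)\<^sup>2)"
    unfolding sum_distrib_right[symmetric] using sigma_norm_nonneg by (intro mult_right_mono \<Gamma>_ge) auto
  finally show ?thesis by (simp add: mult.assoc)
qed

text \<open>Each coefficient is known at time \<open>s\<close> and integrable, so it may be multiplied with a later
Brownian increment without producing a mean.\<close>

lemma lin_centered:
  assumes st: "(h, s, t) \<in> steps" and H: "H \<in> borel_measurable (F s)" and Hb: "\<And>\<omega>. \<bar>H \<omega>\<bar> \<le> c"
  shows "integrable M (\<lambda>\<omega>. H \<omega> * lin i h s t \<omega>)" "(\<integral>\<omega>. H \<omega> * lin i h s t \<omega> \<partial>M) = 0"
proof -
  note st' = stepsD[OF st]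
  have HM [measurable]: "H \<in> borel_measurable M" using F_M[OF _ H] st' by simp
  have c: "0 \<le> c" using Hb abs_ge_zero order_trans by blast
  have Xs [measurable]: "X s \<in> borel_measurable M" using st' by auto
  have XsF [measurable]: "X s \<in> borel_measurable (F s)" using X_adapted st' by auto
  have 1: "integrable M (\<lambda>\<omega>. (H \<omega> * lin_coeff i l (X s \<omega>)) * (W r \<omega> $ l - W s \<omega> $ l)) \<and>
      (\<integral>\<omega>. (H \<omega> * lin_coeff i l (X s \<omega>)) * (W r \<omega> $ l - W s \<omega> $ l) \<partial>M) = 0" if "s \<le> r" "r \<le> T" for l r
  proof (rule W_indep)
    show "(\<lambda>\<omega>. H \<omega> * lin_coeff i l (X s \<omega>)) \<in> borel_measurable (F s)" using H by measurable
    show "integrable M (\<lambda>\<omega>. H \<omega> * lin_coeff i l (X s \<omega>))"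
    proof (rule Bochner_Integration.integrable_bound)
      show "integrable M (\<lambda>\<omega>. c * (\<Gamma> * (2 * sigma_norm) * (inv_gap (X s \<omega>))\<^sup>2))"
        using st' by (intro integrable_mult_right inv_gap_sq_integrable) auto
      show "AE \<omega> in M. norm (H \<omega> * lin_coeff i l (X s \<omega>)) \<le> norm (c * (\<Gamma> * (2 * sigma_norm) * (inv_gap (X s \<omega>))\<^sup>2))"
      proof (rule AE_I2)
        fix \<omega>
        have "\<bar>H \<omega>\<bar> * \<bar>lin_coeff i l (X s \<omega>)\<bar> \<le> c * (\<Gamma> * (2 * sigma_norm) * (inv_gap (X s \<omega>))\<^sup>2)"
          using Hb lin_coeff_bound c by (intro mult_mono) auto
        then show "norm (H \<omega> * lin_coeff i l (X s \<omega>)) \<le> norm (c * (\<Gamma> * (2 * sigma_norm) * (inv_gap (X s \<omega>))\<^sup>2))"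
          unfolding real_norm_def abs_mult[of "H \<omega>"] by linarith
      qed
    qed measurable
  qed (use that st' in auto)
  have 2: "integrable M (\<lambda>\<omega>. (H \<omega> * b' i (X s \<omega>) $ m) * (W t \<omega> $ l - W s \<omega> $ l)) \<and>
      (\<integral>\<omega>. (H \<omega> * b' i (X s \<omega>) $ m) * (W t \<omega> $ l - W s \<omega> $ l) \<partial>M) = 0" for l m
  proof (rule W_indep)
    show "(\<lambda>\<omega>. H \<omega> * b' i (X s \<omega>) $ m) \<in> borel_measurable (F s)" using H by measurable
    show "integrable M (\<lambda>\<omega>. H \<omega> * b' i (X s \<omega>) $ m)"
    proof (rule integrable_const_bound[where B = "c * B"])
      show "AE \<omega> in M. norm (H \<omega> * b' i (X s \<omega>) $ m) \<le> c * B"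
        using Hb c order_trans[OF component_le_norm_cart b'_bound]
        by (intro AE_I2) (auto simp: abs_mult intro!: mult_mono)
    qed measurable
  qed (use st' in auto)
  have e: "H \<omega> * lin i h s t \<omega> =
      (\<Sum>l\<in>UNIV. (H \<omega> * lin_coeff i l (X s \<omega>)) * (W (s + h) \<omega> $ l - W s \<omega> $ l)
          - (H \<omega> * lin_coeff i l (X s \<omega>)) * (W t \<omega> $ l - W s \<omega> $ l))
      + (\<Sum>m\<in>UNIV. \<Sum>l\<in>UNIV. \<sigma> m l * ((H \<omega> * b' i (X s \<omega>) $ m) * (W t \<omega> $ l - W s \<omega> $ l)))" for \<omega>
    unfolding lin_def noise_def distrib_left sum_distrib_left by (simp add: right_diff_distrib ac_simps)
  have i1: "integrable M (\<lambda>\<omega>. (H \<omega> * lin_coeff i l (X s \<omega>)) * (W (s + h) \<omega> $ l - W s \<omega> $ l)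
          - (H \<omega> * lin_coeff i l (X s \<omega>)) * (W t \<omega> $ l - W s \<omega> $ l))" for l
    using 1[of "s + h" l] 1[of t l] st' by (intro Bochner_Integration.integrable_diff) auto
  have i2: "integrable M (\<lambda>\<omega>. \<sigma> m l * ((H \<omega> * b' i (X s \<omega>) $ m) * (W t \<omega> $ l - W s \<omega> $ l)))" for m l
    using 2[of m l] by (intro integrable_mult_right) auto
  have z1: "(\<integral>\<omega>. (H \<omega> * lin_coeff i l (X s \<omega>)) * (W (s + h) \<omega> $ l - W s \<omega> $ l)
          - (H \<omega> * lin_coeff i l (X s \<omega>)) * (W t \<omega> $ l - W s \<omega> $ l) \<partial>M) = 0" for l
    using 1[of "s + h" l] 1[of t l] st' by (subst Bochner_Integration.integral_diff) auto
  have z2: "(\<integral>\<omega>. \<sigma> m l * ((H \<omega> * b' i (X s \<omega>) $ m) * (W t \<omega> $ l - W s \<omega> $ l)) \<partial>M) = 0" for m l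
    using 2[of m l] by (subst integral_mult_right_zero) simp
  define G1 where "G1 l \<omega> = (H \<omega> * lin_coeff i l (X s \<omega>)) * (W (s + h) \<omega> $ l - W s \<omega> $ l)
          - (H \<omega> * lin_coeff i l (X s \<omega>)) * (W t \<omega> $ l - W s \<omega> $ l)" for l \<omega>
  define G2 where "G2 m l \<omega> = \<sigma> m l * ((H \<omega> * b' i (X s \<omega>) $ m) * (W t \<omega> $ l - W s \<omega> $ l))" for m l \<omega>
  have eG: "H \<omega> * lin i h s t \<omega> = (\<Sum>l\<in>UNIV. G1 l \<omega>) + (\<Sum>m\<in>UNIV. \<Sum>l\<in>UNIV. G2 m l \<omega>)" for \<omega>
    unfolding e G1_def G2_def ..
  note i = i1[folded G1_def] i2[folded G2_def]
  note z = z1[folded G1_def] z2[folded G2_def]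
  show "integrable M (\<lambda>\<omega>. H \<omega> * lin i h s t \<omega>)"
    unfolding eG by (intro Bochner_Integration.integrable_add Bochner_Integration.integrable_sum i)
  show "(\<integral>\<omega>. H \<omega> * lin i h s t \<omega> \<partial>M) = 0"
    unfolding eG by (subst Bochner_Integration.integral_add)
      (simp_all add: Bochner_Integration.integral_sum Bochner_Integration.integrable_sum i z)
qed

lemma mart_step_centered:
  assumes st: "(h, s, s) \<in> steps" and H: "H \<in> borel_measurable (F s)" and Hb: "\<And>\<omega>. \<bar>H \<omega>\<bar> \<le> c"
  shows "integrable M (\<lambda>\<omega>. H \<omega> * mart_step i h s \<omega>)" "(\<integral>\<omega>. H \<omega> * mart_step i h s \<omega> \<partial>M) = 0"
proof -
  note st' = stepsD[OF st]
  have HM [measurable]: "H \<in> borel_measurable M" using F_M[OF _ H] st' by simp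
  have c: "0 \<le> c" using Hb abs_ge_zero order_trans by blast
  have stt: "(h, s, t) \<in> steps" if "t \<in> {s..s+h}" for t using that st' by (auto simp: steps_def)
  interpret cp: continuous_process_prob M "\<lambda>t \<omega>. H \<omega> * lin i h s t \<omega>" s "s + h"
    using st' by unfold_locales
      (auto intro!: borel_measurable_times lin_M lin_cont continuous_on_mult_left simp: steps_def)
  have pe: "cp.path_integral \<omega> = H \<omega> * mart_step i h s \<omega>" for \<omega>
    by (simp add: cp.path_integral_def mart_step_def)
  obtain K0 where K0: "0 \<le> K0" "\<And>h s t. (h, s, t) \<in> steps \<Longrightarrow>
      (\<integral>\<^sup>+ \<omega>. ennreal (\<bar>lin i h s t \<omega>\<bar> powr p) \<partial>M) \<le> ennreal (sqrt h powr p * K0)"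
    using lin_moment[of i] by blast
  have "bounded_Lp M p {s..s+h} (\<lambda>t. lin i h s t)"
    using K0 stt by (intro bounded_LpI[where K = "sqrt h powr p * K0"] lin_M) auto
  then have b: "bounded_Lp M p {s..s+h} (\<lambda>t \<omega>. H \<omega> * lin i h s t \<omega>)"
  proof (rule bounded_Lp_mono[OF bounded_Lp_cmult[where c = c]])
    fix t assume t: "t \<in> {s..s+h}"
    show "(\<lambda>\<omega>. H \<omega> * lin i h s t \<omega>) \<in> borel_measurable M"
      using lin_M[OF stt[OF t]] by measurable
    show "AE \<omega> in M. \<bar>H \<omega> * lin i h s t \<omega>\<bar> \<le> \<bar>c * lin i h s t \<omega>\<bar>"
      using Hb c by (intro AE_I2) (auto simp: abs_mult intro!: mult_right_mono)
  qed (use p in auto)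
  obtain K where K: "0 \<le> K" "\<And>t. t \<in> {s..s+h} \<Longrightarrow> (\<integral>\<^sup>+ \<omega>. ennreal \<bar>H \<omega> * lin i h s t \<omega>\<bar> \<partial>M) \<le> ennreal K"
  proof -
    have "1 \<le> p" using p by simp
    from bounded_Lp_nn_integral_abs[OF b this] show ?thesis using that by blast
  qed
  note res = cp.expectation_path_integral[OF K lin_centered(2)[OF stt H Hb]]
  show "integrable M (\<lambda>\<omega>. H \<omega> * mart_step i h s \<omega>)" "(\<integral>\<omega>. H \<omega> * mart_step i h s \<omega> \<partial>M) = 0"
    using res by (simp_all add: pe[abs_def])
qed

text \<open>The solution performs the implicit step of the scheme up to the local error. The set where this
fails does not depend on the step.\<close>

lemma step_expansion:
  "AE \<omega> in M. \<forall>h s i. (h, s, s) \<in> steps \<longrightarrow>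
    X (s + h) \<omega> $ i - h * interaction \<gamma> (X (s + h) \<omega>) i
      = X s \<omega> $ i + h * b i (X s \<omega>) + noise s (s + h) \<omega> i + mart_step i h s \<omega> + rem_step i h s \<omega>"
  using sde AE_space
proof eventually_elim
  fix \<omega> assume sde: "\<forall>s t i. 0 \<le> s \<longrightarrow> s \<le> t \<longrightarrow> t \<le> T \<longrightarrow>
      X t \<omega> $ i - X s \<omega> $ i = (LBINT r:{s..t}. interaction \<gamma> (X r \<omega>) i + b i (X r \<omega>))
        + (\<Sum>j\<in>UNIV. \<sigma> i j * (W t \<omega> $ j - W s \<omega> $ j))" and om: "\<omega> \<in> space M"
  show "\<forall>h s i. (h, s, s) \<in> steps \<longrightarrow>
    X (s + h) \<omega> $ i - h * interaction \<gamma> (X (s + h) \<omega>) i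
      = X s \<omega> $ i + h * b i (X s \<omega>) + noise s (s + h) \<omega> i + mart_step i h s \<omega> + rem_step i h s \<omega>"
  proof (intro allI impI)
    fix h s i assume "(h, s, s) \<in> steps"
    note st = stepsD[OF this]
    let ?k = "interaction \<gamma> (X (s + h) \<omega>) i + b i (X s \<omega>)"
    have X: "X (s + h) \<omega> $ i - X s \<omega> $ i = (LBINT r:{s..s+h}. drift i r \<omega>) + noise s (s + h) \<omega> i"
      using sde[rule_format, of s "s + h" i] st by (simp add: drift_def noise_def)
    have il: "set_integrable lborel {s..s+h} (\<lambda>t. lin i h s t \<omega>)"
      using st by (intro borel_integrable_atLeastAtMost' lin_cont om) auto
    have ir: "set_integrable lborel {s..s+h} (\<lambda>t. remainder i h s t \<omega>)"
      using st by (intro borel_integrable_atLeastAtMost' remainder_cont om) auto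
    have ik: "set_integrable lborel {s..s+h} (\<lambda>t. ?k)"
      by (intro borel_integrable_atLeastAtMost' continuous_on_const)
    have "(LBINT r:{s..s+h}. drift i r \<omega>) = (LBINT r:{s..s+h}. lin i h s r \<omega> + remainder i h s r \<omega> + ?k)"
      by (rule arg_cong[where f = "set_lebesgue_integral lborel {s..s+h}"])
        (simp add: fun_eq_iff drift_def remainder_def)
    also have "\<dots> = mart_step i h s \<omega> + rem_step i h s \<omega> + (LBINT r:{s..s+h}. ?k)"
      using il ir ik by (simp add: set_integral_add mart_step_def rem_step_def)
    also have "(LBINT r:{s..s+h}. ?k) = h * ?k"
      using st by (simp add: set_lebesgue_integral_def)
    finally show "X (s + h) \<omega> $ i - h * interaction \<gamma> (X (s + h) \<omega>) i
      = X s \<omega> $ i + h * b i (X s \<omega>) + noise s (s + h) \<omega> i + mart_step i h s \<omega> + rem_step i h s \<omega>"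
      using X by (simp add: algebra_simps)
  qed
qed

end

section \<open>The global error\<close>

lemma borel_measurable_vec_lambda:
  fixes f :: "'n::finite \<Rightarrow> 'a \<Rightarrow> real"
  assumes "\<And>i. f i \<in> borel_measurable M"
  shows "(\<lambda>\<omega>. \<chi> i. f i \<omega>) \<in> borel_measurable M"
proof -
  have "(\<lambda>\<omega>. \<chi> i. f i \<omega>) = (\<lambda>\<omega>. \<Sum>i\<in>UNIV. f i \<omega> *\<^sub>R axis i 1)"
  proof
    fix \<omega>
    show "(\<chi> i. f i \<omega>) = (\<Sum>i\<in>UNIV. f i \<omega> *\<^sub>R axis i 1)"
      using basis_expansion[of "\<chi> i. f i \<omega>"] by (simp add: scalar_mult_eq_scaleR)
  qed
  then show ?thesis using assms by simp
qed

lemma (in repulsion) semi_implicit_EM_Suc: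
  assumes "0 < T / real n"
  shows "semi_implicit_EM \<gamma> b (\<lambda>i j x. \<sigma> i j) W T \<xi> n (Suc k) \<omega>
    = resolvent (T / real n) (semi_implicit_EM \<gamma> b (\<lambda>i j x. \<sigma> i j) W T \<xi> n k \<omega>
      + (T / real n) *\<^sub>R (\<chi> i. b i (semi_implicit_EM \<gamma> b (\<lambda>i j x. \<sigma> i j) W T \<xi> n k \<omega>))
      + (\<chi> i. \<Sum>j\<in>UNIV. \<sigma> i j * (W (real (Suc k) * T / real n) \<omega> $ j - W (real k * T / real n) \<omega> $ j)))"
  unfolding semi_implicit_EM.simps semi_implicit_step_eq_resolvent[OF assms] vector_minus_component ..

lemma (in repulsion) semi_implicit_EM_measurable:
  assumes h: "0 < T / real n" and b: "\<And>i. b i \<in> borel_measurable borel"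
    and \<xi>: "\<xi> \<in> borel_measurable N"
    and W: "\<And>j. j \<le> k \<Longrightarrow> W (real j * T / real n) \<in> borel_measurable N"
  shows "semi_implicit_EM \<gamma> b (\<lambda>i j x. \<sigma> i j) W T \<xi> n k \<in> borel_measurable N"
  using W
proof (induction k)
  case (Suc k)
  note [measurable] = b
  have [measurable]: "semi_implicit_EM \<gamma> b (\<lambda>i j x. \<sigma> i j) W T \<xi> n k \<in> borel_measurable N"
    using Suc by simp
  have [measurable]: "W (real (Suc k) * T / real n) \<in> borel_measurable N" "W (real k * T / real n) \<in> borel_measurable N"
    using Suc.prems[of "Suc k"] Suc.prems[of k] by simp_all
  have "resolvent (T / real n) \<in> borel_measurable borel"
    by (rule borel_measurable_continuous_onI[OF continuous_resolvent[OF h]])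
  then show ?case
    unfolding semi_implicit_EM_Suc[OF h, abs_def]
  proof (rule measurable_compose[rotated])
    show "(\<lambda>\<omega>. semi_implicit_EM \<gamma> b (\<lambda>i j x. \<sigma> i j) W T \<xi> n k \<omega>
      + (T / real n) *\<^sub>R (\<chi> i. b i (semi_implicit_EM \<gamma> b (\<lambda>i j x. \<sigma> i j) W T \<xi> n k \<omega>))
      + (\<chi> i. \<Sum>j\<in>UNIV. \<sigma> i j * (W (real (Suc k) * T / real n) \<omega> $ j - W (real k * T / real n) \<omega> $ j))) \<in> borel_measurable N"
      by (intro borel_measurable_add borel_measurable_scaleR borel_measurable_vec_lambda borel_measurable_const) measurable
  qed
qed (use \<xi> in simp)

context particle_system
begin

lemma step_sum_moment:
  fixes G :: "'n \<Rightarrow> real \<Rightarrow> real \<Rightarrow> 'a \<Rightarrow> real"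
  assumes m: "\<And>i h s. (h, s, s) \<in> steps \<Longrightarrow> G i h s \<in> borel_measurable M" and c: "\<And>h. 0 \<le> c h"
    and G: "\<And>i. \<exists>K\<ge>0. \<forall>h s. (h, s, s) \<in> steps \<longrightarrow>
      (\<integral>\<^sup>+ \<omega>. ennreal (\<bar>G i h s \<omega>\<bar> powr p) \<partial>M) \<le> ennreal (c h * K)"
  shows "\<exists>K\<ge>0. \<forall>h s. (h, s, s) \<in> steps \<longrightarrow>
    (\<integral>\<^sup>+ \<omega>. ennreal ((\<Sum>i\<in>UNIV. \<bar>G i h s \<omega>\<bar>) powr p) \<partial>M) \<le> ennreal (c h * K)"
proof -
  obtain K where K: "\<And>i. 0 \<le> K i" "\<And>i h s. (h, s, s) \<in> steps \<Longrightarrow>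
      (\<integral>\<^sup>+ \<omega>. ennreal (\<bar>G i h s \<omega>\<bar> powr p) \<partial>M) \<le> ennreal (c h * K i)"
    using G by metis
  have "(\<integral>\<^sup>+ \<omega>. ennreal ((\<Sum>i\<in>UNIV. \<bar>G i h s \<omega>\<bar>) powr p) \<partial>M)
      \<le> ennreal (c h * (real CARD('n) powr (p - 1) * (\<Sum>i\<in>UNIV. K i)))" if st: "(h, s, s) \<in> steps" for h s
  proof -
    have "(\<integral>\<^sup>+ \<omega>. ennreal (\<bar>\<Sum>i\<in>UNIV. \<bar>G i h s \<omega>\<bar>\<bar> powr p) \<partial>M)
        \<le> ennreal (real CARD('n) powr (p - 1) * (\<Sum>i\<in>UNIV. c h * K i))"
      using p K c m st by (intro nn_integral_abs_sum_powr_le) auto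
    then show ?thesis unfolding sum_distrib_left[symmetric] by (simp add: ac_simps)
  qed
  then show ?thesis using K(1)
    by (intro exI[of _ "real CARD('n) powr (p - 1) * (\<Sum>i\<in>UNIV. K i)"]) (auto intro!: mult_nonneg_nonneg sum_nonneg)
qed

definition bvec :: "(real, 'n) vec \<Rightarrow> (real, 'n) vec" where "bvec x = (\<chi> i. b i x)"

lemma bvec_lipschitz: "norm (bvec x - bvec y) \<le> real CARD('n) * B * norm (x - y)"
proof -
  have "norm (bvec x - bvec y) \<le> (\<Sum>i\<in>UNIV. \<bar>(bvec x - bvec y) $ i\<bar>)" by (rule norm_le_l1_cart)
  also have "\<dots> \<le> (\<Sum>i\<in>(UNIV::'n set). B * norm (x - y))"
    using b_lipschitz by (intro sum_mono) (auto simp: bvec_def)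
  finally show ?thesis by simp
qed

end

locale scheme_error = particle_system M \<gamma> F W X \<sigma> b b' T p B
  for M :: "'a measure" and \<gamma> :: "'n::{finite,linorder} \<Rightarrow> 'n \<Rightarrow> real" and F W X \<sigma> b b' T p B +
  fixes n :: nat
  assumes n: "1 \<le> n" and n_large: "T / real n \<le> 1"
begin

definition h :: real where "h = T / real n"
definition grid :: "nat \<Rightarrow> real" where "grid k = real k * T / real n"

lemma h: "0 < h" "h \<le> 1" "real n * h = T" using T n n_large by (auto simp: h_def)
lemma grid_Suc: "grid (Suc k) = grid k + h" by (simp add: grid_def h_def add_divide_distrib distrib_right)
lemma grid_0: "grid 0 = 0" by (simp add: grid_def)
lemma grid_nonneg: "0 \<le> grid k" using T by (simp add: grid_def)
lemma grid_mono: "j \<le> k \<Longrightarrow> grid j \<le> grid k"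
  using T by (auto simp: grid_def intro!: divide_right_mono mult_right_mono)
lemma grid_le: "k \<le> n \<Longrightarrow> grid k \<le> T" using grid_mono[of k n] n by (simp add: grid_def)
lemma grid_in: "k \<le> n \<Longrightarrow> grid k \<in> {0..T}" using grid_le grid_nonneg by simp
lemma grid_steps: "k < n \<Longrightarrow> (h, grid k, grid k) \<in> steps"
  using h grid_nonneg[of k] grid_le[of "Suc k"] by (simp add: steps_def grid_Suc)

definition scheme :: "nat \<Rightarrow> 'a \<Rightarrow> (real, 'n) vec" where
  "scheme k = semi_implicit_EM \<gamma> b (\<lambda>i j x. \<sigma> i j) W T (X 0) n k"

lemma scheme_0: "scheme 0 = X 0" by (simp add: scheme_def)

lemma scheme_Suc: "scheme (Suc k) \<omega> = resolvent h (scheme k \<omega> + h *\<^sub>R bvec (scheme k \<omega>) + (\<chi> i. noise (grid k) (grid (Suc k)) \<omega> i))"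
  unfolding scheme_def bvec_def noise_def h_def grid_def
  by (rule semi_implicit_EM_Suc) (use h(1) in \<open>simp add: h_def\<close>)

lemma scheme_F:
  assumes k: "k \<le> n"
  shows "scheme k \<in> borel_measurable (F (grid k))"
  unfolding scheme_def
proof (rule semi_implicit_EM_measurable)
  show "0 < T / real n" using h(1) by (simp add: h_def)
  show "X 0 \<in> borel_measurable (F (grid k))" using X_F[of 0 "grid k"] T grid_nonneg by simp
  show "W (real j * T / real n) \<in> borel_measurable (F (grid k))" if "j \<le> k" for j
    using W_F[of "grid j" "grid k"] grid_mono[OF that] grid_in[of j] that k by (simp add: grid_def)
qed measurable

definition e :: "nat \<Rightarrow> 'a \<Rightarrow> (real, 'n) vec" where "e k \<omega> = X (grid k) \<omega> - scheme k \<omega>"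
definition a :: "nat \<Rightarrow> 'a \<Rightarrow> (real, 'n) vec" where
  "a k \<omega> = e k \<omega> + h *\<^sub>R (bvec (X (grid k) \<omega>) - bvec (scheme k \<omega>))"
definition mart_vec :: "nat \<Rightarrow> 'a \<Rightarrow> (real, 'n) vec" where "mart_vec k \<omega> = (\<chi> i. mart_step i h (grid k) \<omega>)"
definition rem_vec :: "nat \<Rightarrow> 'a \<Rightarrow> (real, 'n) vec" where "rem_vec k \<omega> = (\<chi> i. rem_step i h (grid k) \<omega>)"
definition emax :: "nat \<Rightarrow> 'a \<Rightarrow> real" where "emax k \<omega> = (MAX i\<in>{..k}. norm (e i \<omega>))"
text \<open>The normalization by the running maximum of the error. It is bounded and known at the beginning of
the step. Where the maximum is 0, so is \<open>a\<close>, and division by zero gives the right value 0.\<close>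

definition \<theta> :: "nat \<Rightarrow> 'a \<Rightarrow> (real, 'n) vec" where "\<theta> k \<omega> = (1 / emax k \<omega>) *\<^sub>R a k \<omega>"
definition L :: real where "L = real CARD('n) * B"

lemma L_nonneg: "0 \<le> L" using B by (simp add: L_def)

lemma scaling: "real n powr (p / 2) * h powr (3 / 2 * p) = h powr p * T powr (p / 2)"
proof -
  have "h powr (3 / 2 * p) = h powr p * h powr (p / 2)" by (simp add: powr_add[symmetric])
  moreover have "T powr (p / 2) = real n powr (p / 2) * h powr (p / 2)"
    using arg_cong[OF h(3), of "\<lambda>x. x powr (p / 2)"] by (simp add: powr_mult)
  ultimately show ?thesis by (simp only: ac_simps)
qed

lemma growth: "norm (a k \<omega>) \<le> (1 + h * L) * norm (e k \<omega>)"
proof -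
  have "norm (a k \<omega>) \<le> norm (e k \<omega>) + norm (h *\<^sub>R (bvec (X (grid k) \<omega>) - bvec (scheme k \<omega>)))"
    unfolding a_def by (rule norm_triangle_ineq)
  also have "norm (h *\<^sub>R (bvec (X (grid k) \<omega>) - bvec (scheme k \<omega>))) \<le> h * (L * norm (e k \<omega>))"
    using h bvec_lipschitz[of "X (grid k) \<omega>" "scheme k \<omega>"] by (simp add: L_def e_def mult.assoc)
  finally show ?thesis by (simp add: algebra_simps)
qed

lemma emax_ge: "i \<le> k \<Longrightarrow> norm (e i \<omega>) \<le> emax k \<omega>"
  unfolding emax_def by (intro Max_ge) auto

lemma emax_nonneg: "0 \<le> emax k \<omega>"
  using emax_ge[of 0 k \<omega>] norm_ge_zero[of "e 0 \<omega>"] by linarith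

lemma a_eq: "a k \<omega> = emax k \<omega> *\<^sub>R \<theta> k \<omega>"
proof (cases "emax k \<omega> = 0")
  case True
  then have "norm (e k \<omega>) = 0" using emax_ge[of k k \<omega>] by simp
  then have "norm (a k \<omega>) \<le> 0" using growth[of k \<omega>] by simp
  then show ?thesis using True by simp
qed (simp add: \<theta>_def)

lemma \<theta>_bound: "norm (\<theta> k \<omega>) \<le> 1 + L"
proof (cases "emax k \<omega> = 0")
  case False
  then have pos: "0 < emax k \<omega>" using emax_nonneg[of k \<omega>] by linarith
  have "norm (a k \<omega>) \<le> (1 + h * L) * norm (e k \<omega>)" by (rule growth)
  also have "\<dots> \<le> (1 + 1 * L) * emax k \<omega>"
    using h L_nonneg emax_ge[of k k \<omega>] by (intro mult_mono add_left_mono mult_right_mono) auto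
  finally show ?thesis using pos by (simp add: \<theta>_def divide_le_eq)
qed (use L_nonneg in \<open>simp add: \<theta>_def\<close>)

lemma e_F: "k \<le> n \<Longrightarrow> e k \<in> borel_measurable (F (grid k))"
  unfolding e_def[abs_def] by (intro borel_measurable_diff X_adapted scheme_F grid_in)

lemma e_F_mono: "j \<le> k \<Longrightarrow> k \<le> n \<Longrightarrow> e j \<in> borel_measurable (F (grid k))"
  by (rule F_measurable_mono[OF e_F]) (auto intro: grid_nonneg grid_mono)

lemma e_M: "k \<le> n \<Longrightarrow> e k \<in> borel_measurable M"
  by (rule F_M[OF _ e_F]) (auto intro: grid_nonneg)

lemma \<theta>_F: 
  assumes k: "k \<le> n" 
  shows "\<theta> k \<in> borel_measurable (F (grid k))"
proof -
  have E: "emax k \<in> borel_measurable (F (grid k))"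
    unfolding emax_def[abs_def]
    by (intro borel_measurable_Max_atMost measurable_compose[OF e_F_mono borel_measurable_norm] k)
  have [measurable]: "X (grid k) \<in> borel_measurable (F (grid k))" "scheme k \<in> borel_measurable (F (grid k))"
    using k by (auto intro: X_adapted grid_in scheme_F)
  have "a k \<in> borel_measurable (F (grid k))"
    unfolding a_def[abs_def] bvec_def
    by (intro borel_measurable_add e_F k borel_measurable_scaleR borel_measurable_diff borel_measurable_vec_lambda
        borel_measurable_const) measurable
  with E show ?thesis unfolding \<theta>_def[abs_def] 
    by (intro borel_measurable_scaleR borel_measurable_divide borel_measurable_const)
qed

lemma mart_vec_M: "k < n \<Longrightarrow> mart_vec k \<in> borel_measurable M"
  unfolding mart_vec_def[abs_def]
  using F_M[OF _ mart_step_F[OF grid_steps]] grid_nonneg[of "Suc k"]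
  by (intro borel_measurable_vec_lambda) (auto simp: grid_Suc)

lemma rem_vec_M: "k < n \<Longrightarrow> rem_vec k \<in> borel_measurable M"
  unfolding rem_vec_def[abs_def] by (intro borel_measurable_vec_lambda rem_step_M grid_steps)

lemma step: "AE \<omega> in M. \<forall>k<n. norm (e (Suc k) \<omega>) \<le> norm (a k \<omega> + mart_vec k \<omega> + rem_vec k \<omega>)"
  using step_expansion AE_space
proof eventually_elim
  fix \<omega> assume ex: "\<forall>h s i. (h, s, s) \<in> steps \<longrightarrow>
    X (s + h) \<omega> $ i - h * interaction \<gamma> (X (s + h) \<omega>) i
      = X s \<omega> $ i + h * b i (X s \<omega>) + noise s (s + h) \<omega> i + mart_step i h s \<omega> + rem_step i h s \<omega>"
    and om: "\<omega> \<in> space M"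
  show "\<forall>k<n. norm (e (Suc k) \<omega>) \<le> norm (a k \<omega> + mart_vec k \<omega> + rem_vec k \<omega>)"
  proof (intro allI impI)
    fix k assume k: "k < n"
    let ?y = "X (grid (Suc k)) \<omega>"
    let ?z = "scheme k \<omega> + h *\<^sub>R bvec (scheme k \<omega>) + (\<chi> i. noise (grid k) (grid (Suc k)) \<omega> i)"
    have "?y - h *\<^sub>R interaction_vec \<gamma> ?y = X (grid k) \<omega> + h *\<^sub>R bvec (X (grid k) \<omega>)
        + (\<chi> i. noise (grid k) (grid (Suc k)) \<omega> i) + mart_vec k \<omega> + rem_vec k \<omega>"
      using ex[rule_format, OF grid_steps[OF k]]
      by (simp add: vec_eq_iff interaction_vec_def bvec_def mart_vec_def rem_vec_def grid_Suc)
    then have "(?y - h *\<^sub>R interaction_vec \<gamma> ?y) - ?z = a k \<omega> + mart_vec k \<omega> + rem_vec k \<omega>"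
      by (simp add: a_def e_def algebra_simps)
    moreover have "?y \<in> Delta" using X_Delta[OF om grid_in[of "Suc k"]] k by simp
    ultimately show "norm (e (Suc k) \<omega>) \<le> norm (a k \<omega> + mart_vec k \<omega> + rem_vec k \<omega>)"
      using resolvent_stable[OF h(1), of ?y ?z] by (simp add: e_def scheme_Suc)
  qed
qed

definition Nmax :: "'a \<Rightarrow> real" where "Nmax \<omega> = (MAX k\<in>{..n}. \<bar>\<Sum>j<k. \<theta> j \<omega> \<bullet> mart_vec j \<omega>\<bar>)"

lemma pathwise_bound: "AE \<omega> in M. (emax n \<omega>)\<^sup>2 \<le> 32 * (1 + L)\<^sup>2 * exp (2 * T * L * (2 + L))
    * ((\<Sum>j<n. norm (rem_vec j \<omega>))\<^sup>2 + (\<Sum>j<n. (norm (mart_vec j \<omega>))\<^sup>2) + (Nmax \<omega>)\<^sup>2)"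
  using step
proof eventually_elim
  fix \<omega> assume st: "\<forall>k<n. norm (e (Suc k) \<omega>) \<le> norm (a k \<omega> + mart_vec k \<omega> + rem_vec k \<omega>)"
  have "(MAX i\<in>{..n}. norm (e i \<omega>))\<^sup>2 \<le> 32 * (1 + L)\<^sup>2 * exp (real n * (2 * (h * L) * (2 + L)))
    * ((\<Sum>j<n. norm (rem_vec j \<omega>))\<^sup>2 + (\<Sum>j<n. (norm (mart_vec j \<omega>))\<^sup>2) + (Nmax \<omega>)\<^sup>2)"
  proof (rule pathwise_stability[where e = "\<lambda>k. e k \<omega>" and a = "\<lambda>k. a k \<omega>" and m = "\<lambda>k. mart_vec k \<omega>"
        and r = "\<lambda>k. rem_vec k \<omega>" and \<theta> = "\<lambda>k. \<theta> k \<omega>"])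
    show "e 0 \<omega> = 0" by (simp add: e_def grid_0 scheme_0)
    show "h * L \<le> L" using h L_nonneg by (simp add: mult_left_le_one_le)
    show "a k \<omega> = (MAX i\<in>{..k}. norm (e i \<omega>)) *\<^sub>R \<theta> k \<omega>" for k
      using a_eq by (simp add: emax_def)
    show "\<bar>\<Sum>j<k. \<theta> j \<omega> \<bullet> mart_vec j \<omega>\<bar> \<le> Nmax \<omega>" if "k \<le> n" for k
      unfolding Nmax_def using that by (intro Max_ge) auto
  qed (use st growth h L_nonneg in auto)
  moreover have "real n * (2 * (h * L) * (2 + L)) = 2 * T * L * (2 + L)"
  proof -
    have "real n * (2 * (h * L) * (2 + L)) = 2 * (real n * h) * L * (2 + L)" by (simp add: ac_simps)
    then show ?thesis by (simp only: h(3))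
  qed
  ultimately show "(emax n \<omega>)\<^sup>2 \<le> 32 * (1 + L)\<^sup>2 * exp (2 * T * L * (2 + L))
    * ((\<Sum>j<n. norm (rem_vec j \<omega>))\<^sup>2 + (\<Sum>j<n. (norm (mart_vec j \<omega>))\<^sup>2) + (Nmax \<omega>)\<^sup>2)"
    by (simp add: emax_def)
qed

context
  fixes Km Kr :: real
  assumes Km: "0 \<le> Km" "\<And>h s. (h, s, s) \<in> steps \<Longrightarrow>
      (\<integral>\<^sup>+ \<omega>. ennreal ((\<Sum>i\<in>UNIV. \<bar>mart_step i h s \<omega>\<bar>) powr p) \<partial>M) \<le> ennreal (h powr (3 / 2 * p) * Km)"
    and Kr: "0 \<le> Kr" "\<And>h s. (h, s, s) \<in> steps \<Longrightarrow>
      (\<integral>\<^sup>+ \<omega>. ennreal ((\<Sum>i\<in>UNIV. \<bar>rem_step i h s \<omega>\<bar>) powr p) \<partial>M) \<le> ennreal (h powr (2 * p) * Kr)"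
begin

lemma mart_vec_moment: "k < n \<Longrightarrow> (\<integral>\<^sup>+ \<omega>. ennreal (norm (mart_vec k \<omega>) powr p) \<partial>M) \<le> ennreal (h powr (3 / 2 * p) * Km)"
proof (rule order_trans[OF nn_integral_mono Km(2)[OF grid_steps]])
  fix \<omega>
  have "norm (mart_vec k \<omega>) \<le> (\<Sum>i\<in>UNIV. \<bar>mart_step i h (grid k) \<omega>\<bar>)"
    using norm_le_l1_cart[of "mart_vec k \<omega>"] by (simp add: mart_vec_def)
  then show "ennreal (norm (mart_vec k \<omega>) powr p) \<le> ennreal ((\<Sum>i\<in>UNIV. \<bar>mart_step i h (grid k) \<omega>\<bar>) powr p)"
    using p by (intro ennreal_leI powr_mono2) auto
qed

lemma rem_vec_moment: "k < n \<Longrightarrow> (\<integral>\<^sup>+ \<omega>. ennreal (norm (rem_vec k \<omega>) powr p) \<partial>M) \<le> ennreal (h powr (2 * p) * Kr)"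
proof (rule order_trans[OF nn_integral_mono Kr(2)[OF grid_steps]])
  fix \<omega>
  have "norm (rem_vec k \<omega>) \<le> (\<Sum>i\<in>UNIV. \<bar>rem_step i h (grid k) \<omega>\<bar>)"
    using norm_le_l1_cart[of "rem_vec k \<omega>"] by (simp add: rem_vec_def)
  then show "ennreal (norm (rem_vec k \<omega>) powr p) \<le> ennreal ((\<Sum>i\<in>UNIV. \<bar>rem_step i h (grid k) \<omega>\<bar>) powr p)"
    using p by (intro ennreal_leI powr_mono2) auto
qed

text \<open>Since \<open>\<theta>\<close> is known at the beginning of the step and bounded, pairing it with the centered
part of the local error preserves both the conditional mean 0 and the order of the moments.\<close>

lemma martingale: "martingale_differences M (\<lambda>k. F (grid k)) (\<lambda>k \<omega>. \<theta> k \<omega> \<bullet> mart_vec k \<omega>) n p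
    ((1 + L) powr p * (h powr (3 / 2 * p) * Km))"
proof unfold_locales
  show "0 \<le> (1 + L) powr p * (h powr (3 / 2 * p) * Km)" using Km by simp
  show "subalgebra M (F (grid k))" for k by (rule subalg[OF grid_nonneg])
  show "sets (F (grid j)) \<subseteq> sets (F (grid k))" if "j \<le> k" for j k
    by (rule F_mono[OF grid_nonneg grid_mono[OF that]])
  fix k assume k: "k < n"
  have mart_vec_F: "mart_vec k \<in> borel_measurable (F (grid (Suc k)))"
    unfolding mart_vec_def[abs_def] grid_Suc by (intro borel_measurable_vec_lambda mart_step_F grid_steps k)
  have \<theta>F: "\<theta> k \<in> borel_measurable (F (grid (Suc k)))"
    using k by (intro F_measurable_mono[OF \<theta>_F grid_nonneg grid_mono]) auto
  show ad: "(\<lambda>\<omega>. \<theta> k \<omega> \<bullet> mart_vec k \<omega>) \<in> borel_measurable (F (grid (Suc k)))"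
    by (intro borel_measurable_inner \<theta>F mart_vec_F)
  have meas: "(\<lambda>\<omega>. \<theta> k \<omega> \<bullet> mart_vec k \<omega>) \<in> borel_measurable M" by (rule F_M[OF grid_nonneg ad])
  note [measurable] = mart_vec_M[OF k]
  show mom: "(\<integral>\<^sup>+ \<omega>. ennreal (\<bar>\<theta> k \<omega> \<bullet> mart_vec k \<omega>\<bar> powr p) \<partial>M) \<le> ennreal ((1 + L) powr p * (h powr (3 / 2 * p) * Km))"
  proof -
    have "(\<integral>\<^sup>+ \<omega>. ennreal (\<bar>\<theta> k \<omega> \<bullet> mart_vec k \<omega>\<bar> powr p) \<partial>M)
        \<le> (\<integral>\<^sup>+ \<omega>. ennreal ((1 + L) powr p) * ennreal (norm (mart_vec k \<omega>) powr p) \<partial>M)"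
    proof (rule nn_integral_mono)
      fix \<omega>
      have "\<bar>\<theta> k \<omega> \<bullet> mart_vec k \<omega>\<bar> \<le> norm (\<theta> k \<omega>) * norm (mart_vec k \<omega>)" by (rule Cauchy_Schwarz_ineq2)
      also have "\<dots> \<le> (1 + L) * norm (mart_vec k \<omega>)" by (intro mult_right_mono \<theta>_bound) auto
      finally have "\<bar>\<theta> k \<omega> \<bullet> mart_vec k \<omega>\<bar> powr p \<le> ((1 + L) * norm (mart_vec k \<omega>)) powr p"
        using p by (intro powr_mono2) auto
      then show "ennreal (\<bar>\<theta> k \<omega> \<bullet> mart_vec k \<omega>\<bar> powr p) \<le> ennreal ((1 + L) powr p) * ennreal (norm (mart_vec k \<omega>) powr p)"
        using L_nonneg by (simp add: ennreal_mult[symmetric] powr_mult ennreal_leI)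
    qed
    also have "\<dots> = ennreal ((1 + L) powr p) * (\<integral>\<^sup>+ \<omega>. ennreal (norm (mart_vec k \<omega>) powr p) \<partial>M)"
      by (intro nn_integral_cmult) measurable
    also have "\<dots> \<le> ennreal ((1 + L) powr p) * ennreal (h powr (3 / 2 * p) * Km)"
      by (intro mult_left_mono mart_vec_moment k) auto
    finally show ?thesis using Km by (simp add: ennreal_mult)
  qed
  interpret sub: finite_measure_subalgebra M "F (grid k)"
    by standard (rule subalg[OF grid_nonneg])
  show "AE \<omega> in M. real_cond_exp M (F (grid k)) (\<lambda>\<omega>. \<theta> k \<omega> \<bullet> mart_vec k \<omega>) \<omega> = 0"
  proof (rule sub.real_cond_exp_charact)
    fix A assume A: "A \<in> sets (F (grid k))"
    have 1: "integrable M (\<lambda>\<omega>. (indicator A \<omega> * \<theta> k \<omega> $ i) * mart_step i h (grid k) \<omega>)"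
      "(\<integral>\<omega>. (indicator A \<omega> * \<theta> k \<omega> $ i) * mart_step i h (grid k) \<omega> \<partial>M) = 0" for i
    proof -
      have H: "(\<lambda>\<omega>. indicator A \<omega> * \<theta> k \<omega> $ i) \<in> borel_measurable (F (grid k))"
        using A k \<theta>_F[of k] by (intro borel_measurable_times borel_measurable_vec_component) auto
      have Hb: "\<bar>indicator A \<omega> * \<theta> k \<omega> $ i\<bar> \<le> 1 + L" for \<omega>
        using order_trans[OF component_le_norm_cart \<theta>_bound, of k \<omega> i] L_nonneg by (auto split: split_indicator)
      show "integrable M (\<lambda>\<omega>. (indicator A \<omega> * \<theta> k \<omega> $ i) * mart_step i h (grid k) \<omega>)"
        "(\<integral>\<omega>. (indicator A \<omega> * \<theta> k \<omega> $ i) * mart_step i h (grid k) \<omega> \<partial>M) = 0"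
        using mart_step_centered[OF grid_steps[OF k] H Hb] by auto
    qed
    have "(\<integral>\<omega>\<in>A. (\<theta> k \<omega> \<bullet> mart_vec k \<omega>) \<partial>M) = (\<integral>\<omega>. (\<Sum>i\<in>UNIV. (indicator A \<omega> * \<theta> k \<omega> $ i) * mart_step i h (grid k) \<omega>) \<partial>M)"
      unfolding set_lebesgue_integral_def inner_vec_def mart_vec_def
      by (intro Bochner_Integration.integral_cong) (auto simp: sum_distrib_left mult.assoc)
    also have "\<dots> = (\<Sum>i\<in>UNIV. (\<integral>\<omega>. (indicator A \<omega> * \<theta> k \<omega> $ i) * mart_step i h (grid k) \<omega> \<partial>M))"
      by (rule Bochner_Integration.integral_sum[OF 1(1)])
    also have "\<dots> = 0" unfolding 1(2) by simp
    finally show "(\<integral>\<omega>\<in>A. (\<theta> k \<omega> \<bullet> mart_vec k \<omega>) \<partial>M) = (\<integral>\<omega>\<in>A. 0 \<partial>M)" by simp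
  next
    have "bounded_Lp M p {k} (\<lambda>k \<omega>. \<theta> k \<omega> \<bullet> mart_vec k \<omega>)"
      using mom meas Km L_nonneg by (intro bounded_LpI[where K = "(1 + L) powr p * (h powr (3 / 2 * p) * Km)"]) auto
    then show "integrable M (\<lambda>\<omega>. \<theta> k \<omega> \<bullet> mart_vec k \<omega>)"
      using p bounded_Lp_integrable[of p "{k}" "\<lambda>k \<omega>. \<theta> k \<omega> \<bullet> mart_vec k \<omega>" k] by simp
  qed auto
qed (use n p in auto)

lemma Nmax_moment:
  "(\<integral>\<^sup>+ \<omega>. ennreal (Nmax \<omega> powr p) \<partial>M)
    \<le> ennreal (h powr p * (4 powr p * (2 * p\<^sup>2 * 3 powr p) * exp (2 * p\<^sup>2 * 3 powr p) * (T powr (p / 2) * ((1 + L) powr p * Km))))"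
proof -
  interpret md: martingale_differences M "\<lambda>k. F (grid k)" "\<lambda>k \<omega>. \<theta> k \<omega> \<bullet> mart_vec k \<omega>" n p
    "(1 + L) powr p * (h powr (3 / 2 * p) * Km)" by (rule martingale)
  have e: "real n powr (p / 2) * h powr (3 / 2 * p) = h powr p * T powr (p / 2)"
    by (rule scaling)
  have "4 powr p * (2 * p\<^sup>2 * 3 powr p) * exp (2 * p\<^sup>2 * 3 powr p) * real n powr (p / 2)
      * ((1 + L) powr p * (h powr (3 / 2 * p) * Km))
    = (real n powr (p / 2) * h powr (3 / 2 * p)) * (4 powr p * (2 * p\<^sup>2 * 3 powr p) * exp (2 * p\<^sup>2 * 3 powr p) * ((1 + L) powr p * Km))"
    by (simp only: ac_simps)
  then show ?thesis using md.maximal_moment unfolding e Nmax_def by (simp only: ac_simps)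
qed

lemma mart_vec_sq_sum_moment:
  "(\<integral>\<^sup>+ \<omega>. ennreal ((\<Sum>j<n. (norm (mart_vec j \<omega>))\<^sup>2) powr (p / 2)) \<partial>M) \<le> ennreal (h powr p * (T powr (p / 2) * Km))"
proof -
  have sq: "\<bar>(norm v)\<^sup>2\<bar> powr (p / 2) = norm v powr p" for v :: "(real, 'n) vec"
    by (simp add: power2_powr_half)
  have "(\<integral>\<^sup>+ \<omega>. ennreal (\<bar>\<Sum>j<n. (norm (mart_vec j \<omega>))\<^sup>2\<bar> powr (p / 2)) \<partial>M)
      \<le> ennreal (real (card {..<n}) powr (p / 2 - 1) * (\<Sum>j<n. h powr (3 / 2 * p) * Km))"
    using p Km mart_vec_moment mart_vec_M unfolding sq[symmetric]
    by (intro nn_integral_abs_sum_powr_le) auto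
  also have "real (card {..<n}) powr (p / 2 - 1) * (\<Sum>j<n. h powr (3 / 2 * p) * Km) = (real n powr (p / 2) * h powr (3 / 2 * p)) * Km"
    using n by (simp add: powr_diff)
  also have "\<dots> = h powr p * (T powr (p / 2) * Km)" unfolding scaling by (simp only: ac_simps)
  finally show ?thesis by (simp add: sum_nonneg)
qed

lemma rem_vec_sum_moment:
  "(\<integral>\<^sup>+ \<omega>. ennreal ((\<Sum>j<n. norm (rem_vec j \<omega>)) powr p) \<partial>M) \<le> ennreal (h powr p * (T powr p * Kr))"
proof -
  have "(\<integral>\<^sup>+ \<omega>. ennreal (\<bar>\<Sum>j<n. norm (rem_vec j \<omega>)\<bar> powr p) \<partial>M)
      \<le> ennreal (real (card {..<n}) powr (p - 1) * (\<Sum>j<n. h powr (2 * p) * Kr))"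
    using p Kr rem_vec_moment measurable_compose[OF rem_vec_M borel_measurable_norm]
    by (intro nn_integral_abs_sum_powr_le) auto
  also have "real (card {..<n}) powr (p - 1) * (\<Sum>j<n. h powr (2 * p) * Kr) = real n powr p * (h powr p * h powr p) * Kr"
    using n by (simp add: powr_diff powr_add[symmetric])
  also have "\<dots> = h powr p * ((real n * h) powr p * Kr)" by (simp only: powr_mult ac_simps)
  finally show ?thesis unfolding h(3) by (simp add: sum_nonneg)
qed

lemma emax_moment:
  "(\<integral>\<^sup>+ \<omega>. ennreal (emax n \<omega> powr p) \<partial>M) \<le> ennreal (h powr p *
    ((3 * (32 * (1 + L)\<^sup>2 * exp (2 * T * L * (2 + L)))) powr (p / 2) * (T powr p * Kr + T powr (p / 2) * Km
      + 4 powr p * (2 * p\<^sup>2 * 3 powr p) * exp (2 * p\<^sup>2 * 3 powr p) * (T powr (p / 2) * ((1 + L) powr p * Km)))))"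
proof -
  define C where "C = 32 * (1 + L)\<^sup>2 * exp (2 * T * L * (2 + L))"
  define KN where "KN = 4 powr p * (2 * p\<^sup>2 * 3 powr p) * exp (2 * p\<^sup>2 * 3 powr p) * (T powr (p / 2) * ((1 + L) powr p * Km))"
  define A where "A \<omega> = (\<Sum>j<n. norm (rem_vec j \<omega>))" for \<omega>
  define Q where "Q \<omega> = (\<Sum>j<n. (norm (mart_vec j \<omega>))\<^sup>2)" for \<omega>
  have C: "0 \<le> C" by (simp add: C_def)
  have KN: "0 \<le> KN" using Km(1) by (simp add: KN_def)
  have AQ: "0 \<le> A \<omega>" "0 \<le> Q \<omega>" for \<omega> unfolding A_def Q_def by (auto intro!: sum_nonneg)
  have N0: "0 \<le> Nmax \<omega>" for \<omega>
  proof -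
    have "\<bar>\<Sum>j<0. \<theta> j \<omega> \<bullet> mart_vec j \<omega>\<bar> \<le> Nmax \<omega>"
      unfolding Nmax_def by (intro Max_ge finite_imageI imageI[where f = "\<lambda>k. \<bar>\<Sum>j<k. \<theta> j \<omega> \<bullet> mart_vec j \<omega>\<bar>"]) auto
    then show ?thesis by simp
  qed
  have [measurable]: "A \<in> borel_measurable M" "Q \<in> borel_measurable M" "Nmax \<in> borel_measurable M"
  proof -
    show "A \<in> borel_measurable M" unfolding A_def[abs_def]
      using measurable_compose[OF rem_vec_M borel_measurable_norm] by (intro borel_measurable_sum) auto
    show "Q \<in> borel_measurable M" unfolding Q_def[abs_def]
      using measurable_compose[OF mart_vec_M borel_measurable_norm] by (intro borel_measurable_sum borel_measurable_power) auto
    have \<theta>M: "\<theta> k \<in> borel_measurable M" if "k < n" for k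
      using that by (intro F_M[OF grid_nonneg \<theta>_F]) auto
    show "Nmax \<in> borel_measurable M" unfolding Nmax_def[abs_def]
      using \<theta>M mart_vec_M by (intro borel_measurable_Max_atMost borel_measurable_abs borel_measurable_sum borel_measurable_inner) auto
  qed
  have "(\<integral>\<^sup>+ \<omega>. ennreal (emax n \<omega> powr p) \<partial>M)
      \<le> (\<integral>\<^sup>+ \<omega>. ennreal ((3 * C) powr (p / 2)) * (ennreal (A \<omega> powr p) + ennreal (Q \<omega> powr (p / 2)) + ennreal (Nmax \<omega> powr p)) \<partial>M)"
    using pathwise_bound
  proof (intro nn_integral_mono_AE, eventually_elim)
    fix \<omega> assume "(emax n \<omega>)\<^sup>2 \<le> 32 * (1 + L)\<^sup>2 * exp (2 * T * L * (2 + L))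
      * ((\<Sum>j<n. norm (rem_vec j \<omega>))\<^sup>2 + (\<Sum>j<n. (norm (mart_vec j \<omega>))\<^sup>2) + (Nmax \<omega>)\<^sup>2)"
    then have le: "(emax n \<omega>)\<^sup>2 \<le> C * ((A \<omega>)\<^sup>2 + Q \<omega> + (Nmax \<omega>)\<^sup>2)" by (simp add: C_def A_def Q_def)
    define m where "m = max ((A \<omega>)\<^sup>2) (max (Q \<omega>) ((Nmax \<omega>)\<^sup>2))"
    have m0: "0 \<le> m" using AQ(2)[of \<omega>] by (simp add: m_def le_max_iff_disj)
    have "C * ((A \<omega>)\<^sup>2 + Q \<omega> + (Nmax \<omega>)\<^sup>2) \<le> C * (3 * m)"
      using C by (intro mult_left_mono) (auto simp: m_def)
    then have "(emax n \<omega>)\<^sup>2 \<le> 3 * C * m" using le by simp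
    then have "((emax n \<omega>)\<^sup>2) powr (p / 2) \<le> (3 * C * m) powr (p / 2)" using p by (intro powr_mono2) auto
    then have "emax n \<omega> powr p \<le> (3 * C) powr (p / 2) * m powr (p / 2)"
      using C m0 emax_nonneg by (simp add: power2_powr_half powr_mult)
    also have "m powr (p / 2) \<le> A \<omega> powr p + Q \<omega> powr (p / 2) + Nmax \<omega> powr p"
      using power2_powr_half[OF AQ(1)[of \<omega>], of p] power2_powr_half[OF N0[of \<omega>], of p] by (auto simp: m_def max_def)
    finally have "emax n \<omega> powr p \<le> (3 * C) powr (p / 2) * (A \<omega> powr p + Q \<omega> powr (p / 2) + Nmax \<omega> powr p)"
      by (simp add: mult_left_mono)
    then show "ennreal (emax n \<omega> powr p) \<le> ennreal ((3 * C) powr (p / 2)) * (ennreal (A \<omega> powr p) + ennreal (Q \<omega> powr (p / 2)) + ennreal (Nmax \<omega> powr p))"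
      by (simp add: ennreal_plus[symmetric] ennreal_mult[symmetric] ennreal_leI del: ennreal_plus)
  qed
  also have "\<dots> = ennreal ((3 * C) powr (p / 2)) * ((\<integral>\<^sup>+ \<omega>. ennreal (A \<omega> powr p) \<partial>M)
      + (\<integral>\<^sup>+ \<omega>. ennreal (Q \<omega> powr (p / 2)) \<partial>M) + (\<integral>\<^sup>+ \<omega>. ennreal (Nmax \<omega> powr p) \<partial>M))"
    by (subst nn_integral_cmult, measurable, subst nn_integral_add, measurable, subst nn_integral_add, measurable)
  also have "\<dots> \<le> ennreal ((3 * C) powr (p / 2)) * (ennreal (h powr p * (T powr p * Kr))
      + ennreal (h powr p * (T powr (p / 2) * Km)) + ennreal (h powr p * KN))"
    using rem_vec_sum_moment mart_vec_sq_sum_moment Nmax_moment unfolding A_def Q_def KN_def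
    by (intro mult_left_mono add_mono) auto
  also have "\<dots> = ennreal (h powr p * ((3 * C) powr (p / 2) * (T powr p * Kr + T powr (p / 2) * Km + KN)))"
    using Km(1) Kr(1) KN by (simp add: ennreal_plus[symmetric] ennreal_mult[symmetric] algebra_simps del: ennreal_plus)
  finally show ?thesis unfolding C_def KN_def .
qed

end

end

context particle_system
begin

theorem error_bound:
  "\<exists>C\<ge>0. \<forall>n::nat. 1 \<le> n \<longrightarrow> T / real n \<le> 1 \<longrightarrow>
    (\<integral>\<^sup>+ \<omega>. ennreal ((MAX k\<in>{..n}. norm (X (real k * T / real n) \<omega>
        - semi_implicit_EM \<gamma> b (\<lambda>i j x. \<sigma> i j) W T (X 0) n k \<omega>)) powr p) \<partial>M)
      \<le> ennreal ((T / real n) powr p * C)"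
proof -
  obtain Km where Km: "0 \<le> Km" "\<And>h s. (h, s, s) \<in> steps \<Longrightarrow>
      (\<integral>\<^sup>+ \<omega>. ennreal ((\<Sum>i\<in>UNIV. \<bar>mart_step i h s \<omega>\<bar>) powr p) \<partial>M) \<le> ennreal (h powr (3 / 2 * p) * Km)"
  proof -
    have "mart_step i h s \<in> borel_measurable M" if "(h, s, s) \<in> steps" for i h s
      using F_M[OF _ mart_step_F[OF that]] stepsD(1,3)[OF that] by simp
    from step_sum_moment[where G = mart_step, OF this powr_ge_zero mart_step_moment] show ?thesis
      using that by blast
  qed
  obtain Kr where Kr: "0 \<le> Kr" "\<And>h s. (h, s, s) \<in> steps \<Longrightarrow>
      (\<integral>\<^sup>+ \<omega>. ennreal ((\<Sum>i\<in>UNIV. \<bar>rem_step i h s \<omega>\<bar>) powr p) \<partial>M) \<le> ennreal (h powr (2 * p) * Kr)"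
    using step_sum_moment[where G = rem_step, OF rem_step_M powr_ge_zero rem_step_moment] by blast
  define L where "L = real CARD('n) * B"
  define C where "C = (3 * (32 * (1 + L)\<^sup>2 * exp (2 * T * L * (2 + L)))) powr (p / 2) * (T powr p * Kr + T powr (p / 2) * Km
      + 4 powr p * (2 * p\<^sup>2 * 3 powr p) * exp (2 * p\<^sup>2 * 3 powr p) * (T powr (p / 2) * ((1 + L) powr p * Km)))"
  show ?thesis
  proof (intro exI[of _ C] conjI allI impI)
    show "0 \<le> C" unfolding C_def using Km(1) Kr(1) by simp
    fix n :: nat assume n: "1 \<le> n" "T / real n \<le> 1"
    interpret se: scheme_error M \<gamma> F W X \<sigma> b b' T p B n
      by unfold_locales (use n in auto)
    show "(\<integral>\<^sup>+ \<omega>. ennreal ((MAX k\<in>{..n}. norm (X (real k * T / real n) \<omega>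
        - semi_implicit_EM \<gamma> b (\<lambda>i j x. \<sigma> i j) W T (X 0) n k \<omega>)) powr p) \<partial>M)
      \<le> ennreal ((T / real n) powr p * C)"
      using se.emax_moment[OF Km Kr]
      unfolding se.emax_def se.e_def se.grid_def se.scheme_def se.h_def se.L_def C_def L_def .
  qed
qed

end

section \<open>From the hypotheses on the equation to the particle system\<close>

text \<open>The bounded Hessian makes the gradient Lipschitz. The mean value inequality for \<open>f\<close> minus its
linear part at \<open>x\<close>, on a ball around \<open>x\<close>, then gives the quadratic remainder.\<close>

lemma Cb2_expansion:
  fixes f :: "real ^ 'n::finite \<Rightarrow> real"
  assumes "Cb2 f"
  obtains B g where "0 \<le> B" "\<And>x. \<bar>f x\<bar> \<le> B" "\<And>x. norm (g x) \<le> B" "continuous_on UNIV g"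
    "\<And>x y. \<bar>f x - f y\<bar> \<le> B * norm (x - y)"
    "\<And>x y. \<bar>f y - f x - g x \<bullet> (y - x)\<bar> \<le> B * (norm (y - x))\<^sup>2"
proof -
  obtain g :: "real ^ 'n \<Rightarrow> real ^ 'n" and H :: "real ^ 'n \<Rightarrow> real ^ 'n ^ 'n" where
    f': "\<And>x. (f has_derivative (\<lambda>h. g x \<bullet> h)) (at x)" and
    g': "\<And>x. (g has_derivative (\<lambda>h. H x *v h)) (at x)" and
    bd: "bounded (range f)" "bounded (range g)" "bounded (range H)"
    using assms unfolding Cb2_def by blast
  obtain Bf where Bf: "\<And>x. \<bar>f x\<bar> \<le> Bf" using bd(1) unfolding bounded_iff by auto
  obtain Bg where Bg: "\<And>x. norm (g x) \<le> Bg" using bd(2) unfolding bounded_iff by auto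
  obtain BH where BH: "\<And>x. norm (H x) \<le> BH" using bd(3) unfolding bounded_iff by auto
  have nn: "0 \<le> Bf" "0 \<le> Bg" "0 \<le> BH"
    using Bf[of 0] order_trans[OF norm_ge_zero Bg[of 0]] order_trans[OF norm_ge_zero BH[of 0]] by auto
  have lip_g: "norm (g x - g y) \<le> (real CARD('n) * BH) * norm (x - y)" for x y
  proof (rule differentiable_bound[of UNIV])
    show "(g has_derivative (\<lambda>h. H x *v h)) (at x within UNIV)" for x using g'[of x] by simp
    show "onorm (\<lambda>h. H x *v h) \<le> real CARD('n) * BH" for x
    proof (rule onorm_le)
      fix h
      have "norm (H x *v h) \<le> (\<Sum>i\<in>UNIV. \<bar>(H x *v h) $ i\<bar>)" by (rule norm_le_l1_cart)
      also have "\<dots> \<le> (\<Sum>i\<in>(UNIV::'n set). BH * norm h)"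
      proof (rule sum_mono)
        fix i
        have "\<bar>(H x *v h) $ i\<bar> = \<bar>H x $ i \<bullet> h\<bar>"
          by (simp add: matrix_vector_mult_def inner_vec_def)
        also have "\<dots> \<le> norm (H x $ i) * norm h" by (rule Cauchy_Schwarz_ineq2)
        also have "\<dots> \<le> BH * norm h"
          using Finite_Cartesian_Product.norm_nth_le[of "H x" i] BH[of x] by (intro mult_right_mono) auto
        finally show "\<bar>(H x *v h) $ i\<bar> \<le> BH * norm h" .
      qed
      finally show "norm (H x *v h) \<le> real CARD('n) * BH * norm h" by simp
    qed
  qed auto
  have on: "onorm (\<lambda>h. v \<bullet> h) \<le> norm v" for v :: "real ^ 'n"
    by (rule onorm_le) (simp add: Cauchy_Schwarz_ineq2)
  have lip_f: "norm (f x - f y) \<le> Bg * norm (x - y)" for x y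
  proof (rule differentiable_bound[of UNIV])
    show "(f has_derivative (\<lambda>h. g x \<bullet> h)) (at x within UNIV)" for x using f'[of x] by simp
    show "onorm (\<lambda>h. g x \<bullet> h) \<le> Bg" for x using on[of "g x"] Bg[of x] by linarith
  qed auto
  have taylor: "\<bar>f y - f x - g x \<bullet> (y - x)\<bar> \<le> (real CARD('n) * BH) * (norm (y - x))\<^sup>2" for x y
  proof -
    let ?S = "cball x (norm (y - x))"
    have "norm ((f y - g x \<bullet> y) - (f x - g x \<bullet> x)) \<le> ((real CARD('n) * BH) * norm (y - x)) * norm (y - x)"
    proof (rule differentiable_bound[of ?S])
      fix z assume z: "z \<in> ?S"
      have "((\<lambda>z. f z - g x \<bullet> z) has_derivative (\<lambda>h. g z \<bullet> h - g x \<bullet> h)) (at z within ?S)"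
        by (intro has_derivative_diff has_derivative_at_withinI[OF f'] derivative_intros)
      then show "((\<lambda>z. f z - g x \<bullet> z) has_derivative (\<lambda>h. (g z - g x) \<bullet> h)) (at z within ?S)"
        by (simp add: inner_diff_left)
      have "onorm (\<lambda>h. (g z - g x) \<bullet> h) \<le> norm (g z - g x)" by (rule on)
      also have "\<dots> \<le> (real CARD('n) * BH) * norm (z - x)" by (rule lip_g)
      also have "\<dots> \<le> (real CARD('n) * BH) * norm (y - x)"
        using z nn by (intro mult_left_mono) (auto simp: dist_norm norm_minus_commute)
      finally show "onorm (\<lambda>h. (g z - g x) \<bullet> h) \<le> (real CARD('n) * BH) * norm (y - x)" .
    qed (auto simp: dist_norm norm_minus_commute)
    then show ?thesis by (simp add: inner_diff_right power2_eq_square algebra_simps)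
  qed
  define B where "B = Bf + Bg + real CARD('n) * BH"
  have B: "Bf \<le> B" "Bg \<le> B" "real CARD('n) * BH \<le> B" "0 \<le> B" using nn by (auto simp: B_def)
  show ?thesis
  proof (rule that[of B g])
    show "\<bar>f x\<bar> \<le> B" "norm (g x) \<le> B" for x using Bf[of x] Bg[of x] B by linarith+
    show "continuous_on UNIV g"
      using g' by (meson continuous_at_imp_continuous_on has_derivative_continuous)
    show "\<bar>f x - f y\<bar> \<le> B * norm (x - y)" for x y
      using lip_f[of x y] mult_right_mono[OF B(2), of "norm (x - y)"] by simp
    show "\<bar>f y - f x - g x \<bullet> (y - x)\<bar> \<le> B * (norm (y - x))\<^sup>2" for x y
      using taylor[of y x] mult_right_mono[OF B(3) zero_le_power2[of "norm (y - x)"]] by linarith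
  qed (use B in auto)
qed

lemma usual_filtrationD:
  assumes "usual_filtration M F"
  shows "0 \<le> t \<Longrightarrow> subalgebra M (F t)" "0 \<le> s \<Longrightarrow> s \<le> t \<Longrightarrow> sets (F s) \<subseteq> sets (F t)"
    "null_sets M \<subseteq> sets (F 0)"
proof -
  note D = assms[unfolded usual_filtration_def]
  show "0 \<le> t \<Longrightarrow> subalgebra M (F t)" using conjunct1[OF D] by blast
  show "0 \<le> s \<Longrightarrow> s \<le> t \<Longrightarrow> sets (F s) \<subseteq> sets (F t)" using conjunct1[OF conjunct2[OF D]] by blast
  show "null_sets M \<subseteq> sets (F 0)" by (rule conjunct2[OF conjunct2[OF conjunct2[OF conjunct2[OF D]]]])
qed

text \<open>A strong solution is adapted to the filtration generated by its data, hence to the given one, for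
which the increments of the Brownian motion are independent of the past.\<close>

lemma sets_augmented_filtration_subset:
  assumes F: "usual_filtration M F" and t: "0 \<le> t"
    and W: "\<And>s. 0 \<le> s \<Longrightarrow> W s \<in> borel_measurable (F s)" and \<xi>: "\<xi> \<in> borel_measurable (F 0)"
  shows "sets (augmented_filtration M W \<xi> t) \<subseteq> sets (F t)"
proof -
  note sub = usual_filtrationD(1)[OF F] and mono = usual_filtrationD(2)[OF F] and null = usual_filtrationD(3)[OF F]
  have sp: "0 \<le> s \<Longrightarrow> space (F s) = space M" for s using sub[of s] by (simp add: subalgebra_def)
  let ?G = "null_sets M \<union> {\<xi> -` A \<inter> space M | A. A \<in> sets borel} \<union>
     {W s -` A \<inter> space M | s A. 0 \<le> s \<and> s \<le> t \<and> A \<in> sets borel}"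
  have G: "?G \<subseteq> sets (F t)"
  proof -
    have "null_sets M \<subseteq> sets (F t)" using null mono[of 0 t] t by auto
    moreover have "\<xi> -` A \<inter> space M \<in> sets (F t)" if "A \<in> sets borel" for A
      using measurable_sets[OF \<xi> that] mono[of 0 t] t sp[of 0] by auto
    moreover have "W s -` A \<inter> space M \<in> sets (F t)" if "A \<in> sets borel" "0 \<le> s" "s \<le> t" for A s
      using measurable_sets[OF W[OF that(2)] that(1)] mono[of s t] that sp[of s] by auto
    ultimately show ?thesis by blast
  qed
  have "?G \<subseteq> Pow (space M)" using sets.sets_into_space[of _ M] by auto
  then have "sets (augmented_filtration M W \<xi> t) = sigma_sets (space M) ?G"
    unfolding augmented_filtration_def by (rule sets_measure_of)
  also have "\<dots> \<subseteq> sets (F t)"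
    using sets.sigma_sets_subset[OF G] sp[OF t] by simp
  finally show ?thesis .
qed

lemma set_integral_diff_Icc:
  fixes f :: "real \<Rightarrow> real"
  assumes f: "set_integrable lborel {0..T} f" and st: "0 \<le> s" "s \<le> t" "t \<le> T"
  shows "(LBINT r:{0..t}. f r) - (LBINT r:{0..s}. f r) = (LBINT r:{s..t}. f r)"
proof -
  have i: "set_integrable lborel {0..u} f" if "u \<le> T" for u
    by (rule set_integrable_subset[OF f]) (use that in auto)
  have "(LBINT r:{s..t}. f r) = (\<integral>r. indicator {0..t} r *\<^sub>R f r - indicator {0..s} r *\<^sub>R f r \<partial>lborel)"
    unfolding set_lebesgue_integral_def
  proof (rule integral_cong_AE)
    have m: "(\<lambda>r. indicator A r *\<^sub>R f r) \<in> borel_measurable lborel" if "A \<subseteq> {0..T}" "A \<in> sets borel" for A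
      using set_integrable_subset[OF f, of A] that unfolding set_integrable_def by auto
    show "(\<lambda>r. indicator {s..t} r *\<^sub>R f r) \<in> borel_measurable lborel" using st by (intro m) auto
    show "(\<lambda>r. indicator {0..t} r *\<^sub>R f r - indicator {0..s} r *\<^sub>R f r) \<in> borel_measurable lborel"
      using st by (intro borel_measurable_diff m) auto
    show "AE r in lborel. indicator {s..t} r *\<^sub>R f r = indicator {0..t} r *\<^sub>R f r - indicator {0..s} r *\<^sub>R f r"
      using AE_lborel_singleton[of s] by eventually_elim (use st in \<open>auto split: split_indicator\<close>)
  qed
  also have "\<dots> = (LBINT r:{0..t}. f r) - (LBINT r:{0..s}. f r)"
    unfolding set_lebesgue_integral_def
    by (rule Bochner_Integration.integral_diff) (use i[of t] i[of s] st in \<open>auto simp: set_integrable_def\<close>)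
  finally show ?thesis by simp
qed

lemma (in prob_space) brownian_increment:
  fixes W :: "real \<Rightarrow> 'a \<Rightarrow> real ^ 'n::finite"
  assumes F: "usual_filtration M F" and W: "standard_brownian_motion M F W" and st: "0 \<le> s" "s \<le> t"
  shows brownian_increment_moment: "0 \<le> q \<Longrightarrow> q \<le> real (2 * k) \<Longrightarrow>
      (\<integral>\<^sup>+ \<omega>. ennreal (\<bar>W t \<omega> $ l - W s \<omega> $ l\<bar> powr q) \<partial>M)
        \<le> ennreal ((t - s) powr (q / 2) * (1 + fact (2 * k) / (2 ^ k * fact k)))"
    and brownian_increment_integrable: "H \<in> borel_measurable (F s) \<Longrightarrow> integrable M H \<Longrightarrow>
      integrable M (\<lambda>\<omega>. H \<omega> * (W t \<omega> $ l - W s \<omega> $ l))"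
    and brownian_increment_centered: "H \<in> borel_measurable (F s) \<Longrightarrow> integrable M H \<Longrightarrow>
      (\<integral>\<omega>. H \<omega> * (W t \<omega> $ l - W s \<omega> $ l) \<partial>M) = 0"
proof -
  have sub: "subalgebra M (F s)" by (rule usual_filtrationD(1)[OF F st(1)])
  have D: "distributed M lborel (\<lambda>\<omega>. W t \<omega> - W s \<omega>) (\<lambda>x. ennreal (\<Prod>i\<in>UNIV. normal_density 0 (sqrt (t - s)) (x $ i)))"
    and ind: "indep_set (sets (F s)) (sets (vimage_algebra (space M) (\<lambda>\<omega>. W t \<omega> - W s \<omega>) borel))" if "s < t"
    using W st that unfolding standard_brownian_motion_def by blast+
  have Dl: "distributed M lborel (\<lambda>\<omega>. (W t \<omega> - W s \<omega>) $ l) (\<lambda>y. ennreal (normal_density 0 (sqrt (t - s)) y))" if "s < t"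
    using that by (intro distributed_normal_coordinate D) auto
  show "(\<integral>\<^sup>+ \<omega>. ennreal (\<bar>W t \<omega> $ l - W s \<omega> $ l\<bar> powr q) \<partial>M)
        \<le> ennreal ((t - s) powr (q / 2) * (1 + fact (2 * k) / (2 ^ k * fact k)))" if q: "0 \<le> q" "q \<le> real (2 * k)"
  proof (cases "s = t")
    case False
    then have "s < t" using st by simp
    have sq: "sqrt (t - s) powr q = (t - s) powr (q / 2)"
      using st by (simp add: powr_half_sqrt[symmetric] powr_powr)
    show ?thesis
      using normal_powr_moment_bound[OF _ q Dl[OF \<open>s < t\<close>] prob_space_axioms] \<open>s < t\<close> unfolding sq by simp
  qed simp
  assume H: "H \<in> borel_measurable (F s)" "integrable M H"
  have "integrable M (\<lambda>\<omega>. H \<omega> * (W t \<omega> $ l - W s \<omega> $ l)) \<and> (\<integral>\<omega>. H \<omega> * (W t \<omega> $ l - W s \<omega> $ l) \<partial>M) = 0"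
  proof (cases "s = t")
    case False
    then have lt: "s < t" using st by simp
    have Z: "(\<lambda>\<omega>. W t \<omega> - W s \<omega>) \<in> borel_measurable M" using distributed_measurable[OF D[OF lt]] by simp
    note n = normal_expectation[OF _ Dl[OF lt]]
    show ?thesis
      using indep_increment_product[OF sub Z ind[OF lt] H n] lt by simp
  qed simp
  then show "integrable M (\<lambda>\<omega>. H \<omega> * (W t \<omega> $ l - W s \<omega> $ l))"
    "(\<integral>\<omega>. H \<omega> * (W t \<omega> $ l - W s \<omega> $ l) \<partial>M) = 0" by auto
qed

text \<open>In the chamber the gap between adjacent particles is the smaller one, so the moment
assumption on adjacent pairs extends to all pairs.\<close>

lemma gap_moment_bound:
  fixes X :: "real \<Rightarrow> 'a \<Rightarrow> (real, 'n::{finite,linorder}) vec"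
  assumes mom: "\<And>i j t. adjacent i j \<Longrightarrow> t \<in> {0..T} \<Longrightarrow>
      (\<integral>\<^sup>+ \<omega>. ennreal (\<bar>X t \<omega> $ i - X t \<omega> $ j\<bar> powr (- q)) \<partial>M) \<le> ennreal C"
    and C: "0 \<le> C" and q: "0 \<le> q" and meas: "\<And>t. t \<in> {0..T} \<Longrightarrow> X t \<in> borel_measurable M"
    and D: "\<And>t. t \<in> {0..T} \<Longrightarrow> AE \<omega> in M. X t \<omega> \<in> Delta" and ij: "i \<noteq> j"
  shows "bounded_Lp M q {0..T} (\<lambda>t \<omega>. 1 / \<bar>X t \<omega> $ i - X t \<omega> $ j\<bar>)"
proof -
  have lt: "bounded_Lp M q {0..T} (\<lambda>t \<omega>. 1 / \<bar>X t \<omega> $ i - X t \<omega> $ j\<bar>)" if less: "i < j" for i j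
  proof -
    obtain s where s: "adjacent i s" "s \<le> j" by (rule exists_adjacent_between[OF less])
    then have below: "i < s" by (simp add: adjacent_def)
    show ?thesis
    proof (rule bounded_LpI[OF _ C])
      fix t assume t: "t \<in> {0..T}"
      note [measurable] = meas[OF t]
      show "(\<lambda>\<omega>. 1 / \<bar>X t \<omega> $ i - X t \<omega> $ j\<bar>) \<in> borel_measurable M" by measurable
      have "(\<integral>\<^sup>+ \<omega>. ennreal (\<bar>1 / \<bar>X t \<omega> $ i - X t \<omega> $ j\<bar>\<bar> powr q) \<partial>M)
          \<le> (\<integral>\<^sup>+ \<omega>. ennreal (\<bar>X t \<omega> $ i - X t \<omega> $ s\<bar> powr (- q)) \<partial>M)"
        using D[OF t]
      proof (intro nn_integral_mono_AE, eventually_elim)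
        fix \<omega> assume X: "X t \<omega> \<in> Delta"
        have 1: "X t \<omega> $ i < X t \<omega> $ s" using X below by (auto simp: Delta_def)
        have 2: "X t \<omega> $ s \<le> X t \<omega> $ j" using X s(2) by (cases "s = j") (auto simp: Delta_def less_imp_le)
        have "\<bar>1 / \<bar>X t \<omega> $ i - X t \<omega> $ j\<bar>\<bar> powr q = \<bar>X t \<omega> $ i - X t \<omega> $ j\<bar> powr (- q)"
          using 1 2 by (simp add: powr_divide powr_minus_divide)
        also have "\<dots> \<le> \<bar>X t \<omega> $ i - X t \<omega> $ s\<bar> powr (- q)"
          using 1 2 q by (intro powr_mono2') auto
        finally show "ennreal (\<bar>1 / \<bar>X t \<omega> $ i - X t \<omega> $ j\<bar>\<bar> powr q) \<le> ennreal (\<bar>X t \<omega> $ i - X t \<omega> $ s\<bar> powr (- q))"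
          by (rule ennreal_leI)
      qed
      also have "\<dots> \<le> ennreal C" by (rule mom[OF s(1) t])
      finally show "(\<integral>\<^sup>+ \<omega>. ennreal (\<bar>1 / \<bar>X t \<omega> $ i - X t \<omega> $ j\<bar>\<bar> powr q) \<partial>M) \<le> ennreal C" .
    qed
  qed
  show ?thesis
  proof (cases "i < j")
    case False
    then have "j < i" using ij by simp
    from lt[OF this] show ?thesis by (simp only: abs_minus_commute)
  qed (rule lt)
qed

text \<open>The scheme acts path by path, so a change of its data on a null set changes it only there.\<close>

lemma semi_implicit_EM_cong:
  assumes "\<And>t. W t \<omega> = W' t \<omega>" "\<xi> \<omega> = \<xi>' \<omega>"
  shows "semi_implicit_EM \<gamma> b \<sigma> W T \<xi> n k \<omega> = semi_implicit_EM \<gamma> b \<sigma> W' T \<xi>' n k \<omega>"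
  by (induction k) (simp_all add: assms)

theorem theorem2p9:
  fixes M :: "'a measure"
    and F :: "real \<Rightarrow> 'a measure"
    and W X :: "real \<Rightarrow> 'a \<Rightarrow> (real, 'n::{finite,linorder}) vec"
    and \<gamma> \<sigma> :: "'n \<Rightarrow> 'n \<Rightarrow> real"
    and b :: "'n \<Rightarrow> (real, 'n) vec \<Rightarrow> real"
    and T p p_hat C_hat :: real
  assumes "CARD('n) \<ge> 2" and "T > 0"
    and "prob_space M" and "usual_filtration M F" and "standard_brownian_motion M F W"
    and "X 0 \<in> borel_measurable (F 0)" and A1: "AE \<omega> in M. X 0 \<omega> \<in> Delta"
    and A2: "\<And>i j. i \<noteq> j \<Longrightarrow> \<gamma> i j = \<gamma> j i \<and> \<gamma> i j \<ge> 0" "\<And>i j. adjacent i j \<Longrightarrow> \<gamma> i j > 0"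
    and A3: "\<And>i. \<exists>L. L-lipschitz_on UNIV (b i)"
    and "unique_strong_solution M W \<gamma> b \<sigma> T (X 0) X"
    and "p \<ge> 2" and "p_hat = 4 * p" and "C_hat > 0"
    and moments: "(SUP t\<in>{0..T}. \<integral>\<^sup>+ \<omega>. ennreal (norm (X t \<omega>) powr p_hat) \<partial>M)
      + (MAX (i, j)\<in>{(i, j). adjacent i j}. SUP t\<in>{0..T}.
          \<integral>\<^sup>+ \<omega>. ennreal (\<bar>X t \<omega> $ i - X t \<omega> $ j\<bar> powr (- p_hat)) \<partial>M)
      < ennreal C_hat"
    and increments: "\<And>s t. 0 \<le> s \<Longrightarrow> s < t \<Longrightarrow> t \<le> T \<Longrightarrow>
      (\<integral>\<^sup>+ \<omega>. ennreal (norm (X t \<omega> - X s \<omega>) powr p_hat) \<partial>M)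
        \<le> ennreal (C_hat * \<bar>t - s\<bar> powr (p_hat / 2))"
    and "\<And>i. Cb2 (b i)"
  shows "\<exists>C>0. \<forall>n::nat. n \<ge> 1 \<longrightarrow> T / real n \<le> 1 \<longrightarrow>
    (let error = (\<lambda>\<omega>. SUP k\<in>{1..n}.
           norm (X (real k * T / real n) \<omega>
             - semi_implicit_EM \<gamma> b (\<lambda>i j x. \<sigma> i j) W T (X 0) n k \<omega>) powr p)
     in integrable M error \<and> (\<integral>\<omega>. error \<omega> \<partial>M) powr (1 / p) \<le> C / real n)"
proof -
  note T = \<open>T > 0\<close> and p = \<open>p \<ge> 2\<close> and UF = \<open>usual_filtration M F\<close>
    and BM = \<open>standard_brownian_motion M F W\<close> and X0 = \<open>X 0 \<in> borel_measurable (F 0)\<close>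
  interpret prob_space M by fact
  interpret repulsion \<gamma> using A2 by unfold_locales auto
  note sub = usual_filtrationD(1)[OF UF] and mono = usual_filtrationD(2)[OF UF] and null = usual_filtrationD(3)[OF UF]
  have spF: "space (F t) = space M" if "0 \<le> t" for t using sub[OF that] by (simp add: subalgebra_def)
  have W_F: "W t \<in> borel_measurable (F t)" if "0 \<le> t" for t
    using BM that unfolding standard_brownian_motion_def by blast
  have sol: "strong_solution M W \<gamma> b \<sigma> T (X 0) X"
    using \<open>unique_strong_solution M W \<gamma> b \<sigma> T (X 0) X\<close> unfolding unique_strong_solution_def by auto
  have X_F: "X t \<in> borel_measurable (F t)" if t: "t \<in> {0..T}" for t
  proof (rule measurableI)
    have Xt: "X t \<in> borel_measurable (augmented_filtration M W (X 0) t)"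
      using sol t unfolding strong_solution_def by auto
    fix A :: "(real, 'n) vec set" assume "A \<in> sets borel"
    then have "X t -` A \<inter> space (augmented_filtration M W (X 0) t) \<in> sets (augmented_filtration M W (X 0) t)"
      using Xt by (rule measurable_sets[rotated])
    then have "X t -` A \<inter> space (augmented_filtration M W (X 0) t) \<in> sets (F t)"
      using sets_augmented_filtration_subset[OF UF _ W_F X0] t by auto
    moreover have "space (augmented_filtration M W (X 0) t) = space M"
      by (simp add: augmented_filtration_def space_measure_of_conv)
    ultimately show "X t -` A \<inter> space (F t) \<in> sets (F t)" using spF[of t] t by simp
  qed auto

  \<comment> \<open>All path properties hold outside a single null set \<open>N\<close>. Null sets belong to \<open>F 0\<close>, so changing the
processes on \<open>N\<close> to constants keeps them adapted.\<close>
  define good where "good \<omega> \<longleftrightarrow> continuous_on {0..T} (\<lambda>t. X t \<omega>) \<and> (\<forall>t\<in>{0..T}. X t \<omega> \<in> Delta)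
      \<and> continuous_on {0..} (\<lambda>t. W t \<omega>)" for \<omega>
  have "AE \<omega> in M. good \<omega>"
    unfolding good_def
    using sol BM unfolding strong_solution_def standard_brownian_motion_def by (intro AE_conjI) auto
  then obtain N where N: "{\<omega> \<in> space M. \<not> good \<omega>} \<subseteq> N" "N \<in> null_sets M"
    using AE_E2 unfolding eventually_ae_filter by (metis (mono_tags, lifting) AE_E eventually_ae_filter)
  have NF: "N \<in> sets (F t)" if "0 \<le> t" for t using N(2) null mono[OF order_refl that] by auto
  have outside: "AE \<omega> in M. \<omega> \<notin> N" by (rule AE_not_in[OF N(2)])

  define x0 :: "(real, 'n) vec" where "x0 = (\<chi> i. real (card {k. k < i}))"
  define X' where "X' t \<omega> = (if \<omega> \<in> N then x0 else X t \<omega>)" for t \<omega>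
  define W' where "W' t \<omega> = (if \<omega> \<in> N then 0 else W t \<omega>)" for t \<omega>
  have modify: "(\<lambda>\<omega>. if \<omega> \<in> N then c else f \<omega>) \<in> borel_measurable (F t)"
    if "0 \<le> t" "f \<in> borel_measurable (F t)" for t f and c :: "(real, 'n) vec"
    using that NF[OF that(1)] by (intro measurable_If_set) (auto intro: sets.Int)
  have goodN: "good \<omega>" if "\<omega> \<in> space M" "\<omega> \<notin> N" for \<omega> using N(1) that by auto

  have ex_b: "\<exists>B g. 0 \<le> B \<and> (\<forall>x. \<bar>b i x\<bar> \<le> B) \<and> (\<forall>x. norm (g x) \<le> B) \<and> continuous_on UNIV g \<and>
    (\<forall>x y. \<bar>b i x - b i y\<bar> \<le> B * norm (x - y)) \<and>
    (\<forall>x y. \<bar>b i y - b i x - g x \<bullet> (y - x)\<bar> \<le> B * (norm (y - x))\<^sup>2)" for i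
    by (rule Cb2_expansion[OF \<open>\<And>i. Cb2 (b i)\<close>[of i]]) blast
  then obtain Bi b' where Bi: "\<And>i. 0 \<le> Bi i" "\<And>i x. \<bar>b i x\<bar> \<le> Bi i" "\<And>i x. norm (b' i x) \<le> Bi i"
    "\<And>i. continuous_on UNIV (b' i)" "\<And>i x y. \<bar>b i x - b i y\<bar> \<le> Bi i * norm (x - y)"
    "\<And>i x y. \<bar>b i y - b i x - b' i x \<bullet> (y - x)\<bar> \<le> Bi i * (norm (y - x))\<^sup>2"
    by metis
  define B where "B = (\<Sum>i\<in>UNIV. Bi i)"
  have B: "Bi i \<le> B" "0 \<le> B" for i
    unfolding B_def using Bi(1) by (auto intro!: member_le_sum sum_nonneg)

  have gap: "(\<integral>\<^sup>+ \<omega>. ennreal (\<bar>X t \<omega> $ i - X t \<omega> $ j\<bar> powr (- (4 * p))) \<partial>M) \<le> ennreal C_hat"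
    if ij: "adjacent i j" and t: "t \<in> {0..T}" for i j t
  proof -
    let ?f = "\<lambda>(i, j). SUP t\<in>{0..T}. \<integral>\<^sup>+ \<omega>. ennreal (\<bar>X t \<omega> $ i - X t \<omega> $ j\<bar> powr (- p_hat)) \<partial>M"
    have "(\<integral>\<^sup>+ \<omega>. ennreal (\<bar>X t \<omega> $ i - X t \<omega> $ j\<bar> powr (- p_hat)) \<partial>M) \<le> ?f (i, j)"
      unfolding prod.case by (rule SUP_upper[OF t])
    also have "\<dots> \<le> Max (?f ` {(i, j). adjacent i j})"
      using ij by (intro Max_ge imageI) auto
    also have "\<dots> \<le> ennreal C_hat"
      using moments by (metis (no_types, lifting) add_increasing le_less_trans less_imp_le zero_le order_refl add_mono add_0)
    finally show ?thesis using \<open>p_hat = 4 * p\<close> by simp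
  qed

  interpret ps: particle_system M \<gamma> F W' X' \<sigma> b b' T p B
  proof unfold_locales
    show "subalgebra M (F t)" if "0 \<le> t" for t by (rule sub[OF that])
    show "sets (F s) \<subseteq> sets (F t)" if "0 \<le> s" "s \<le> t" for s t by (rule mono[OF that])
    show "X' t \<in> borel_measurable (F t)" if "t \<in> {0..T}" for t
      unfolding X'_def[abs_def] using that by (intro modify X_F) auto
    show "W' t \<in> borel_measurable (F t)" if "t \<in> {0..T}" for t
      unfolding W'_def[abs_def] using that by (intro modify W_F) auto
    show "continuous_on {0..T} (\<lambda>t. X' t \<omega>)" if "\<omega> \<in> space M" for \<omega>
      using goodN[OF that] by (cases "\<omega> \<in> N") (auto simp: X'_def good_def)
    show "continuous_on {0..T} (\<lambda>t. W' t \<omega>)" if "\<omega> \<in> space M" for \<omega>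
      using goodN[OF that]
      by (cases "\<omega> \<in> N") (auto simp: W'_def good_def intro: continuous_on_subset)
    show "X' t \<omega> \<in> Delta" if "\<omega> \<in> space M" "t \<in> {0..T}" for \<omega> t
      using goodN[OF that(1)] that(2) Delta_nonempty by (cases "\<omega> \<in> N") (auto simp: X'_def good_def x0_def)
    have "AE \<omega> in M. \<forall>i. set_integrable lborel {0..T} (\<lambda>s. interaction \<gamma> (X s \<omega>) i + b i (X s \<omega>)) \<and>
      (\<forall>t\<in>{0..T}. X t \<omega> $ i = X 0 \<omega> $ i + (LBINT s:{0..t}. interaction \<gamma> (X s \<omega>) i + b i (X s \<omega>))
        + (\<Sum>j\<in>UNIV. \<sigma> i j * W t \<omega> $ j))" using sol unfolding strong_solution_def by blast
    then show "AE \<omega> in M. \<forall>s t i. 0 \<le> s \<longrightarrow> s \<le> t \<longrightarrow> t \<le> T \<longrightarrow>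
      X' t \<omega> $ i - X' s \<omega> $ i = (LBINT r:{s..t}. interaction \<gamma> (X' r \<omega>) i + b i (X' r \<omega>))
        + (\<Sum>j\<in>UNIV. \<sigma> i j * (W' t \<omega> $ j - W' s \<omega> $ j))"
      using outside
    proof eventually_elim
      fix \<omega> assume eq: "\<forall>i. set_integrable lborel {0..T} (\<lambda>s. interaction \<gamma> (X s \<omega>) i + b i (X s \<omega>)) \<and>
        (\<forall>t\<in>{0..T}. X t \<omega> $ i = X 0 \<omega> $ i + (LBINT s:{0..t}. interaction \<gamma> (X s \<omega>) i + b i (X s \<omega>))
          + (\<Sum>j\<in>UNIV. \<sigma> i j * W t \<omega> $ j))" and nN: "\<omega> \<notin> N"
      show "\<forall>s t i. 0 \<le> s \<longrightarrow> s \<le> t \<longrightarrow> t \<le> T \<longrightarrow>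
        X' t \<omega> $ i - X' s \<omega> $ i = (LBINT r:{s..t}. interaction \<gamma> (X' r \<omega>) i + b i (X' r \<omega>))
          + (\<Sum>j\<in>UNIV. \<sigma> i j * (W' t \<omega> $ j - W' s \<omega> $ j))"
      proof (intro allI impI)
        fix s t i assume st: "0 \<le> s" "s \<le> t" "t \<le> T"
        have i: "set_integrable lborel {0..T} (\<lambda>s. interaction \<gamma> (X s \<omega>) i + b i (X s \<omega>))" using eq by blast
        have "X t \<omega> $ i - X s \<omega> $ i = ((LBINT s:{0..t}. interaction \<gamma> (X s \<omega>) i + b i (X s \<omega>))
            - (LBINT s:{0..s}. interaction \<gamma> (X s \<omega>) i + b i (X s \<omega>)))
            + ((\<Sum>j\<in>UNIV. \<sigma> i j * W t \<omega> $ j) - (\<Sum>j\<in>UNIV. \<sigma> i j * W s \<omega> $ j))"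
        proof -
          have "X u \<omega> $ i = X 0 \<omega> $ i + (LBINT s:{0..u}. interaction \<gamma> (X s \<omega>) i + b i (X s \<omega>))
              + (\<Sum>j\<in>UNIV. \<sigma> i j * W u \<omega> $ j)" if "0 \<le> u" "u \<le> T" for u
            by (rule bspec[OF conjunct2[OF spec[OF eq]]]) (use that in simp)
          from this[of t] this[of s] show ?thesis using st by linarith
        qed
        also have "\<dots> = (LBINT r:{s..t}. interaction \<gamma> (X r \<omega>) i + b i (X r \<omega>))
            + (\<Sum>j\<in>UNIV. \<sigma> i j * (W t \<omega> $ j - W s \<omega> $ j))"
          unfolding set_integral_diff_Icc[OF i st] by (simp add: right_diff_distrib sum_subtractf)
        finally show "X' t \<omega> $ i - X' s \<omega> $ i = (LBINT r:{s..t}. interaction \<gamma> (X' r \<omega>) i + b i (X' r \<omega>))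
          + (\<Sum>j\<in>UNIV. \<sigma> i j * (W' t \<omega> $ j - W' s \<omega> $ j))"
          using nN by (simp add: X'_def W'_def)
      qed
    qed
    show "bounded_Lp M (4 * p) {0..T} (\<lambda>t \<omega>. 1 / \<bar>X' t \<omega> $ i - X' t \<omega> $ j\<bar>)" if "i \<noteq> j" for i j
    proof (rule gap_moment_bound[OF _ _ _ _ _ that])
      show "(\<integral>\<^sup>+ \<omega>. ennreal (\<bar>X' t \<omega> $ i - X' t \<omega> $ j\<bar> powr (- (4 * p))) \<partial>M) \<le> ennreal C_hat"
        if "adjacent i j" "t \<in> {0..T}" for i j t
      proof -
        have "(\<integral>\<^sup>+ \<omega>. ennreal (\<bar>X' t \<omega> $ i - X' t \<omega> $ j\<bar> powr (- (4 * p))) \<partial>M)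
            = (\<integral>\<^sup>+ \<omega>. ennreal (\<bar>X t \<omega> $ i - X t \<omega> $ j\<bar> powr (- (4 * p))) \<partial>M)"
          using outside by (intro nn_integral_cong_AE, eventually_elim) (simp add: X'_def)
        then show ?thesis using gap[OF that] by simp
      qed
      show "X' t \<in> borel_measurable M" if "t \<in> {0..T}" for t
      proof -
        have "0 \<le> t" using that by simp
        from measurable_from_subalg[OF sub[OF this] modify[OF this X_F[OF that]]]
        show ?thesis unfolding X'_def[abs_def] .
      qed
      show "AE \<omega> in M. X' t \<omega> \<in> Delta" if "t \<in> {0..T}" for t
        using goodN that Delta_nonempty by (intro AE_I2) (auto simp: X'_def good_def x0_def)
    qed (use \<open>C_hat > 0\<close> p in auto)
    show "\<exists>K\<ge>0. \<forall>s t. 0 \<le> s \<longrightarrow> s \<le> t \<longrightarrow> t \<le> T \<longrightarrow>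
      (\<integral>\<^sup>+ \<omega>. ennreal (\<bar>W' t \<omega> $ l - W' s \<omega> $ l\<bar> powr (8 * p)) \<partial>M) \<le> ennreal ((t - s) powr (4 * p) * K)" for l
    proof -
      \<comment> \<open>The moments of a normal variable are explicit for even integers, so \<open>8 p\<close> is rounded up to \<open>2 m\<close>.\<close>
      define m where "m = nat \<lceil>4 * p\<rceil>"
      have m: "0 \<le> 8 * p" "8 * p \<le> real (2 * m)" using p by (auto simp: m_def)
      have "(\<integral>\<^sup>+ \<omega>. ennreal (\<bar>W' t \<omega> $ l - W' s \<omega> $ l\<bar> powr (8 * p)) \<partial>M)
          \<le> ennreal ((t - s) powr (4 * p) * (1 + fact (2 * m) / (2 ^ m * fact m)))" if "0 \<le> s" "s \<le> t" for s t
      proof -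
        have "(\<integral>\<^sup>+ \<omega>. ennreal (\<bar>W' t \<omega> $ l - W' s \<omega> $ l\<bar> powr (8 * p)) \<partial>M)
            = (\<integral>\<^sup>+ \<omega>. ennreal (\<bar>W t \<omega> $ l - W s \<omega> $ l\<bar> powr (8 * p)) \<partial>M)"
          using outside by (intro nn_integral_cong_AE, eventually_elim) (simp add: W'_def)
        then show ?thesis using brownian_increment_moment[OF UF BM that m, of l] by simp
      qed
      then show ?thesis by (intro exI[of _ "1 + fact (2 * m) / (2 ^ m * fact m)"]) auto
    qed
    show "integrable M (\<lambda>\<omega>. H \<omega> * (W' t \<omega> $ l - W' s \<omega> $ l)) \<and> (\<integral>\<omega>. H \<omega> * (W' t \<omega> $ l - W' s \<omega> $ l) \<partial>M) = 0"
      if st: "0 \<le> s" "s \<le> t" "t \<le> T" and H: "H \<in> borel_measurable (F s)" "integrable M H" for s t H l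
    proof -
      have HM: "H \<in> borel_measurable M" using H(2) by auto
      have WM: "W u \<in> borel_measurable M" "W' u \<in> borel_measurable M" if "0 \<le> u" for u
        unfolding W'_def[abs_def] using that measurable_from_subalg[OF sub[OF that] W_F[OF that]]
          measurable_from_subalg[OF sub[OF that] modify[OF that W_F[OF that]]] by auto
      have t0: "0 \<le> t" using st by simp
      note [measurable] = HM WM[OF st(1)] WM[OF t0]
      have ae: "AE \<omega> in M. H \<omega> * (W t \<omega> $ l - W s \<omega> $ l) = H \<omega> * (W' t \<omega> $ l - W' s \<omega> $ l)"
        using outside by eventually_elim (simp add: W'_def)
      have m1: "(\<lambda>\<omega>. H \<omega> * (W t \<omega> $ l - W s \<omega> $ l)) \<in> borel_measurable M" by measurable
      have m2: "(\<lambda>\<omega>. H \<omega> * (W' t \<omega> $ l - W' s \<omega> $ l)) \<in> borel_measurable M" by measurable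
      show ?thesis
        using brownian_increment_integrable[OF UF BM st(1,2) H, of l] brownian_increment_centered[OF UF BM st(1,2) H, of l]
          integrable_cong_AE[OF m1 m2 ae] integral_cong_AE[OF m1 m2 ae] by simp
    qed
    show "\<bar>b i x\<bar> \<le> B" for i x using Bi(2)[of i x] B(1)[of i] by linarith
    show "norm (b' i x) \<le> B" for i x using Bi(3)[of i x] B(1)[of i] by linarith
    show "\<bar>b i x - b i y\<bar> \<le> B * norm (x - y)" for i x y
      by (rule order_trans[OF Bi(5) mult_right_mono[OF B(1)]]) auto
    show "\<bar>b i y - b i x - b' i x \<bullet> (y - x)\<bar> \<le> B * (norm (y - x))\<^sup>2" for i x y
      by (rule order_trans[OF Bi(6) mult_right_mono[OF B(1)]]) auto
  qed (use T p B Bi(4) in auto)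

  obtain C where C: "0 \<le> C" "\<And>n::nat. 1 \<le> n \<Longrightarrow> T / real n \<le> 1 \<Longrightarrow>
    (\<integral>\<^sup>+ \<omega>. ennreal ((MAX k\<in>{..n}. norm (X' (real k * T / real n) \<omega>
        - semi_implicit_EM \<gamma> b (\<lambda>i j x. \<sigma> i j) W' T (X' 0) n k \<omega>)) powr p) \<partial>M)
      \<le> ennreal ((T / real n) powr p * C)"
    using ps.error_bound by blast
  show ?thesis
  proof (intro exI[of _ "T * C powr (1 / p) + 1"] conjI allI impI)
    show "0 < T * C powr (1 / p) + 1" using T by (simp add: add_nonneg_pos)
    fix n :: nat assume n: "1 \<le> n" "T / real n \<le> 1"
    define err where "err k \<omega> = norm (X (real k * T / real n) \<omega>
        - semi_implicit_EM \<gamma> b (\<lambda>i j x. \<sigma> i j) W T (X 0) n k \<omega>)" for k \<omega>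
    define error where "error \<omega> = (SUP k\<in>{1..n}. err k \<omega> powr p)" for \<omega>
    have err_M: "err k \<in> borel_measurable M" if k: "k \<le> n" for k
    proof -
      have h: "0 < T / real n" using T n by simp
      have XM: "X t \<in> borel_measurable M" if "t \<in> {0..T}" for t
        using X_F[OF that] sub[of t] that by (auto intro: measurable_from_subalg)
      have WM: "W t \<in> borel_measurable M" if "0 \<le> t" for t
        using W_F[OF that] sub[OF that] by (auto intro: measurable_from_subalg)
      have S: "semi_implicit_EM \<gamma> b (\<lambda>i j x. \<sigma> i j) W T (X 0) n k \<in> borel_measurable M"
        using T by (intro semi_implicit_EM_measurable[OF h] ps.b_meas XM WM) auto
      have "real k * T / real n \<in> {0..T}"
      proof -
        have "real k * T \<le> real n * T" using k T by (intro mult_right_mono) auto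
        then show ?thesis using T n by (simp add: divide_le_eq mult.commute)
      qed
      then have "(\<lambda>\<omega>. X (real k * T / real n) \<omega> - semi_implicit_EM \<gamma> b (\<lambda>i j x. \<sigma> i j) W T (X 0) n k \<omega>) \<in> borel_measurable M"
        by (intro borel_measurable_diff XM S)
      from measurable_compose[OF this borel_measurable_norm] show ?thesis unfolding err_def[abs_def] .
    qed
    have error_M: "error \<in> borel_measurable M"
      unfolding error_def[abs_def]
    proof (rule borel_measurable_cSUP)
      show "(\<lambda>\<omega>. err k \<omega> powr p) \<in> borel_measurable M" if "k \<in> {1..n}" for k
      proof -
        have [measurable]: "err k \<in> borel_measurable M" using err_M[of k] that by simp
        show ?thesis by measurable
      qed
    qed auto
    have error_nonneg: "0 \<le> error \<omega>" for \<omega>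
    proof -
      have "0 \<le> err 1 \<omega> powr p" by simp
      also have "\<dots> \<le> error \<omega>" unfolding error_def using n by (intro cSUP_upper) auto
      finally show ?thesis .
    qed
    have "(\<integral>\<^sup>+ \<omega>. ennreal (error \<omega>) \<partial>M) \<le> (\<integral>\<^sup>+ \<omega>. ennreal ((MAX k\<in>{..n}. norm (X' (real k * T / real n) \<omega>
        - semi_implicit_EM \<gamma> b (\<lambda>i j x. \<sigma> i j) W' T (X' 0) n k \<omega>)) powr p) \<partial>M)"
      using outside
    proof (intro nn_integral_mono_AE, eventually_elim)
      fix \<omega> assume nN: "\<omega> \<notin> N"
      have eq: "norm (X' (real k * T / real n) \<omega> - semi_implicit_EM \<gamma> b (\<lambda>i j x. \<sigma> i j) W' T (X' 0) n k \<omega>) = err k \<omega>" for k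
        using nN semi_implicit_EM_cong[of W' \<omega> W "X' 0" "X 0"] by (simp add: err_def X'_def W'_def)
      have "error \<omega> \<le> (MAX k\<in>{..n}. err k \<omega>) powr p"
        unfolding error_def
      proof (rule cSUP_least)
        fix k assume "k \<in> {1..n}"
        then show "err k \<omega> powr p \<le> (MAX k\<in>{..n}. err k \<omega>) powr p"
          using p by (intro powr_mono2 Max_ge) (auto simp: err_def)
      qed (use n in auto)
      then show "ennreal (error \<omega>) \<le> ennreal ((MAX k\<in>{..n}. norm (X' (real k * T / real n) \<omega>
        - semi_implicit_EM \<gamma> b (\<lambda>i j x. \<sigma> i j) W' T (X' 0) n k \<omega>)) powr p)"
        unfolding eq by (rule ennreal_leI)
    qed
    also have "\<dots> \<le> ennreal ((T / real n) powr p * C)" by (rule C(2)[OF n])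
    finally have le: "(\<integral>\<^sup>+ \<omega>. ennreal (error \<omega>) \<partial>M) \<le> ennreal ((T / real n) powr p * C)" .
    have int: "integrable M error"
      using le error_nonneg by (intro integrableI_bounded error_M) (auto intro: le_less_trans)
    have "ennreal (\<integral>\<omega>. error \<omega> \<partial>M) \<le> ennreal ((T / real n) powr p * C)"
      using le int error_nonneg by (subst nn_integral_eq_integral[symmetric]) auto
    then have "(\<integral>\<omega>. error \<omega> \<partial>M) \<le> (T / real n) powr p * C"
      using C(1) by (simp add: ennreal_le_iff)
    then have "(\<integral>\<omega>. error \<omega> \<partial>M) powr (1 / p) \<le> ((T / real n) powr p * C) powr (1 / p)"
      using p error_nonneg by (intro powr_mono2 integral_nonneg_AE) auto
    also have "\<dots> = T / real n * C powr (1 / p)"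
      using T n p C(1) by (simp add: powr_mult powr_powr)
    also have "\<dots> \<le> (T * C powr (1 / p) + 1) / real n" by (simp add: add_divide_distrib)
    finally show "let error = (\<lambda>\<omega>. SUP k\<in>{1..n}.
           norm (X (real k * T / real n) \<omega>
             - semi_implicit_EM \<gamma> b (\<lambda>i j x. \<sigma> i j) W T (X 0) n k \<omega>) powr p)
     in integrable M error \<and> (\<integral>\<omega>. error \<omega> \<partial>M) powr (1 / p) \<le> (T * C powr (1 / p) + 1) / real n"
      using int unfolding Let_def error_def err_def by blast
  qed
qed

end
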